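(* Let $\mathcal{F}$ be the weighted unanchored Sobolev space over $\mathbb{R}^s$ determined by the density $\phi$, the weight parameters $\bm{\gamma}=(\gamma_u)_{u\subseteq\{1:s\}}$ and the weight functions $\bm{\psi}=(\psi_j)_{j=1}^s$. Let $r>\frac12$ be such that for each $j\in\{1:s\}$ there are $C_j>0$ and $r_j\ge r$ with $\widehat{\theta}_j(h)\le C_j|h|^{-2r_j}$ for all $h\in\mathbb{Z}\setminus\{0\}$. Then for every $\epsilon\in(0,r-\frac12]$ there is a constant $c=c(r,\bm{\gamma},\epsilon,\phi,\bm{\psi})>0$, independent of $N$, $k$ and $\rho$, such that for every positive integer $N$, every odd integer $k\ge 3$ and every $\rho\in(0,1)$, $$\sup_{f\in\mathcal{F},\ \Vert f\Vert_{\mathcal{F}}\le 1}\mathbb{P}\left[\left|M_k(f)-I_{\bm{\phi}}(f)\right|\ge \frac{c}{\rho^{\frac12+r-\epsilon}}\,N^{-r+\epsilon}\right]\le \frac{\rho^{\frac{k+1}{2}}}{4}.$$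
   Context: Let $s\ge 1$ and $\{1:s\}=\{1,\dots,s\}$. $\phi$ is a probability density on $\mathbb{R}$ with distribution function $\Phi$, assumed to have an inverse $\Phi^{-1}:(0,1)\to\mathbb{R}$. Put $\bm{\phi}(\bm{y})=\prod_{j=1}^s\phi(y_j)$, let $\bm{\Phi}^{-1}$ denote $\Phi^{-1}$ applied componentwise, and $I_{\bm{\phi}}(f)=\int_{\mathbb{R}^s}f(\bm{y})\bm{\phi}(\bm{y})\,d\bm{y}$. Function space: given weight parameters $\gamma_u>0$ for $u\subseteq\{1:s\}$ with $\gamma_\emptyset=1$, and weight functions $\psi_j:\mathbb{R}\to\mathbb{R}_+$ (positive), $j=1,\dots,s$, the weighted unanchored Sobolev space $\mathcal{F}$ is the space of locally integrable functions on $\mathbb{R}^s$ for which the norm $$\Vert f\Vert_{\mathcal{F}}^2=\sum_{u\subseteq\{1:s\}}\gamma_u^{-1}\int_{\mathbb{R}^{|u|}}\left(\int_{\mathbb{R}^{s-|u|}}\frac{\partial^{|u|}f}{\partial\bm{y}_u}(\bm{y})\prod_{j\in -u}\phi(y_j)\,d\bm{y}_{-u}\right)^2\prod_{j\in u}\psi_j^2(y_j)\,d\bm{y}_u$$ is finite; here $-u=\{1:s\}\setminus u$, $\bm{y}_u=(y_j)_{j\in u}$, and $\partial^{|u|}/\partial\bm{y}_u$ is the (weak) mixed first partial derivative in the variables $y_j$, $j\in u$. Standing assumption: for every $j$ and every finite $c$, $\int_{-\infty}^{c}\frac{\Phi(y)}{\psi_j^2(y)}dy<\infty$ and $\int_c^\infty\frac{1-\Phi(y)}{\psi_j^2(y)}dy<\infty$.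 Under this assumption it is known that $\mathcal{F}$ is a reproducing kernel Hilbert space embedded in $L^2(\mathbb{R}^s,\bm{\phi}(\bm{y})d\bm{y})$, so point evaluations of $f\in\mathcal{F}$ make sense. For $h\in\mathbb{Z}\setminus\{0\}$: $\widehat{\theta}_j(h)=\frac{1}{\pi^2h^2}\int_{\mathbb{R}}\frac{\sin^2(\pi h\Phi(t))}{\psi_j^2(t)}\,dt$. Median estimator: for a positive integer $N$ let $G_N=\{a\in\{1,\dots,N\}:\gcd(a,N)=1\}$. For odd $k$, let $\bm{Z}_1,\dots,\bm{Z}_k$ be uniform on $G_N^s$ and $\bm{\Delta}_1,\dots,\bm{\Delta}_k$ uniform on $[0,1]^s$, all $2k$ random vectors independent, and $$M_k(f)=\underset{1\le l\le k}{\operatorname{median}}\ \frac1N\sum_{n=1}^{N}f\circ\bm{\Phi}^{-1}\left(\left\{\frac{n\bm{Z}_l}{N}+\bm{\Delta}_l\right\}\right),$$ where $\{\cdot\}$ is the componentwise fractional part. *)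

theory Defs
  imports "HOL-Probability.Probability"
begin

text \<open>
  The coordinates \<open>1,\<dots>,s\<close> are the elements of a finite type \<open>'s\<close>, points of the
  ambient space are of type \<open>real ^ 's\<close>, and a set \<open>u\<close> of coordinates has type \<open>'s set\<close>
  with complement \<open>- u\<close>.  Integrals over the variables \<open>y\<^sub>u\<close> are taken with respect to
  the product measure \<open>PiM u (\<lambda>_. lborel)\<close>.
\<close>

section \<open>The density and its distribution function\<close>

definition prob_density :: "(real \<Rightarrow> real) \<Rightarrow> bool" where
  "prob_density \<phi> \<longleftrightarrow>
     \<phi> \<in> borel_measurable borel \<and> (\<forall>x. 0 \<le> \<phi> x) \<and> prob_space (density lborel (\<lambda>x. ennreal (\<phi> x)))"

definition dist_fun :: "(real \<Rightarrow> real) \<Rightarrow> real \<Rightarrow> real" where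
  "dist_fun \<phi> = cdf (density lborel (\<lambda>x. ennreal (\<phi> x)))"

text \<open>
  The inverse is only meant on \<open>(0,1)\<close>, so the support of the density may be any interval.
  Outside of \<open>(0,1)\<close> the value of \<open>dist_inv \<phi>\<close> is irrelevant.
\<close>

definition dist_invertible :: "(real \<Rightarrow> real) \<Rightarrow> bool" where
  "dist_invertible \<phi> \<longleftrightarrow> (\<forall>p\<in>{0<..<1}. \<exists>!y. dist_fun \<phi> y = p)"

definition dist_inv :: "(real \<Rightarrow> real) \<Rightarrow> real \<Rightarrow> real" where
  "dist_inv \<phi> p = (THE y. dist_fun \<phi> y = p)"

definition weighted_integral :: "(real \<Rightarrow> real) \<Rightarrow> (real ^ 's::finite \<Rightarrow> real) \<Rightarrow> real" where
  "weighted_integral \<phi> f = (LINT y|lborel. f y * (\<Prod>j\<in>UNIV. \<phi> (y $ j)))"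

section \<open>Weak mixed derivatives\<close>

definition partial_deriv :: "'s \<Rightarrow> (real ^ 's::finite \<Rightarrow> real) \<Rightarrow> real ^ 's \<Rightarrow> real" where
  "partial_deriv j f x = frechet_derivative f (at x) (axis j 1)"

text \<open>
  Differentiability at each point of all iterated partial derivatives is the same as being
  \<open>C\<^sup>\<infinity>\<close>: it makes each iterated partial derivative continuous.
\<close>

definition test_function :: "(real ^ 's::finite \<Rightarrow> real) \<Rightarrow> bool" where
  "test_function \<eta> \<longleftrightarrow>
     (\<forall>js x. (foldr partial_deriv js \<eta>) differentiable (at x)) \<and> compact (closure {x. \<eta> x \<noteq> 0})"

definition locally_integrable :: "(real ^ 's::finite \<Rightarrow> real) \<Rightarrow> bool" where
  "locally_integrable f \<longleftrightarrow> (\<forall>K. compact K \<longrightarrow> set_integrable lborel K f)"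

text \<open>
  \<open>js\<close> enumerates \<open>u\<close>; the order in which the test function is differentiated is immaterial.
\<close>

definition is_weak_mixed_deriv ::
    "'s set \<Rightarrow> (real ^ 's::finite \<Rightarrow> real) \<Rightarrow> (real ^ 's \<Rightarrow> real) \<Rightarrow> bool" where
  "is_weak_mixed_deriv u f g \<longleftrightarrow> locally_integrable g \<and>
     (\<forall>\<eta> js. test_function \<eta> \<and> distinct js \<and> set js = u \<longrightarrow>
        (LINT y|lborel. f y * foldr partial_deriv js \<eta> y)
          = (-1) ^ card u * (LINT y|lborel. g y * \<eta> y))"

text \<open>
  The weak derivative is determined up to null sets only.  The choice of the representative
  affects neither membership in the Sobolev space nor the norm.
\<close>

definition weak_mixed_deriv :: "'s set \<Rightarrow> (real ^ 's::finite \<Rightarrow> real) \<Rightarrow> real ^ 's \<Rightarrow> real" where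
  "weak_mixed_deriv u f = (SOME g. is_weak_mixed_deriv u f g)"

section \<open>The weighted unanchored Sobolev space\<close>

definition inner_integrand ::
    "(real \<Rightarrow> real) \<Rightarrow> (real ^ 's::finite \<Rightarrow> real) \<Rightarrow> 's set \<Rightarrow> ('s \<Rightarrow> real) \<Rightarrow> ('s \<Rightarrow> real) \<Rightarrow> real" where
  "inner_integrand \<phi> f u y z =
     weak_mixed_deriv u f (vec_lambda (merge u (- u) (y, z))) * (\<Prod>j\<in>- u. \<phi> (z j))"

definition inner_integral ::
    "(real \<Rightarrow> real) \<Rightarrow> (real ^ 's::finite \<Rightarrow> real) \<Rightarrow> 's set \<Rightarrow> ('s \<Rightarrow> real) \<Rightarrow> real" where
  "inner_integral \<phi> f u y = (LINT z|PiM (- u) (\<lambda>_. lborel). inner_integrand \<phi> f u y z)"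

definition sobolev_norm_sq ::
    "(real \<Rightarrow> real) \<Rightarrow> ('s::finite set \<Rightarrow> real) \<Rightarrow> ('s \<Rightarrow> real \<Rightarrow> real) \<Rightarrow> (real ^ 's \<Rightarrow> real) \<Rightarrow> ennreal" where
  "sobolev_norm_sq \<phi> \<gamma> \<psi> f =
     (\<Sum>u\<in>UNIV. ennreal (inverse (\<gamma> u)) *
        (\<integral>\<^sup>+ y. ennreal ((inner_integral \<phi> f u y)\<^sup>2 * (\<Prod>j\<in>u. (\<psi> j (y j))\<^sup>2)) \<partial>PiM u (\<lambda>_. lborel)))"

definition sobolev_norm ::
    "(real \<Rightarrow> real) \<Rightarrow> ('s::finite set \<Rightarrow> real) \<Rightarrow> ('s \<Rightarrow> real \<Rightarrow> real) \<Rightarrow> (real ^ 's \<Rightarrow> real) \<Rightarrow> real" where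
  "sobolev_norm \<phi> \<gamma> \<psi> f = sqrt (enn2real (sobolev_norm_sq \<phi> \<gamma> \<psi> f))"

text \<open>
  Elements of the space are represented by their continuous representatives: under
  \<open>weights_admissible\<close> below, the reproducing kernel is continuous, so each class of almost
  everywhere equal functions in the space contains exactly one continuous function, and point
  evaluation in the reproducing kernel Hilbert space is evaluation of that function.

  The almost-everywhere clause states that the inner integrals in the norm exist; it is needed
  because the Bochner integral of a non-integrable function is 0 by convention.
\<close>

definition sobolev_space ::
    "(real \<Rightarrow> real) \<Rightarrow> ('s::finite set \<Rightarrow> real) \<Rightarrow> ('s \<Rightarrow> real \<Rightarrow> real) \<Rightarrow> (real ^ 's \<Rightarrow> real) set" where
  "sobolev_space \<phi> \<gamma> \<psi> = {f.
     continuous_on UNIV f \<and> locally_integrable f \<and>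
     (\<forall>u. \<exists>g. is_weak_mixed_deriv u f g) \<and>
     (\<forall>u. AE y in PiM u (\<lambda>_. lborel). integrable (PiM (- u) (\<lambda>_. lborel)) (inner_integrand \<phi> f u y)) \<and>
     sobolev_norm_sq \<phi> \<gamma> \<psi> f < \<infinity>}"

definition weights_admissible :: "(real \<Rightarrow> real) \<Rightarrow> ('s::finite \<Rightarrow> real \<Rightarrow> real) \<Rightarrow> bool" where
  "weights_admissible \<phi> \<psi> \<longleftrightarrow>
     (\<forall>j c. set_integrable lborel {..c} (\<lambda>y. dist_fun \<phi> y / (\<psi> j y)\<^sup>2) \<and>
            set_integrable lborel {c..} (\<lambda>y. (1 - dist_fun \<phi> y) / (\<psi> j y)\<^sup>2))"

definition theta_hat :: "(real \<Rightarrow> real) \<Rightarrow> ('s \<Rightarrow> real \<Rightarrow> real) \<Rightarrow> 's \<Rightarrow> int \<Rightarrow> real" where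
  "theta_hat \<phi> \<psi> j h =
     1 / (pi\<^sup>2 * (real_of_int h)\<^sup>2)
       * (LINT t|lborel. (sin (pi * real_of_int h * dist_fun \<phi> t))\<^sup>2 / (\<psi> j t)\<^sup>2)"

section \<open>The median estimator\<close>

definition generators :: "nat \<Rightarrow> nat set" where
  "generators N = {a \<in> {1..N}. coprime a N}"

definition lattice_rule ::
    "(real \<Rightarrow> real) \<Rightarrow> (real ^ 's::finite \<Rightarrow> real) \<Rightarrow> nat \<Rightarrow> nat ^ 's \<Rightarrow> real ^ 's \<Rightarrow> real" where
  "lattice_rule \<phi> f N z \<Delta> =
     1 / real N * (\<Sum>n=1..N. f (\<chi> j. dist_inv \<phi> (frac (real n * real (z $ j) / real N + \<Delta> $ j))))"

text \<open>The median of a list of odd length.\<close>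

definition median :: "real list \<Rightarrow> real" where
  "median xs = sort xs ! (length xs div 2)"

text \<open>
  The joint law of \<open>(Z\<^sub>1, \<Delta>\<^sub>1), \<dots>, (Z\<^sub>k, \<Delta>\<^sub>k)\<close>, all \<open>2k\<close> vectors being independent.
\<close>

definition sample_space :: "nat \<Rightarrow> nat \<Rightarrow> (nat \<Rightarrow> (nat ^ 's::finite) \<times> (real ^ 's)) measure" where
  "sample_space N k =
     PiM {1..k} (\<lambda>_. measure_pmf (pmf_of_set {z. \<forall>j. z $ j \<in> generators N})
                      \<Otimes>\<^sub>M uniform_measure lborel {x. \<forall>j. x $ j \<in> {0..1}})"

definition median_estimator ::
    "(real \<Rightarrow> real) \<Rightarrow> (real ^ 's::finite \<Rightarrow> real) \<Rightarrow> nat \<Rightarrow> nat \<Rightarrow>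
     (nat \<Rightarrow> (nat ^ 's) \<times> (real ^ 's)) \<Rightarrow> real" where
  "median_estimator \<phi> f N k \<omega> =
     median (map (\<lambda>l. lattice_rule \<phi> f N (fst (\<omega> l)) (snd (\<omega> l))) [1..<k+1])"

end

theory Submission
  imports Defs "HOL-Number_Theory.Totient" "HOL-Real_Asymp.Real_Asymp"
begin

text \<open>
  Integrating weak derivatives along lines gives, almost everywhere,
  \<open>f y = \<Sum>u. \<integral> F\<^sub>u t * (\<Prod>i\<in>u. K (y i) (t i)) dt\<close>, where \<open>F\<^sub>u\<close> is the inner integral in the norm,
  \<open>K y t = [t \<le> y] - (1 - \<Phi> t)\<close> and the term for \<open>u = {}\<close> is the integral of \<open>f\<close>.  By the weighted
  Cauchy-Schwarz inequality, the error of a shifted lattice rule is therefore small for every \<open>f\<close> in the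
  unit ball as soon as, for each nonempty \<open>u\<close>, the weighted square norm of the averaged kernel product is
  small.  By Parseval, the mean of that square norm over the shifts is a sum of products of \<open>theta_hat\<close>
  over the dual lattice.

  The power \<open>q\<close> of this sum is at most the sum of the \<open>q\<close>-th powers, for \<open>0 < q \<le> 1\<close>; if \<open>2 * r * q > 1\<close>, the
  mean of the latter over all generators is of order \<open>N powr (\<delta> - 1)\<close>.  With Markov's inequality, a single
  sample misses the error bound with probability at most \<open>\<rho> / 4\<close>, and the median misses it only if at
  least half of the samples do.
\<close>

section \<open>Finite products of the Lebesgue measure\<close>

text \<open>Two obstacles shape the proof. The weak derivatives are known only through test
  functions, so the representation holds only almost everywhere, whereas the estimator uses point
  values. This does no harm: the inverse distribution function applied to a uniformly shifted point
  has a law with a density, so a null set is met with probability 0. That null set depends on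
  \<open>f\<close>, but the event that some \<open>shift_error\<close> is large does not.

  The second obstacle is the rate. Markov's inequality for the mean over shifts and generators would
  control a quantity of order 1/N only, hence give the rate N^(-1/2). Therefore it is applied for
  each fixed generator, where it bounds a probability p by a multiple of the dual lattice series. As
  p <= p^q, the bound may be raised to the power q before the mean over the generators is taken. Few
  generators are bad, and they count for less in this form; this lifts the rate from 1/2 to nearly
  r. The median then turns the moderate success probability of one sample into an exponentially
  small failure probability.\<close>

abbreviation LP :: "'s set \<Rightarrow> ('s \<Rightarrow> real) measure" where
  "LP I \<equiv> PiM I (\<lambda>_. lborel)"

interpretation LP: product_sigma_finite "\<lambda>_. lborel :: real measure"
  by standard

lemma measurable_override_on:
  assumes "f \<in> M \<rightarrow>\<^sub>M LP UNIV" "g \<in> M \<rightarrow>\<^sub>M LP w"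
  shows "(\<lambda>x. override_on (f x) (g x) w) \<in> M \<rightarrow>\<^sub>M LP UNIV"
proof -
  have "(\<lambda>x. if i \<in> w then g x i else f x i) \<in> M \<rightarrow>\<^sub>M lborel" for i
  proof (cases "i \<in> w")
    case True
    with measurable_compose[OF assms(2) measurable_component_singleton[OF True]] show ?thesis
      by (simp only: if_True)
  next
    case False
    with measurable_compose[OF assms(1) measurable_component_singleton[OF UNIV_I]] show ?thesis
      by (simp only: if_False)
  qed
  then show ?thesis
    unfolding override_on_def by (intro measurable_abs_UNIV)
qed

lemma sigma_finite_LP: "sigma_finite_measure (LP (I :: 's::finite set))"
  by (rule LP.sigma_finite) simp

lemma pair_sigma_finite_LP: "pair_sigma_finite (LP (I :: 's::finite set)) (LP (J :: 't::finite set))"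
  by (simp add: pair_sigma_finite_def sigma_finite_LP)

lemma AE_LP_Un:
  fixes I J :: "'s::finite set"
  assumes "I \<inter> J = {}" "AE y in LP (I \<union> J). Q y"
  shows "AE x in LP I. AE y in LP J. Q (merge I J (x, y))"
proof -
  interpret pair_sigma_finite "LP I" "LP J" by (rule pair_sigma_finite_LP)
  have "AE p in LP I \<Otimes>\<^sub>M LP J. Q (merge I J p)"
    by (rule AE_distrD[OF measurable_merge]) (subst LP.distr_merge[OF assms(1) finite finite], rule assms(2))
  then show ?thesis
    by (rule AE_pair)
qed

text \<open>A cylinder over a null set is null. \<open>S\<close> may be any predicate, so the
  argument runs through a measurable null set \<open>N\<close> that contains its exceptions.\<close>

lemma AE_LP_extend:
  fixes I :: "'s::finite set"
  assumes "AE x in LP I. S x"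
  shows "AE y in LP UNIV. S (restrict y I)"
proof -
  interpret pair_sigma_finite "LP I" "LP (-I)" by (rule pair_sigma_finite_LP)
  obtain N where N: "{x \<in> space (LP I). \<not> S x} \<subseteq> N" "emeasure (LP I) N = 0" "N \<in> sets (LP I)"
    using AE_E[OF assms] by blast
  have [measurable]: "N \<in> sets (LP I)" "(\<lambda>y. restrict y I) \<in> LP UNIV \<rightarrow>\<^sub>M LP I"
    using N by (auto intro: measurable_restrict_subset)
  have "AE p in LP I \<Otimes>\<^sub>M LP (-I). fst p \<notin> N"
  proof (rule AE_pair_measure)
    show "{x \<in> space (LP I \<Otimes>\<^sub>M LP (- I)). fst x \<notin> N} \<in> sets (LP I \<Otimes>\<^sub>M LP (- I))"
      by measurable
    show "AE x in LP I. AE y in LP (- I). fst (x, y) \<notin> N"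
      using AE_not_in[of N "LP I"] N by (auto simp: null_sets_def)
  qed
  then have "AE p in LP I \<Otimes>\<^sub>M LP (-I). restrict (merge I (-I) p) I \<notin> N"
    by (rule AE_mp, intro AE_I2) (auto simp: space_pair_measure space_PiM PiE_restrict)
  then have "AE y in distr (LP I \<Otimes>\<^sub>M LP (-I)) (LP (I \<union> -I)) (merge I (-I)). restrict y I \<notin> N"
    by (subst AE_distr_iff[OF measurable_merge]) (auto simp: Compl_partition)
  then have "AE y in LP (I \<union> -I). restrict y I \<notin> N"
    by (subst (asm) LP.distr_merge) auto
  then have "AE y in LP UNIV. restrict y I \<notin> N"
    unfolding Compl_partition .
  moreover have "restrict y I \<in> space (LP I)" for y
    by (simp add: space_PiM)
  ultimately show ?thesis
    using N(1) by (elim eventually_mono) blast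
qed

text \<open>Fubini after forgetting the coordinates of \<open>y\<close> in \<open>w\<close>, which
  \<open>override_on\<close> replaces anyway. Keeping the old point as a parameter allows the old
  and the new coordinates to be compared.\<close>

lemma AE_LP_override:
  fixes w :: "'s::finite set"
  assumes "AE y in LP UNIV. Q y"
  shows "AE y in LP UNIV. AE z in LP w. Q (override_on y z w)"
proof -
  have "AE x in LP (-w). AE z in LP w. Q (merge (-w) w (x, z))"
    using AE_LP_Un[of "-w" w Q, unfolded Compl_partition2] assms by simp
  then have "AE y in LP UNIV. AE z in LP w. Q (merge (-w) w (restrict y (-w), z))"
    by (rule AE_LP_extend)
  moreover have eq: "merge (-w) w (restrict y (-w), z) = override_on y z w" for y z
    by (auto simp: merge_def override_on_def)
  ultimately show ?thesis by (simp only: eq)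
qed

lemma AE_LP_update:
  fixes j :: "'s::finite"
  assumes "AE y in LP UNIV. Q y"
  shows "AE y in LP UNIV. AE t in lborel. Q (y(j := t))"
proof -
  have "AE y in LP UNIV. AE z in LP {j}. Q (override_on y z {j})"
    by (rule AE_LP_override[OF assms])
  moreover have "AE t in lborel. Q (y(j := t))" if "AE z in LP {j}. Q (override_on y z {j})" for y
  proof -
    have m: "(\<lambda>x. \<lambda>i\<in>{j}. x) \<in> lborel \<rightarrow>\<^sub>M LP {j}"
      by (rule measurable_restrict) auto
    have "AE z in distr lborel (LP {j}) (\<lambda>x. \<lambda>i\<in>{j}. x). Q (override_on y z {j})"
      using that by (subst LP.distr_component)
    from AE_distrD[OF m this] have "AE t in lborel. Q (override_on y (\<lambda>i\<in>{j}. t) {j})" .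
    moreover have "override_on y (\<lambda>i\<in>{j}. t) {j} = y(j := t)" for t
      by (auto simp: override_on_def)
    ultimately show ?thesis by simp
  qed
  ultimately show ?thesis by (auto elim!: eventually_mono)
qed

text \<open>The converse direction of Fubini: null sections make a set null only if the set is
  measurable, hence the measurability premise.\<close>

lemma AE_LP_insert:
  fixes j :: "'s::finite"
  assumes "j \<notin> w" and [measurable]: "{z \<in> space (LP (insert j w)). P z} \<in> sets (LP (insert j w))"
    and ae: "AE z in LP w. AE t in lborel. P (z(j := t))"
  shows "AE z in LP (insert j w). P z"
proof -
  interpret pair_sigma_finite "LP w" "lborel :: real measure"
    by (simp add: pair_sigma_finite_def sigma_finite_LP sigma_finite_lborel)
  have m: "(\<lambda>(f, y). f(j := y)) \<in> LP w \<Otimes>\<^sub>M lborel \<rightarrow>\<^sub>M LP (insert j w)"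
    by (rule measurable_add_dim)
  have eq: "(\<integral>\<^sup>+z. indicator {z \<in> space (LP (insert j w)). \<not> P z} z \<partial>LP (insert j w)) =
     (\<integral>\<^sup>+x. \<integral>\<^sup>+t. indicator {z \<in> space (LP (insert j w)). \<not> P z} (x(j := t)) \<partial>lborel \<partial>LP w)"
    by (rule LP.product_nn_integral_insert) (use assms(1) in \<open>simp, simp, measurable\<close>)
  also have "\<dots> = (\<integral>\<^sup>+x. 0 \<partial>LP w)"
  proof (rule nn_integral_cong_AE)
    show "AE x in LP w. (\<integral>\<^sup>+t. indicator {z \<in> space (LP (insert j w)). \<not> P z} (x(j := t)) \<partial>lborel) = 0"
      using ae
    proof eventually_elim
      case (elim x)
      have "(\<integral>\<^sup>+t. indicator {z \<in> space (LP (insert j w)). \<not> P z} (x(j := t)) \<partial>lborel) = (\<integral>\<^sup>+(t::real). 0 \<partial>lborel)"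
        by (rule nn_integral_cong_AE) (use elim in \<open>eventually_elim, auto\<close>)
      then show ?case by simp
    qed
  qed
  finally have "emeasure (LP (insert j w)) {z \<in> space (LP (insert j w)). \<not> P z} = 0"
    by (subst (asm) nn_integral_indicator) auto
  then show ?thesis
    by (intro AE_I[where N="{z \<in> space (LP (insert j w)). \<not> P z}"]) auto
qed

text \<open>The coordinates in \<open>w\<close> are replaced one at a time. Invariance under a
  single replacement is applied at the partially replaced point, which is allowed by
  \<open>AE_LP_override\<close>.\<close>

lemma AE_indep_override:
  fixes w :: "'s::finite set" and R :: "('s \<Rightarrow> real) \<Rightarrow> real"
  assumes [measurable]: "R \<in> borel_measurable (LP UNIV)"
    and ae: "\<And>j. j \<in> w \<Longrightarrow> AE y in LP UNIV. AE t in lborel. R (y(j := t)) = R y"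
  shows "AE y in LP UNIV. AE z in LP w. R (override_on y z w) = R y"
  using finite[of w] ae
proof (induction w rule: finite_induct)
  case empty
  show ?case by (simp add: override_on_def)
next
  case (insert j w)
  have "AE y in LP UNIV. AE z in LP w. AE t in lborel. R ((override_on y z w)(j := t)) = R (override_on y z w)"
    by (rule AE_LP_override) (rule insert.prems, simp)
  moreover have "AE y in LP UNIV. AE z in LP w. R (override_on y z w) = R y"
    using insert by auto
  ultimately show ?case
  proof eventually_elim
    case (elim y)
    have [measurable]: "(\<lambda>z. override_on y z (insert j w)) \<in> LP (insert j w) \<rightarrow>\<^sub>M LP UNIV"
      by (intro measurable_override_on) (auto simp: space_PiM)
    have "AE z in LP w. AE t in lborel. R (override_on y (z(j := t)) (insert j w)) = R y"
      using elim
    proof eventually_elim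
      case (elim z)
      have "override_on y (z(j := t)) (insert j w) = (override_on y z w)(j := t)" for t
        using insert(2) by (auto simp: override_on_def)
      with elim show ?case by auto
    qed
    then show ?case
      by (intro AE_LP_insert[OF insert(2)]) measurable
  qed
qed

section \<open>The kernel and its moments\<close>

locale weighted_setting =
  fixes \<phi> :: "real \<Rightarrow> real" and \<psi> :: "'s::finite \<Rightarrow> real \<Rightarrow> real"
  assumes dens: "prob_density \<phi>" and inv: "dist_invertible \<phi>"
    and psi_pos: "\<And>j y. \<psi> j y > 0"
    and psi_meas [measurable]: "\<And>j. \<psi> j \<in> borel_measurable borel"
    and adm: "weights_admissible \<phi> \<psi>"
begin

abbreviation (input) \<Phi> where "\<Phi> \<equiv> dist_fun \<phi>"
abbreviation (input) P where "P \<equiv> density lborel (\<lambda>x. ennreal (\<phi> x))"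

lemma phi_meas [measurable]: "\<phi> \<in> borel_measurable borel"
  and phi_nonneg: "0 \<le> \<phi> x"
  using dens by (auto simp: prob_density_def)

lemma real_distribution_P: "real_distribution P"
proof -
  interpret prob_space P using dens by (simp add: prob_density_def)
  show ?thesis by unfold_locales auto
qed

sublocale P: real_distribution P by (rule real_distribution_P)

lemma cdf_singleton: "measure P {x} = 0"
proof -
  have "emeasure P {x} = (\<integral>\<^sup>+y. ennreal (\<phi> y) * indicator {x} y \<partial>lborel)"
    by (rule emeasure_density) auto
  also have "\<dots> = (\<integral>\<^sup>+(y::real). 0 \<partial>lborel)"
    using AE_lborel_singleton[of x] by (intro nn_integral_cong_AE) (auto elim!: eventually_mono)
  finally show ?thesis by (simp add: measure_def)
qed

lemma dist_mono: "x \<le> y \<Longrightarrow> \<Phi> x \<le> \<Phi> y"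
  unfolding dist_fun_def by (rule P.cdf_nondecreasing)

lemma dist_ge0 [simp]: "0 \<le> \<Phi> x"
  unfolding dist_fun_def by (rule P.cdf_nonneg)

lemma dist_le1 [simp]: "\<Phi> x \<le> 1"
  unfolding dist_fun_def by (rule P.cdf_bounded_prob)

lemma dist_meas [measurable]: "\<Phi> \<in> borel_measurable borel"
  by (rule borel_measurable_mono) (simp add: dist_mono mono_def)

lemma phi_integrable: "integrable lborel \<phi>"
proof (rule integrableI_nonneg)
  have "(\<integral>\<^sup>+x. ennreal (\<phi> x) \<partial>lborel) = emeasure P (space P)"
    by (simp add: emeasure_density)
  then show "(\<integral>\<^sup>+x. ennreal (\<phi> x) \<partial>lborel) < \<infinity>"
    using P.emeasure_space_1 by simp
qed (auto simp: phi_nonneg)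

lemma integral_phi_set:
  assumes [measurable]: "A \<in> sets borel"
  shows "(LINT y|lborel. \<phi> y * indicator A y) = measure P A"
proof -
  have "measure P A = (LINT y|P. indicator A y)"
    by simp
  also have "\<dots> = (LINT y|lborel. \<phi> y *\<^sub>R indicator A y)"
    by (rule integral_density) (auto simp: phi_nonneg)
  finally show ?thesis by simp
qed

lemma integral_phi: "(LINT y|lborel. \<phi> y) = 1"
  using integral_phi_set[of UNIV] P.prob_space by (simp add: space_density)

lemma measure_P_atLeast: "measure P {t..} = 1 - \<Phi> t"
proof -
  have "measure P {t..} = measure P {t} + measure P {t<..}"
    by (subst P.finite_measure_Union[symmetric]) (auto intro!: arg_cong[of _ _ "measure P"])
  also have "measure P {t<..} = measure P (space P - {..t})"
    by (intro arg_cong[of _ _ "measure P"]) auto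
  also have "\<dots> = 1 - \<Phi> t"
    by (subst P.prob_compl) (auto simp: dist_fun_def cdf_def)
  finally show ?thesis by (simp add: cdf_singleton)
qed

text \<open>
  For smooth \<open>f\<close> with mean 0 with respect to \<open>\<phi>\<close>, the function \<open>f y\<close> is the integral of \<open>f' t * ker y t\<close>.
\<close>

definition ker :: "real \<Rightarrow> real \<Rightarrow> real" where
  "ker y t = of_bool (t \<le> y) - (1 - \<Phi> t)"

lemma ker_alt: "ker y t = (if t \<le> y then \<Phi> t else - (1 - \<Phi> t))"
  by (simp add: ker_def)

lemma ker_meas [measurable]: "(\<lambda>x. ker (fst x) (snd x)) \<in> borel_measurable (borel \<Otimes>\<^sub>M borel)"
  unfolding ker_alt by measurable

lemma ker_meas' [measurable (raw)]:
  assumes [measurable]: "f \<in> borel_measurable M" "g \<in> borel_measurable M"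
  shows "(\<lambda>x. ker (f x) (g x)) \<in> borel_measurable M"
  using measurable_compose[of "\<lambda>x. (f x, g x)", OF _ ker_meas] by simp

lemma ker_le1: "\<bar>ker y t\<bar> \<le> 1"
  using dist_ge0[of t] dist_le1[of t] by (auto simp: ker_alt simp del: dist_ge0 dist_le1)

lemma ker_integrable: "integrable lborel (\<lambda>y. \<phi> y * ker y t)"
  by (rule Bochner_Integration.integrable_bound[OF phi_integrable])
     (auto simp: abs_mult phi_nonneg intro!: mult_left_le ker_le1)

lemma ker_mean: "(LINT y|lborel. \<phi> y * ker y t) = 0"
proof -
  have "(LINT y|lborel. \<phi> y * ker y t) = (LINT y|lborel. \<phi> y * indicator {t..} y - \<phi> y * (1 - \<Phi> t))"
    by (intro Bochner_Integration.integral_cong) (auto simp: ker_def algebra_simps)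
  also have "\<dots> = (LINT y|lborel. \<phi> y * indicator {t..} y) - (LINT y|lborel. \<phi> y * (1 - \<Phi> t))"
    by (rule Bochner_Integration.integral_diff)
       (auto intro!: integrable_real_mult_indicator phi_integrable)
  also have "\<dots> = 0"
    by (simp add: integral_phi_set measure_P_atLeast integral_phi)
  finally show ?thesis .
qed

text \<open>The half-line y >= t has mass 1 - \<Phi> t and kernel value \<Phi> t; on its complement
  the two are exchanged, so both parts contribute equally. The result decays at both ends, which the
  trivial bound 1 does not; this puts it into the weighted square integrable class used for Fubini
  in \<open>T_mean\<close>.\<close>

lemma ker_abs_mean: "(LINT y|lborel. \<phi> y * \<bar>ker y t\<bar>) = 2 * \<Phi> t * (1 - \<Phi> t)"
proof -
  have "(LINT y|lborel. \<phi> y * \<bar>ker y t\<bar>) =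
     (LINT y|lborel. (2 * \<Phi> t - 1) * (\<phi> y * indicator {t..} y) + \<phi> y * (1 - \<Phi> t))"
    by (intro Bochner_Integration.integral_cong) (auto simp: ker_alt algebra_simps split: split_indicator)
  also have "\<dots> = (2 * \<Phi> t - 1) * (LINT y|lborel. \<phi> y * indicator {t..} y) + (LINT y|lborel. \<phi> y * (1 - \<Phi> t))"
    by (subst Bochner_Integration.integral_add)
       (auto intro!: integrable_real_mult_indicator phi_integrable)
  also have "\<dots> = 2 * \<Phi> t * (1 - \<Phi> t)"
    by (simp add: integral_phi_set measure_P_atLeast integral_phi) (simp add: algebra_simps)
  finally show ?thesis .
qed

text \<open>Reduces square integrability against 1/\<psi>^2 to the standing assumption, whose two
  halves control the two sides of \<open>c\<close>. It serves the kernel, its absolute mean and the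
  sine in \<open>theta_hat\<close>.\<close>

lemma weight_integral_finite:
  assumes [measurable]: "m \<in> borel_measurable borel"
    and "\<And>t. t \<le> c \<Longrightarrow> (m t)\<^sup>2 \<le> C * \<Phi> t" "\<And>t. t > c \<Longrightarrow> (m t)\<^sup>2 \<le> C * (1 - \<Phi> t)"
  shows "(\<integral>\<^sup>+t. ennreal ((m t)\<^sup>2 / (\<psi> j t)\<^sup>2) \<partial>lborel) < \<infinity>"
proof -
  let ?f = "\<lambda>t. C * (indicator {..c} t *\<^sub>R (\<Phi> t / (\<psi> j t)\<^sup>2)) + C * (indicator {c..} t *\<^sub>R ((1 - \<Phi> t) / (\<psi> j t)\<^sup>2))"
  have int: "integrable lborel ?f"
    using adm unfolding weights_admissible_def set_integrable_def
    by (intro Bochner_Integration.integrable_add integrable_mult_right) blast+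
  \<comment> \<open>A negative \<open>C\<close> would force \<Phi> to be 0 up to \<open>c\<close>
    and 1 beyond it, so the value 1/2 would never be attained, against invertibility.\<close>
  have C: "0 \<le> C"
  proof (rule ccontr)
    assume "\<not> 0 \<le> C"
    then have *: "\<Phi> t = 0" if "t \<le> c" for t
      using assms(2)[OF that] dist_ge0[of t]
      by (smt (verit) mult_neg_pos zero_le_power2)
    have "\<Phi> t = 1" if "t > c" for t
      using assms(3)[OF that] dist_le1[of t] \<open>\<not> 0 \<le> C\<close>
      by (smt (verit) mult_neg_pos zero_le_power2)
    with * have "\<not> (\<exists>y. \<Phi> y = 1/2)" by (metis not_le zero_neq_one div_by_1 divide_eq_eq_1 half_gt_zero_iff
       one_eq_divide_iff numeral_eq_one_iff semiring_norm(85) zero_less_one less_irrefl)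
    moreover have "(1/2::real) \<in> {0<..<1}" by simp
    ultimately show False
      using inv unfolding dist_invertible_def by blast
  qed
  have "(m t)\<^sup>2 / (\<psi> j t)\<^sup>2 \<le> ?f t" for t
  proof -
    consider "t < c" | "t = c" | "t > c" by linarith
    then show ?thesis
    proof cases
      \<comment> \<open>At \<open>c\<close> itself both indicators are 1; the surplus term is
        nonnegative.\<close>
      case 2
      then have "(m t)\<^sup>2 / (\<psi> j t)\<^sup>2 \<le> C * (\<Phi> t / (\<psi> j t)\<^sup>2)"
        using assms(2)[of t] psi_pos[of j t] by (simp add: divide_right_mono)
      moreover have "0 \<le> C * ((1 - \<Phi> t) / (\<psi> j t)\<^sup>2)"
        using C by simp
      ultimately show ?thesis using 2 by simp
    qed (use assms(2,3)[of t] psi_pos[of j t] in \<open>auto simp: divide_right_mono\<close>)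
  qed
  then have "integrable lborel (\<lambda>t. (m t)\<^sup>2 / (\<psi> j t)\<^sup>2)"
    using psi_pos by (intro Bochner_Integration.integrable_bound[OF int]) (auto simp: order_trans[OF _ abs_ge_self])
  then show ?thesis
    by (simp add: integrable_iff_bounded)
qed

text \<open>Splitting at the jump t = y leaves \<Phi>^2 <= \<Phi> on the left and (1 - \<Phi>)^2 <=
  1 - \<Phi> on the right.\<close>

lemma ker_L2: "(\<integral>\<^sup>+t. ennreal ((ker y t)\<^sup>2 / (\<psi> j t)\<^sup>2) \<partial>lborel) < \<infinity>"
proof (rule weight_integral_finite[where c=y and C=1])
  show "(ker y t)\<^sup>2 \<le> 1 * \<Phi> t" if "t \<le> y" for t
    using that power_decreasing[of 1 2 "\<Phi> t"] by (simp add: ker_alt)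
  show "(ker y t)\<^sup>2 \<le> 1 * (1 - \<Phi> t)" if "t > y" for t
    using that power_decreasing[of 1 2 "1 - \<Phi> t"] by (simp add: ker_alt power2_commute)
qed measurable

lemma ker_abs_mean_L2: "(\<integral>\<^sup>+t. ennreal ((2 * \<Phi> t * (1 - \<Phi> t))\<^sup>2 / (\<psi> j t)\<^sup>2) \<partial>lborel) < \<infinity>"
proof (rule weight_integral_finite[where c=0 and C=4])
  fix t :: real
  have *: "a\<^sup>2 * (1 - a)\<^sup>2 \<le> a" if "0 \<le> a" "a \<le> 1" for a :: real
    using that power_decreasing[of 1 2 a] power_le_one[of "1 - a" 2]
      mult_mono[of "a\<^sup>2" a "(1-a)\<^sup>2" 1] by simp
  show "(2 * \<Phi> t * (1 - \<Phi> t))\<^sup>2 \<le> 4 * \<Phi> t"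
    using *[of "\<Phi> t"] by (simp add: power_mult_distrib)
  show "(2 * \<Phi> t * (1 - \<Phi> t))\<^sup>2 \<le> 4 * (1 - \<Phi> t)"
    using *[of "1 - \<Phi> t"] unfolding power_mult_distrib by (simp add: mult_ac)
qed measurable

end

text \<open>Cauchy-Schwarz in the pointwise form |ab| <= a^2 + b^2: with w the product of the
  weights, A m = (A w)(m / w), and the square of m / w is a product of functions of single
  variables.\<close>

lemma product_weight_integrable:
  fixes A :: "('s::finite \<Rightarrow> real) \<Rightarrow> real"
  assumes [measurable]: "A \<in> borel_measurable (LP I)" "\<And>i. i \<in> I \<Longrightarrow> m i \<in> borel_measurable borel"
    "\<And>i. \<psi> i \<in> borel_measurable borel"
    and pos: "\<And>i t. \<psi> i t > (0::real)"
    and fin: "(\<integral>\<^sup>+t. ennreal ((A t)\<^sup>2 * (\<Prod>i\<in>I. (\<psi> i (t i))\<^sup>2)) \<partial>LP I) < \<infinity>"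
    and m: "\<And>i. i \<in> I \<Longrightarrow> (\<integral>\<^sup>+t. ennreal ((m i t)\<^sup>2 / (\<psi> i t)\<^sup>2) \<partial>lborel) < \<infinity>"
  shows "integrable (LP I) (\<lambda>t. A t * (\<Prod>i\<in>I. m i (t i)))"
proof -
  have 1: "integrable (LP I) (\<lambda>t. (A t)\<^sup>2 * (\<Prod>i\<in>I. (\<psi> i (t i))\<^sup>2))"
    by (rule integrableI_nonneg) (use fin in \<open>auto intro!: mult_nonneg_nonneg prod_nonneg\<close>)
  have 2: "integrable (LP I) (\<lambda>t. \<Prod>i\<in>I. (m i (t i))\<^sup>2 / (\<psi> i (t i))\<^sup>2)"
    by (rule LP.product_integrable_prod) (use m in \<open>auto intro!: integrableI_nonneg\<close>)
  have "\<bar>A t * (\<Prod>i\<in>I. m i (t i))\<bar> \<le> (A t)\<^sup>2 * (\<Prod>i\<in>I. (\<psi> i (t i))\<^sup>2) + (\<Prod>i\<in>I. (m i (t i))\<^sup>2 / (\<psi> i (t i))\<^sup>2)" for t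
  proof -
    let ?w = "\<Prod>i\<in>I. \<psi> i (t i)" and ?m = "\<Prod>i\<in>I. m i (t i)"
    have w: "?w > 0" by (intro prod_pos) (simp add: pos)
    have ab: "\<bar>a * b\<bar> \<le> a\<^sup>2 + b\<^sup>2" for a b :: real
    proof -
      have "2 * (\<bar>a\<bar> * \<bar>b\<bar>) \<le> a\<^sup>2 + b\<^sup>2"
        using sum_squares_bound[of "\<bar>a\<bar>" "\<bar>b\<bar>"] by simp
      moreover have "0 \<le> \<bar>a\<bar> * \<bar>b\<bar>" by simp
      ultimately show ?thesis unfolding abs_mult by linarith
    qed
    have "\<bar>A t * ?m\<bar> = \<bar>(A t * ?w) * (?m / ?w)\<bar>"
      using w by (simp del: prod_zero_iff)
    also have "\<dots> \<le> (A t * ?w)\<^sup>2 + (?m / ?w)\<^sup>2"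
      by (rule ab)
    also have "\<dots> = (A t)\<^sup>2 * (\<Prod>i\<in>I. (\<psi> i (t i))\<^sup>2) + (\<Prod>i\<in>I. (m i (t i))\<^sup>2 / (\<psi> i (t i))\<^sup>2)"
      by (simp add: power_mult_distrib power_divide prod_dividef prod_power_distrib)
    finally show ?thesis .
  qed
  then show ?thesis
    by (intro Bochner_Integration.integrable_bound[OF Bochner_Integration.integrable_add[OF 1 2]])
       (auto simp: order_trans[OF _ abs_ge_self])
qed

text \<open>Fubini with the added coordinate as the outer variable, the order in which increments in
  that coordinate are expressed.\<close>

lemma LP_integral_insert:
  fixes f :: "('s::finite \<Rightarrow> real) \<Rightarrow> real"
  assumes "j \<notin> w" and f: "integrable (LP (insert j w)) f"
  shows "integral\<^sup>L (LP (insert j w)) f = (LINT s|lborel. LINT t|LP w. f (t(j := s)))"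
    and "integrable lborel (\<lambda>s. LINT t|LP w. f (t(j := s)))"
proof -
  interpret pair_sigma_finite "LP w" "lborel :: real measure"
    by (simp add: pair_sigma_finite_def sigma_finite_LP sigma_finite_lborel)
  have m: "(\<lambda>(t, s). t(j := s)) \<in> LP w \<Otimes>\<^sub>M lborel \<rightarrow>\<^sub>M LP (insert j w)"
    by (rule measurable_add_dim)
  have [measurable]: "f \<in> borel_measurable (LP (insert j w))" using f by auto
  have fm [measurable]: "(\<lambda>(t, s). f (t(j := s))) \<in> borel_measurable (LP w \<Otimes>\<^sub>M lborel)"
    using measurable_compose[OF m, of f borel] by (simp add: case_prod_beta)
  have int: "integrable (LP w \<Otimes>\<^sub>M lborel) (\<lambda>(t, s). f (t(j := s)))"
  proof (rule integrableI_bounded)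
    have "(\<integral>\<^sup>+ p. ennreal (norm (case p of (t, s) \<Rightarrow> f (t(j := s)))) \<partial>(LP w \<Otimes>\<^sub>M lborel)) =
       (\<integral>\<^sup>+ t. \<integral>\<^sup>+ s. ennreal (norm (f (t(j := s)))) \<partial>lborel \<partial>LP w)"
      by (subst lborel.nn_integral_fst[symmetric]) auto
    also have "\<dots> = (\<integral>\<^sup>+ t. ennreal (norm (f t)) \<partial>LP (insert j w))"
      using assms(1) by (intro LP.product_nn_integral_insert[symmetric]) auto
    also have "\<dots> < \<infinity>" using f by (simp add: integrable_iff_bounded)
    finally show "(\<integral>\<^sup>+ p. ennreal (norm (case p of (t, s) \<Rightarrow> f (t(j := s)))) \<partial>(LP w \<Otimes>\<^sub>M lborel)) < \<infinity>" .
  qed (rule fm)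
  show "integral\<^sup>L (LP (insert j w)) f = (LINT s|lborel. LINT t|LP w. f (t(j := s)))"
    using assms(1) f by (subst LP.product_integral_insert) (auto intro!: Fubini_integral[OF int, symmetric])
  show "integrable lborel (\<lambda>s. LINT t|LP w. f (t(j := s)))"
    by (rule integrable_snd[OF int])
qed

lemma measurable_LP_snd: "i \<in> J \<Longrightarrow> (\<lambda>x. snd x i) \<in> borel_measurable (M \<Otimes>\<^sub>M LP J)"
  using measurable_compose[OF measurable_snd, of "\<lambda>x. x i" "LP J" lborel M]
    measurable_component_singleton[of i J "\<lambda>_. lborel"] by simp

lemma measurable_LP_fst: "i \<in> J \<Longrightarrow> (\<lambda>x. fst x i) \<in> borel_measurable (LP J \<Otimes>\<^sub>M M)"
  using measurable_compose[OF measurable_fst, of "\<lambda>x. x i" "LP J" lborel M]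
    measurable_component_singleton[of i J "\<lambda>_. lborel"] by simp

section \<open>The decomposition of a function by its averaged mixed derivatives\<close>

text \<open>Collects the properties of the averaged derivatives on which the decomposition rests.
  \<open>F u\<close> takes total maps but ignores the coordinates outside \<open>u\<close>, so that
  one function lives both on \<open>LP u\<close> and on \<open>LP UNIV\<close>.\<close>

locale anova = weighted_setting \<phi> \<psi> for \<phi> and \<psi> :: "'s::finite \<Rightarrow> real \<Rightarrow> real" +
  fixes F :: "'s set \<Rightarrow> ('s \<Rightarrow> real) \<Rightarrow> real"
  assumes F_meas [measurable]: "F u \<in> borel_measurable (LP UNIV)"
    and F_cong: "(\<And>i. i \<in> u \<Longrightarrow> y i = y' i) \<Longrightarrow> F u y = F u y'"
    and F_L2: "(\<integral>\<^sup>+y. ennreal ((F u y)\<^sup>2 * (\<Prod>j\<in>u. (\<psi> j (y j))\<^sup>2)) \<partial>LP u) < \<infinity>"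
begin

text \<open>The mixed derivative in \<open>v\<close> of the summand for \<open>u\<close>: as a
  function of y the kernel jumps by 1 at y = t, so differentiating in a coordinate replaces the
  integral over \<open>t i\<close> by evaluation at \<open>y i\<close>.\<close>

definition T :: "'s set \<Rightarrow> 's set \<Rightarrow> ('s \<Rightarrow> real) \<Rightarrow> real" where
  "T u v y = (LINT t|LP (u - v). F u (override_on y t (u - v)) * (\<Prod>i\<in>u - v. ker (y i) (t i)))"

text \<open>
  Guards the Bochner integrals in \<open>T\<close> against the convention that non-integrable functions have
  integral 0.
\<close>

definition good :: "'s set \<Rightarrow> 's set \<Rightarrow> ('s \<Rightarrow> real) \<Rightarrow> bool" where
  "good u v y \<longleftrightarrow> (\<integral>\<^sup>+t. ennreal ((F u (override_on y t (u - v)))\<^sup>2 * (\<Prod>i\<in>u - v. (\<psi> i (t i))\<^sup>2)) \<partial>LP (u - v)) < \<infinity>"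

lemma F_override_meas [measurable (raw)]:
  assumes "f \<in> M \<rightarrow>\<^sub>M LP UNIV" "g \<in> M \<rightarrow>\<^sub>M LP w"
  shows "(\<lambda>x. F u (override_on (f x) (g x) w)) \<in> borel_measurable M"
  by (rule measurable_compose[OF measurable_override_on[OF assms] F_meas])

lemma F_LP_meas: "F u \<in> borel_measurable (LP u)"
proof -
  have "(\<lambda>y. F u (override_on (\<lambda>_. 0) y u)) \<in> borel_measurable (LP u)"
    by (rule F_override_meas) (auto simp: space_PiM)
  moreover have "F u (override_on (\<lambda>_. 0) y u) = F u y" for y
    by (rule F_cong) (simp add: override_on_def)
  ultimately show ?thesis by simp
qed

text \<open>By Tonelli, \<open>F_L2\<close> makes the integral over the coordinates in
  \<open>u - v\<close> finite for almost every value of those in \<open>v\<close>; the weights of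
  \<open>v\<close> are then a positive constant factor.\<close>

lemma good_AE:
  assumes "v \<subseteq> u"
  shows "AE y in LP UNIV. good u v y"
proof -
  have u: "v \<union> (u - v) = u" using assms by auto
  have [measurable]: "F u \<in> borel_measurable (LP u)"
    by (rule F_LP_meas)
  let ?h = "\<lambda>y. ennreal ((F u y)\<^sup>2 * (\<Prod>j\<in>u. (\<psi> j (y j))\<^sup>2))"
  have [measurable]: "?h \<in> borel_measurable (LP u)"
    by measurable
  then have fm: "?h \<in> borel_measurable (LP (v \<union> (u - v)))"
    unfolding u .
  have mm: "(\<lambda>(x, t). ?h (merge v (u - v) (x, t))) \<in> borel_measurable (LP v \<Otimes>\<^sub>M LP (u - v))"
    using measurable_compose[OF measurable_merge fm] by (simp add: case_prod_eta)
  have "(\<integral>\<^sup>+x. \<integral>\<^sup>+t. ?h (merge v (u - v) (x, t)) \<partial>LP (u - v) \<partial>LP v) = integral\<^sup>N (LP (v \<union> (u - v))) ?h"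
    by (rule LP.product_nn_integral_fold[OF _ _ _ fm, symmetric]) auto
  also have "\<dots> < \<infinity>"
    unfolding u by (rule F_L2)
  finally have "AE x in LP v. (\<integral>\<^sup>+t. ?h (merge v (u - v) (x, t)) \<partial>LP (u - v)) \<noteq> \<infinity>"
    by (intro nn_integral_PInf_AE sigma_finite_measure.borel_measurable_nn_integral[OF sigma_finite_LP] mm) auto
  then have "AE y in LP UNIV. (\<integral>\<^sup>+t. ?h (merge v (u - v) (restrict y v, t)) \<partial>LP (u - v)) \<noteq> \<infinity>"
    by (rule AE_LP_extend)
  then show ?thesis
  proof eventually_elim
    case (elim y)
    let ?c = "\<Prod>j\<in>v. (\<psi> j (y j))\<^sup>2"
    have nz: "\<psi> j t \<noteq> 0" for j t using psi_pos[of j t] by simp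
    then have c: "?c > 0" by (intro prod_pos) auto
    have "?h (merge v (u - v) (restrict y v, t)) =
       ennreal ?c * ennreal ((F u (override_on y t (u - v)))\<^sup>2 * (\<Prod>i\<in>u - v. (\<psi> i (t i))\<^sup>2))" for t
    proof -
      have "(\<Prod>j\<in>u. (\<psi> j (merge v (u - v) (restrict y v, t) j))\<^sup>2) =
         (\<Prod>j\<in>v \<union> (u - v). (\<psi> j (merge v (u - v) (restrict y v, t) j))\<^sup>2)"
        unfolding u ..
      also have "\<dots> = ?c * (\<Prod>i\<in>u - v. (\<psi> i (t i))\<^sup>2)"
        by (subst prod.union_disjoint) (auto intro!: arg_cong2[where f="(*)"] prod.cong simp: merge_def)
      moreover have "F u (merge v (u - v) (restrict y v, t)) = F u (override_on y t (u - v))"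
        using assms by (intro F_cong) (auto simp: merge_def override_on_def)
      ultimately show ?thesis
        using c by (subst ennreal_mult[symmetric]) (auto simp: mult_ac intro!: mult_nonneg_nonneg prod_nonneg)
    qed
    then have "(\<integral>\<^sup>+t. ?h (merge v (u - v) (restrict y v, t)) \<partial>LP (u - v)) = ennreal ?c *
      (\<integral>\<^sup>+t. ennreal ((F u (override_on y t (u - v)))\<^sup>2 * (\<Prod>i\<in>u - v. (\<psi> i (t i))\<^sup>2)) \<partial>LP (u - v))"
      by (simp only:, subst nn_integral_cmult) (auto simp: space_PiM)
    with elim c show ?case
      unfolding good_def by (auto simp: ennreal_mult_eq_top_iff less_top[symmetric] nz)
  qed
qed

lemma T_integrand_integrable:
  assumes "good u v y" "\<And>i. i \<in> u - v \<Longrightarrow> m i \<in> borel_measurable borel"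
    "\<And>i. i \<in> u - v \<Longrightarrow> (\<integral>\<^sup>+t. ennreal ((m i t)\<^sup>2 / (\<psi> i t)\<^sup>2) \<partial>lborel) < \<infinity>"
  shows "integrable (LP (u - v)) (\<lambda>t. F u (override_on y t (u - v)) * (\<Prod>i\<in>u - v. m i (t i)))"
proof (rule product_weight_integrable[where \<psi>=\<psi>])
  show "(\<lambda>t. F u (override_on y t (u - v))) \<in> borel_measurable (LP (u - v))"
    by (rule F_override_meas) (auto simp: space_PiM)
qed (use assms psi_pos in \<open>auto simp: good_def\<close>)

lemma T_meas [measurable]: "T u v \<in> borel_measurable (LP UNIV)"
proof -
  interpret sigma_finite_measure "LP (u - v)" by (rule sigma_finite_LP)
  show ?thesis
    unfolding T_def by (rule borel_measurable_lebesgue_integral) measurable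
qed

text \<open>In \<open>ker (y j) s - ker \<tau> s\<close> the term with \<Phi> cancels, and only the
  difference of the two steps is left. This is the integrated form of the rule that the derivative
  of \<open>T u v\<close> in direction \<open>j\<close> is \<open>T u (insert j v)\<close>.\<close>

lemma T_diff:
  assumes "v \<subseteq> u" "j \<in> u - v" "good u v y"
  shows "T u v y - T u v (y(j := \<tau>)) =
      (LINT s|lborel. (of_bool (s \<le> y j) - of_bool (s \<le> \<tau>)) * T u (insert j v) (y(j := s)))" (is ?eq)
    and "integrable lborel (\<lambda>s. (of_bool (s \<le> y j) - of_bool (s \<le> \<tau>)) * T u (insert j v) (y(j := s)))" (is ?int)
proof -
  define w where "w = u - insert j v"
  have uv: "u - v = insert j w" "j \<notin> w" using assms by (auto simp: w_def)
  define f where "f y' t = F u (override_on y t (u - v)) * (\<Prod>i\<in>u - v. ker (y' i) (t i))" for y' t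
  have int: "integrable (LP (u - v)) (f y')" for y'
    unfolding f_def using assms(3) by (rule T_integrand_integrable) (measurable, rule ker_L2)
  have T1: "T u v y = integral\<^sup>L (LP (u - v)) (f y)"
    unfolding T_def f_def ..
  \<comment> \<open>The coordinate \<open>j\<close> is integrated out, hence overwritten by
    \<open>t\<close>.\<close>
  have "override_on (y(j := \<tau>)) t (u - v) = override_on y t (u - v)" for t
    using assms by (auto simp: override_on_def)
  then have T2: "T u v (y(j := \<tau>)) = integral\<^sup>L (LP (u - v)) (f (y(j := \<tau>)))"
    unfolding T_def f_def by simp
  define d where "d t = f y t - f (y(j := \<tau>)) t" for t
  have dint: "integrable (LP (insert j w)) d"
    unfolding d_def uv(1)[symmetric] by (intro Bochner_Integration.integrable_diff int)
  have "T u v y - T u v (y(j := \<tau>)) = integral\<^sup>L (LP (insert j w)) d"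
    unfolding T1 T2 d_def uv(1)[symmetric] by (intro Bochner_Integration.integral_diff[symmetric] int)
  also have "\<dots> = (LINT s|lborel. LINT t|LP w. d (t(j := s)))"
    by (rule LP_integral_insert[OF uv(2) dint])
  finally have *: "T u v y - T u v (y(j := \<tau>)) = (LINT s|lborel. LINT t|LP w. d (t(j := s)))" .
  have "(LINT t|LP w. d (t(j := s))) = (of_bool (s \<le> y j) - of_bool (s \<le> \<tau>)) * T u (insert j v) (y(j := s))" for s
  proof -
    have "d (t(j := s)) = (of_bool (s \<le> y j) - of_bool (s \<le> \<tau>)) *
        (F u (override_on (y(j := s)) t w) * (\<Prod>i\<in>w. ker ((y(j := s)) i) (t i)))" for t
    proof -
      have 1: "override_on y (t(j := s)) (insert j w) = override_on (y(j := s)) t w"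
        using uv(2) by (auto simp: override_on_def)
      have 2: "(\<Prod>i\<in>w. ker (y i) ((t(j := s)) i)) = (\<Prod>i\<in>w. ker (y i) (t i))"
        "(\<Prod>i\<in>w. ker ((y(j := \<tau>)) i) ((t(j := s)) i)) = (\<Prod>i\<in>w. ker (y i) (t i))"
        "(\<Prod>i\<in>w. ker ((y(j := s)) i) (t i)) = (\<Prod>i\<in>w. ker (y i) (t i))"
        using uv(2) by (auto intro!: prod.cong)
      have "ker (y j) s - ker \<tau> s = of_bool (s \<le> y j) - of_bool (s \<le> \<tau>)"
        by (simp add: ker_def)
      moreover have "d (t(j := s)) = (ker (y j) s - ker \<tau> s) * (F u (override_on (y(j := s)) t w) * (\<Prod>i\<in>w. ker (y i) (t i)))"
        unfolding d_def f_def uv(1) 1 prod.insert[OF finite uv(2)] 2 by (simp add: algebra_simps)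
      ultimately show ?thesis by (simp only: 2)
    qed
    then show ?thesis
      unfolding T_def w_def by simp
  qed
  then show ?eq ?int
    using * LP_integral_insert(2)[OF uv(2) dint] by simp_all
qed

lemma T_update_notin:
  assumes "j \<notin> u"
  shows "T u v (y(j := \<tau>)) = T u v y"
proof -
  have "F u (override_on (y(j := \<tau>)) t (u - v)) = F u (override_on y t (u - v))" for t
    using assms by (intro F_cong) (auto simp: override_on_def)
  moreover have "(\<Prod>i\<in>u - v. ker ((y(j := \<tau>)) i) (t i)) = (\<Prod>i\<in>u - v. ker (y i) (t i))" for t
    using assms by (intro prod.cong) auto
  ultimately show ?thesis by (simp only: T_def)
qed

lemma T_self [simp]: "T v v y = F v y"
  unfolding T_def by (simp add: PiM_empty lebesgue_integral_count_space_finite)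

text \<open>The mixed derivative in \<open>v\<close> of the claimed decomposition; summands whose
  \<open>u\<close> does not contain \<open>v\<close> have derivative 0. For the empty
  \<open>v\<close> it is the right-hand side of the representation.\<close>

definition H :: "'s set \<Rightarrow> ('s \<Rightarrow> real) \<Rightarrow> real" where
  "H v y = (\<Sum>u | v \<subseteq> u. T u v y)"

lemma H_meas [measurable]: "H v \<in> borel_measurable (LP UNIV)"
  unfolding H_def by measurable

lemma H_diff:
  assumes "j \<notin> v" "\<And>u. v \<subseteq> u \<Longrightarrow> good u v y"
  shows "H v y - H v (y(j := \<tau>)) =
      (LINT s|lborel. (of_bool (s \<le> y j) - of_bool (s \<le> \<tau>)) * H (insert j v) (y(j := s)))"
    and "integrable lborel (\<lambda>s. (of_bool (s \<le> y j) - of_bool (s \<le> \<tau>)) * H (insert j v) (y(j := s)))"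
proof -
  have "H v y - H v (y(j := \<tau>)) = (\<Sum>u | v \<subseteq> u. T u v y - T u v (y(j := \<tau>)))"
    by (simp add: H_def sum_subtractf)
  also have "\<dots> = (\<Sum>u | insert j v \<subseteq> u. T u v y - T u v (y(j := \<tau>)))"
    by (rule sum.mono_neutral_right) (auto, metis T_update_notin)
  also have "\<dots> = (\<Sum>u | insert j v \<subseteq> u. (LINT s|lborel. (of_bool (s \<le> y j) - of_bool (s \<le> \<tau>)) * T u (insert j v) (y(j := s))))"
    using assms by (intro sum.cong T_diff) auto
  also have "\<dots> = (LINT s|lborel. (\<Sum>u | insert j v \<subseteq> u. (of_bool (s \<le> y j) - of_bool (s \<le> \<tau>)) * T u (insert j v) (y(j := s))))"
    using assms by (intro Bochner_Integration.integral_sum[symmetric] T_diff) auto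
  finally show "H v y - H v (y(j := \<tau>)) =
      (LINT s|lborel. (of_bool (s \<le> y j) - of_bool (s \<le> \<tau>)) * H (insert j v) (y(j := s)))"
    by (simp add: H_def sum_distrib_left)
  show "integrable lborel (\<lambda>s. (of_bool (s \<le> y j) - of_bool (s \<le> \<tau>)) * H (insert j v) (y(j := s)))"
    unfolding H_def sum_distrib_left
    using assms by (intro Bochner_Integration.integrable_sum T_diff) auto
qed

text \<open>Some coordinate of \<open>u\<close> lies outside \<open>v\<close>, and averaging its
  kernel against \<phi> gives 0 by \<open>ker_mean\<close>. The work is in the interchange of the
  integrals: averaging the absolute kernels first yields the decaying factors 2 \<Phi> (1 - \<Phi>),
  which are integrable together with \<open>F u\<close>.\<close>

lemma T_mean:
  assumes "v \<subset> u" "good u v y"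
  shows "(LINT z|LP (-v). T u v (override_on y z (-v)) * (\<Prod>j\<in>-v. \<phi> (z j))) = 0" (is ?eq)
    and "integrable (LP (-v)) (\<lambda>z. T u v (override_on y z (-v)) * (\<Prod>j\<in>-v. \<phi> (z j)))" (is ?int)
proof -
  interpret pair_sigma_finite "LP (u - v)" "LP (- v)" by (rule pair_sigma_finite_LP)
  define A where "A t = F u (override_on y t (u - v))" for t
  \<comment> \<open>One factor for each averaged coordinate; outside \<open>u\<close> only the
    density remains, with integral 1.\<close>
  define q where "q t i x = \<phi> x * (if i \<in> u then ker x (t i) else 1)" for t :: "'s \<Rightarrow> real" and i x
  have [measurable]: "A \<in> borel_measurable (LP (u - v))"
    unfolding A_def by (rule F_override_meas) (auto simp: space_PiM)
  have qint: "integrable lborel (q t i)" for t i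
    unfolding q_def using ker_integrable phi_integrable by (cases "i \<in> u") auto
  have qmean: "integral\<^sup>L lborel (q t i) = (if i \<in> u then 0 else 1)" for t i
    unfolding q_def using ker_mean integral_phi by (cases "i \<in> u") auto
  have qabs: "(LINT x|lborel. \<bar>q t i x\<bar>) = (if i \<in> u then 2 * \<Phi> (t i) * (1 - \<Phi> (t i)) else 1)" for t i
    unfolding q_def using ker_abs_mean integral_phi by (cases "i \<in> u") (auto simp: abs_mult phi_nonneg)
  define f where "f t z = A t * (\<Prod>i\<in>-v. q t i (z i))" for t z
  have [measurable]: "(\<lambda>x. \<Prod>i\<in>-v. q (fst x) i (snd x i)) \<in> borel_measurable (LP (u - v) \<Otimes>\<^sub>M LP (- v))"
  proof (rule borel_measurable_prod)
    fix i assume i: "i \<in> -v"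
    show "(\<lambda>x. q (fst x) i (snd x i)) \<in> borel_measurable (LP (u - v) \<Otimes>\<^sub>M LP (- v))"
    proof (cases "i \<in> u")
      case True
      with i have i': "i \<in> u - v" by auto
      note measurable_LP_snd[OF i, measurable] measurable_LP_fst[OF i', measurable]
      show ?thesis unfolding q_def if_P[OF True] by measurable
    next
      case False
      note measurable_LP_snd[OF i, measurable]
      show ?thesis unfolding q_def if_not_P[OF False] by measurable
    qed
  qed
  have fm [measurable]: "case_prod f \<in> borel_measurable (LP (u - v) \<Otimes>\<^sub>M LP (- v))"
    unfolding f_def case_prod_beta by measurable
  have int: "integrable (LP (u - v) \<Otimes>\<^sub>M LP (- v)) (case_prod f)"
  proof (rule Fubini_integrable[OF fm])
    have "(LINT z|LP (-v). norm (case (t, z) of (t, z) \<Rightarrow> f t z)) = norm (A t * (\<Prod>i\<in>u - v. 2 * \<Phi> (t i) * (1 - \<Phi> (t i))))" for t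
    proof -
      have "(LINT z|LP (-v). norm (case (t, z) of (t, z) \<Rightarrow> f t z)) = \<bar>A t\<bar> * (LINT z|LP (-v). (\<Prod>i\<in>-v. \<bar>q t i (z i)\<bar>))"
        by (simp add: f_def abs_mult abs_prod)
      also have "(LINT z|LP (-v). (\<Prod>i\<in>-v. \<bar>q t i (z i)\<bar>)) = (\<Prod>i\<in>-v. (LINT x|lborel. \<bar>q t i x\<bar>))"
        by (rule LP.product_integral_prod) (auto intro: qint)
      also have "\<dots> = (\<Prod>i\<in>u-v. (LINT x|lborel. \<bar>q t i x\<bar>))"
        by (rule prod.mono_neutral_right) (auto simp: qabs)
      also have "\<dots> = (\<Prod>i\<in>u-v. 2 * \<Phi> (t i) * (1 - \<Phi> (t i)))"
        by (rule prod.cong) (auto simp: qabs)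
      also have "\<dots> = \<bar>\<Prod>i\<in>u-v. 2 * \<Phi> (t i) * (1 - \<Phi> (t i))\<bar>"
        by (rule abs_of_nonneg[symmetric]) (auto intro!: prod_nonneg)
      finally show ?thesis by (simp add: abs_mult)
    qed
    then show "integrable (LP (u - v)) (\<lambda>t. LINT z|LP (-v). norm (case (t, z) of (t, z) \<Rightarrow> f t z))"
      unfolding A_def
      by (simp only:) (intro integrable_norm T_integrand_integrable assms ker_abs_mean_L2, measurable)
    have "integrable (LP (- v)) (f t)" for t
      unfolding f_def by (intro integrable_mult_right LP.product_integrable_prod qint) simp
    then show "AE t in LP (u - v). integrable (LP (- v)) (\<lambda>z. case (t, z) of (t, z) \<Rightarrow> f t z)"
      by simp
  qed
  have Teq: "T u v (override_on y z (-v)) * (\<Prod>j\<in>-v. \<phi> (z j)) = (LINT t|LP (u - v). f t z)" for z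
  proof -
    have "F u (override_on (override_on y z (-v)) t (u - v)) = A t" for t
      unfolding A_def using assms(1) by (intro F_cong) (auto simp: override_on_def)
    moreover have "(\<Prod>i\<in>u - v. ker (override_on y z (- v) i) (t i)) * (\<Prod>j\<in>-v. \<phi> (z j)) = (\<Prod>i\<in>-v. q t i (z i))" for t
    proof -
      have "(\<Prod>i\<in>u - v. ker (override_on y z (- v) i) (t i)) = (\<Prod>i\<in>u - v. if i \<in> u then ker (z i) (t i) else 1)"
        by (rule prod.cong) auto
      also have "\<dots> = (\<Prod>i\<in>-v. if i \<in> u then ker (z i) (t i) else 1)"
        by (rule prod.mono_neutral_left) auto
      finally show ?thesis
        by (simp add: q_def prod.distrib mult.commute)
    qed
    ultimately show ?thesis
      unfolding T_def f_def by (simp flip: integral_mult_left_zero add: mult.assoc)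
  qed
  show ?int
    unfolding Teq by (rule integrable_snd[OF int])
  have "(LINT z|LP (-v). f t z) = 0" for t
  proof -
    have "(LINT z|LP (-v). f t z) = A t * (\<Prod>i\<in>-v. integral\<^sup>L lborel (q t i))"
      unfolding f_def by (simp add: LP.product_integral_prod qint)
    also have "(\<Prod>i\<in>-v. integral\<^sup>L lborel (q t i)) = 0"
      using assms(1) by (auto simp: qmean)
    finally show ?thesis by simp
  qed
  then show ?eq
    unfolding Teq Fubini_integral[OF int] by simp
qed

lemma H_mean:
  assumes "\<And>u. v \<subseteq> u \<Longrightarrow> good u v y"
  shows "(LINT z|LP (-v). H v (override_on y z (-v)) * (\<Prod>j\<in>-v. \<phi> (z j))) = F v y"
    and "integrable (LP (-v)) (\<lambda>z. H v (override_on y z (-v)) * (\<Prod>j\<in>-v. \<phi> (z j)))"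
proof -
  have F: "F v (override_on y z (-v)) = F v y" for z
    by (rule F_cong) simp
  have phi: "integrable (LP (-v)) (\<lambda>z. \<Prod>j\<in>-v. \<phi> (z j))" "(LINT z|LP (-v). (\<Prod>j\<in>-v. \<phi> (z j))) = 1"
    using LP.product_integrable_prod[of "-v" "\<lambda>_. \<phi>"] LP.product_integral_prod[of "-v" "\<lambda>_. \<phi>"]
      phi_integrable integral_phi by auto
  have int: "integrable (LP (-v)) (\<lambda>z. T u v (override_on y z (-v)) * (\<Prod>j\<in>-v. \<phi> (z j)))" if "v \<subseteq> u" for u
    using T_mean(2)[of v u y] assms[OF that] that phi(1) by (cases "u = v") (auto simp: F)
  then show "integrable (LP (-v)) (\<lambda>z. H v (override_on y z (-v)) * (\<Prod>j\<in>-v. \<phi> (z j)))"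
    unfolding H_def sum_distrib_right by auto
  have "(LINT z|LP (-v). H v (override_on y z (-v)) * (\<Prod>j\<in>-v. \<phi> (z j))) =
     (\<Sum>u | v \<subseteq> u. (LINT z|LP (-v). T u v (override_on y z (-v)) * (\<Prod>j\<in>-v. \<phi> (z j))))"
    unfolding H_def sum_distrib_right using int by (intro Bochner_Integration.integral_sum) auto
  also have "\<dots> = (\<Sum>u | v \<subseteq> u. if u = v then F v y else 0)"
    using T_mean(1)[of v _ y] assms phi by (intro sum.cong) (auto simp: F)
  also have "\<dots> = F v y"
    by simp
  finally show "(LINT z|LP (-v). H v (override_on y z (-v)) * (\<Prod>j\<in>-v. \<phi> (z j))) = F v y" .
qed

text \<open>
  Here \<open>g v\<close> stands for the mixed derivative in the variables \<open>v\<close>.  Downward induction on \<open>v\<close>: if the claim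
  holds for all \<open>insert j v\<close>, then \<open>g v - H v\<close> does not depend on the variables outside \<open>v\<close>, and
  averaging over these gives \<open>F v - F v = 0\<close>.
\<close>

proposition anova_representation:
  fixes g :: "'s set \<Rightarrow> ('s \<Rightarrow> real) \<Rightarrow> real"
  assumes g_meas [measurable]: "\<And>v. g v \<in> borel_measurable (LP UNIV)"
    and g_diff: "\<And>v j. j \<notin> v \<Longrightarrow> AE y in LP UNIV. AE \<tau> in lborel. g v y - g v (y(j := \<tau>)) =
        (LINT s|lborel. (of_bool (s \<le> y j) - of_bool (s \<le> \<tau>)) * g (insert j v) (y(j := s)))"
    and g_int: "\<And>v. AE y in LP UNIV. integrable (LP (-v)) (\<lambda>z. g v (override_on y z (-v)) * (\<Prod>j\<in>-v. \<phi> (z j)))"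
    and F_eq: "\<And>v y. F v y = (LINT z|LP (-v). g v (override_on y z (-v)) * (\<Prod>j\<in>-v. \<phi> (z j)))"
  shows "AE y in LP UNIV. g v y = H v y"
proof (induction "card (-v)" arbitrary: v rule: less_induct)
  case less
  define R where "R y = g v y - H v y" for y
  have [measurable]: "R \<in> borel_measurable (LP UNIV)"
    unfolding R_def by measurable
  have good: "AE y in LP UNIV. \<forall>u\<in>{u. v \<subseteq> u}. good u v y"
    by (intro AE_finite_allI) (auto intro: good_AE)
  \<comment> \<open>Both increments in direction \<open>j\<close> are integrals of the functions for
    \<open>insert j v\<close>, which agree on almost every line.\<close>
  have "AE y in LP UNIV. AE t in lborel. R (y(j := t)) = R y" if "j \<in> -v" for j
  proof -
    have "card (- insert j v) < card (- v)"
      using that by (intro psubset_card_mono) auto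
    then have "AE y in LP UNIV. g (insert j v) y = H (insert j v) y"
      by (rule less)
    then have "AE y in LP UNIV. AE s in lborel. g (insert j v) (y(j := s)) = H (insert j v) (y(j := s))"
      by (rule AE_LP_update)
    moreover have "AE y in LP UNIV. AE \<tau> in lborel. g v y - g v (y(j := \<tau>)) =
        (LINT s|lborel. (of_bool (s \<le> y j) - of_bool (s \<le> \<tau>)) * g (insert j v) (y(j := s)))"
      using that by (intro g_diff) simp
    ultimately show ?thesis
      using good AE_space[of "LP UNIV"]
    proof eventually_elim
      case (elim y)
      from elim(2) show ?case
      proof eventually_elim
        case (elim \<tau>)
        have [measurable]: "(\<lambda>s. y(j := s)) \<in> lborel \<rightarrow>\<^sub>M LP UNIV"
          using measurable_component_update[of y "UNIV - {j}" "\<lambda>_. lborel" j]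
          by (intro measurable_abs_UNIV) (simp add: fun_upd_def)
        have "(LINT s|lborel. (of_bool (s \<le> y j) - of_bool (s \<le> \<tau>)) * g (insert j v) (y(j := s))) =
           (LINT s|lborel. (of_bool (s \<le> y j) - of_bool (s \<le> \<tau>)) * H (insert j v) (y(j := s)))"
          using \<open>AE s in lborel. g (insert j v) (y(j := s)) = H (insert j v) (y(j := s))\<close>
          by (intro integral_cong_AE) (measurable, auto elim!: eventually_mono)
        also have "\<dots> = H v y - H v (y(j := \<tau>))"
          using that \<open>\<forall>u\<in>{u. v \<subseteq> u}. good u v y\<close> by (intro H_diff(1)[symmetric]) auto
        finally show ?case
          using elim by (simp add: R_def)
      qed
    qed
  qed
  then have "AE y in LP UNIV. AE z in LP (-v). R (override_on y z (-v)) = R y"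
    by (rule AE_indep_override[rotated]) measurable
  with good g_int[of v] have "AE y in LP UNIV. R y = 0"
  proof eventually_elim
    case (elim y)
    have good: "good u v y" if "v \<subseteq> u" for u
      using elim(1) that by auto
    have [measurable]: "(\<lambda>z. override_on y z (-v)) \<in> LP (-v) \<rightarrow>\<^sub>M LP UNIV"
      by (rule measurable_override_on) (auto simp: space_PiM)
    have phi: "integrable (LP (-v)) (\<lambda>z. \<Prod>j\<in>-v. \<phi> (z j))" "(LINT z|LP (-v). (\<Prod>j\<in>-v. \<phi> (z j))) = 1"
      using LP.product_integrable_prod[of "-v" "\<lambda>_. \<phi>"] LP.product_integral_prod[of "-v" "\<lambda>_. \<phi>"]
        phi_integrable integral_phi by auto
    have "R y = (LINT z|LP (-v). R y * (\<Prod>j\<in>-v. \<phi> (z j)))"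
      using phi by simp
    also have "\<dots> = (LINT z|LP (-v). R (override_on y z (-v)) * (\<Prod>j\<in>-v. \<phi> (z j)))"
      using elim(3) by (intro integral_cong_AE) (measurable, auto elim!: eventually_mono)
    also have "\<dots> = (LINT z|LP (-v). g v (override_on y z (-v)) * (\<Prod>j\<in>-v. \<phi> (z j)) -
                                H v (override_on y z (-v)) * (\<Prod>j\<in>-v. \<phi> (z j)))"
      by (simp add: R_def left_diff_distrib)
    also have "\<dots> = F v y - F v y"
      using elim(2) H_mean[of v y] good by (subst Bochner_Integration.integral_diff) (auto simp flip: F_eq)
    finally show ?case by simp
  qed
  then show ?case by (simp add: R_def)
qed

lemma H_empty: "H {} y = (\<Sum>u\<in>UNIV. LINT t|LP u. F u t * (\<Prod>i\<in>u. ker (y i) (t i)))"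
proof -
  have "F u (override_on y t u) = F u t" for u t
    by (rule F_cong) simp
  then show ?thesis by (simp add: H_def T_def)
qed

end

section \<open>Weak derivatives and integration along lines\<close>

lemma measurable_vec_lambda [measurable]: "vec_lambda \<in> LP (UNIV :: 's::finite set) \<rightarrow>\<^sub>M (borel :: (real^'s) measure)"
proof -
  have eq: "vec_lambda = (\<lambda>y :: 's \<Rightarrow> real. \<Sum>i\<in>UNIV. y i *\<^sub>R axis i (1::real))"
    by (rule ext) (simp add: vec_eq_iff axis_def if_distrib[of "\<lambda>x. _ * x"] cong: if_cong)
  show ?thesis
    unfolding eq by measurable
qed

lemma measurable_vec_nth_LP [measurable]: "vec_nth \<in> (borel :: (real^'s::finite) measure) \<rightarrow>\<^sub>M LP UNIV"
  using measurable_abs_UNIV[of "\<lambda>n (x :: real^'s). x $ n" borel "\<lambda>_. lborel"] by simp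

lemma lborel_vec: "lborel = distr (LP UNIV) borel (vec_lambda :: _ \<Rightarrow> real^'s::finite)"
proof (rule lborel_eqI)
  fix l u :: "real^'s" assume lu: "\<And>b. b \<in> Basis \<Longrightarrow> l \<bullet> b \<le> u \<bullet> b"
  have le: "l $ i \<le> u $ i" for i
    using lu[of "axis i 1"] by (simp add: inner_axis)
  have "vec_lambda -` box l u \<inter> space (LP UNIV) = PiE UNIV (\<lambda>i. {l $ i<..<u $ i})"
    by (auto simp: space_PiM mem_box_cart PiE_iff)
  then have "emeasure (distr (LP UNIV) borel vec_lambda) (box l u) = (\<Prod>i\<in>UNIV. ennreal (u $ i - l $ i))"
    using le by (subst emeasure_distr) (auto simp: LP.emeasure_PiM)
  also have "\<dots> = ennreal (\<Prod>i\<in>UNIV. (u - l) $ i)"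
    using le by (subst prod_ennreal) auto
  also have "(\<Prod>i\<in>UNIV. (u - l) $ i) = (\<Prod>b\<in>Basis. (u - l) \<bullet> b)"
    unfolding Basis_vec_def by (simp add: prod.UNION_disjoint axis_eq_axis inner_axis)
  finally show "emeasure (distr (LP UNIV) borel vec_lambda) (box l u) = (\<Prod>b\<in>Basis. (u - l) \<bullet> b)" .
qed simp

lemma LP_UNIV_vec: "LP UNIV = distr (lborel :: (real^'s::finite) measure) (LP UNIV) vec_nth"
proof -
  have "distr (lborel :: (real^'s::finite) measure) (LP UNIV) vec_nth = distr (LP UNIV) (LP UNIV) (vec_nth \<circ> (vec_lambda :: _ \<Rightarrow> real^'s::finite))"
    unfolding lborel_vec by (rule distr_distr) measurable
  also have "vec_nth \<circ> (vec_lambda :: _ \<Rightarrow> real^'s::finite) = (\<lambda>x. x)"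
    by (auto simp: fun_eq_iff)
  finally show ?thesis by (simp add: distr_id2)
qed

lemma AE_vec_lambda: "AE x in (lborel :: (real^'s::finite) measure). Q x \<Longrightarrow> AE y in LP UNIV. Q (vec_lambda y)"
  unfolding lborel_vec by (rule AE_distrD) measurable

lemma AE_vec_nth: "AE y in LP UNIV. Q y \<Longrightarrow> AE x in (lborel :: (real^'s::finite) measure). Q (vec_nth x)"
proof -
  assume "AE y in LP UNIV. Q y"
  then have "AE y in distr (lborel :: (real^'s) measure) (LP UNIV) vec_nth. Q y"
    by (subst LP_UNIV_vec[symmetric])
  then show "AE x in (lborel :: (real^'s) measure). Q (vec_nth x)"
    by (rule AE_distrD[rotated]) measurable
qed

lemma integral_vec:
  fixes f :: "real^'s::finite \<Rightarrow> real"
  assumes "f \<in> borel_measurable borel"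
  shows "(LINT x|lborel. f x) = (LINT y|LP UNIV. f (vec_lambda y))"
  unfolding lborel_vec by (rule integral_distr[OF measurable_vec_lambda assms])

section \<open>Smooth functions of one variable and smooth bumps\<close>

text \<open>The whole sequence of derivatives is the witness, so each closure property is proved by
  writing down a sequence.\<close>

definition smooth :: "(real \<Rightarrow> real) \<Rightarrow> bool" where
  "smooth f \<longleftrightarrow> (\<exists>D. D 0 = f \<and> (\<forall>n x. (D n has_real_derivative D (Suc n) x) (at x)))"

lemma smooth_has_derivative:
  assumes "smooth f"
  obtains f' where "\<And>x. (f has_real_derivative f' x) (at x)" "smooth f'"
proof -
  obtain D where D: "D 0 = f" "\<And>n x. (D n has_real_derivative D (Suc n) x) (at x)"
    using assms by (auto simp: smooth_def)
  have "smooth (D 1)"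
    unfolding smooth_def by (rule exI[of _ "\<lambda>n. D (Suc n)"]) (use D(2) in auto)
  with D(1) D(2)[of 0] that show ?thesis by auto
qed

lemma smooth_antiderivative:
  assumes "smooth f" "\<And>x. (g has_real_derivative f x) (at x)"
  shows "smooth g"
proof -
  obtain D where D: "D 0 = f" "\<And>n x. (D n has_real_derivative D (Suc n) x) (at x)"
    using assms by (auto simp: smooth_def)
  show ?thesis
    unfolding smooth_def
    by (rule exI[of _ "case_nat g D"]) (use D assms(2) in \<open>auto split: nat.split\<close>)
qed

lemma smooth_continuous: "smooth f \<Longrightarrow> continuous_on A f"
  by (meson DERIV_isCont continuous_at_imp_continuous_on smooth_has_derivative)

lemma smooth_diff:
  assumes "smooth f" "smooth g"
  shows "smooth (\<lambda>x. f x - g x)"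
proof -
  obtain D1 where D1: "D1 0 = f" "\<And>n x. (D1 n has_real_derivative D1 (Suc n) x) (at x)"
    using assms by (auto simp: smooth_def)
  obtain D2 where D2: "D2 0 = g" "\<And>n x. (D2 n has_real_derivative D2 (Suc n) x) (at x)"
    using assms by (auto simp: smooth_def)
  show ?thesis
    unfolding smooth_def
    by (rule exI[of _ "\<lambda>n x. D1 n x - D2 n x"]) (auto simp: D1(1) D2(1) intro!: DERIV_diff D1(2) D2(2))
qed

lemma smooth_affine:
  assumes "smooth f"
  shows "smooth (\<lambda>x. f (c * x + d))"
proof -
  obtain D where D: "D 0 = f" "\<And>n x. (D n has_real_derivative D (Suc n) x) (at x)"
    using assms by (auto simp: smooth_def)
  have "((\<lambda>x. c ^ n * D n (c * x + d)) has_real_derivative c ^ Suc n * D (Suc n) (c * x + d)) (at x)" for n x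
    by (auto intro!: derivative_eq_intros DERIV_chain2[OF D(2)])
  then show ?thesis
    unfolding smooth_def by (intro exI[of _ "\<lambda>n x. c ^ n * D n (c * x + d)"]) (auto simp: D(1))
qed

text \<open>Every derivative of the product is a sum of terms \<open>D1 a x * D2 b x\<close>. A list
  of pairs (a, b) records this sum with repetitions, and \<open>next_list\<close> performs the
  product rule on each entry; binomial coefficients never appear.\<close>

lemma smooth_mult:
  assumes "smooth f" "smooth g"
  shows "smooth (\<lambda>x. f x * g x)"
proof -
  obtain D1 where D1: "D1 0 = f" "\<And>n x. (D1 n has_real_derivative D1 (Suc n) x) (at x)"
    using assms by (auto simp: smooth_def)
  obtain D2 where D2: "D2 0 = g" "\<And>n x. (D2 n has_real_derivative D2 (Suc n) x) (at x)"
    using assms by (auto simp: smooth_def)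
  define S where "S l x = (\<Sum>(a, b)\<leftarrow>l. D1 a x * D2 b x)" for l :: "(nat \<times> nat) list" and x
  define next_list where "next_list l = concat (map (\<lambda>(a, b). [(Suc a, b), (a, Suc b)]) l)" for l :: "(nat \<times> nat) list"
  have "(S l has_real_derivative S (next_list l) x) (at x)" for l x
  proof (induction l)
    case Nil
    then show ?case by (simp add: S_def next_list_def)
  next
    case (Cons p l)
    obtain a b where p: "p = (a, b)" by force
    have "S (p # l) = (\<lambda>x. D1 a x * D2 b x + S l x)"
      by (simp add: S_def p fun_eq_iff)
    moreover have "S (next_list (p # l)) x = (D1 (Suc a) x * D2 b x + D2 (Suc b) x * D1 a x) + S (next_list l) x"
      by (simp add: S_def next_list_def p)
    moreover have "((\<lambda>x. D1 a x * D2 b x + S l x) has_real_derivative (D1 (Suc a) x * D2 b x + D2 (Suc b) x * D1 a x) + S (next_list l) x) (at x)"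
      by (intro DERIV_add DERIV_mult D1 D2 Cons)
    ultimately show ?case by (simp only:)
  qed
  then show ?thesis
    unfolding smooth_def
    by (intro exI[of _ "\<lambda>n. S ((next_list ^^ n) [(0, 0)])"]) (auto simp: S_def D1(1) D2(1) fun_eq_iff)
qed

definition exp_cutoff :: "real \<Rightarrow> real" where
  "exp_cutoff x = (if x > 0 then exp (- 1 / x) else 0)"

lemma exp_cutoff_bounds: "0 \<le> exp_cutoff x" "exp_cutoff x \<le> 1"
  by (auto simp: exp_cutoff_def)

lemma poly_times_exp_minus_tendsto_0: "((\<lambda>s. poly p s * exp (- s)) \<longlongrightarrow> 0) (at_top :: real filter)"
proof -
  have "((\<lambda>s. \<Sum>i\<le>degree p. coeff p i * (s ^ i / exp s)) \<longlongrightarrow> (\<Sum>i\<le>degree p. coeff p i * 0)) at_top"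
    by (intro tendsto_sum tendsto_mult tendsto_const tendsto_power_div_exp_0)
  then show ?thesis
    by (simp add: poly_altdef exp_minus sum_distrib_right sum_distrib_left divide_inverse mult_ac)
qed

text \<open>On the right of 0 the derivatives keep the form p(1/x) exp(-1/x). As 1/x has the
  derivative -1/x^2, differentiation sends p to X^2 (p - p'), the map \<open>q\<close>. At 0 the
  exponential beats every polynomial in 1/x.\<close>

lemma smooth_exp_cutoff: "smooth exp_cutoff"
proof -
  define E where "E p x = (if x > 0 then poly p (1 / x) * exp (- 1 / x) else 0)" for p and x :: real
  define q where "q p = [:0, 0, 1:] * (p - pderiv p)" for p :: "real poly"
  have "(E p has_real_derivative E (q p) x) (at x)" for p x
  proof -
    consider "x > 0" | "x < 0" | "x = 0" by linarith
    then show ?thesis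
    proof cases
      case 1
      have "((\<lambda>x. poly p (1 / x) * exp (- 1 / x)) has_real_derivative E (q p) x) (at x)"
        using 1 by (auto intro!: derivative_eq_intros DERIV_chain2[OF poly_DERIV]
            simp: E_def q_def field_simps power2_eq_square)
      moreover have "\<forall>\<^sub>F y in nhds x. y > 0"
        using 1 by (intro eventually_nhds_in_open[of "{0<..}", simplified]) auto
      then have "\<forall>\<^sub>F y in nhds x. E p y = poly p (1 / y) * exp (- 1 / y)"
        by eventually_elim (simp add: E_def)
      ultimately show ?thesis by (subst DERIV_cong_ev[OF refl _ refl])
    next
      case 2
      have "\<forall>\<^sub>F y in nhds x. y < 0"
        using 2 by (intro eventually_nhds_in_open[of "{..<0}", simplified]) auto
      then have "\<forall>\<^sub>F y in nhds x. E p y = 0"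
        by eventually_elim (simp add: E_def)
      moreover have "((\<lambda>_. 0) has_real_derivative E (q p) x) (at x)"
        using 2 by (simp add: E_def)
      ultimately show ?thesis by (subst DERIV_cong_ev[OF refl _ refl])
    next
      case 3
      \<comment> \<open>On the right, the difference quotient at 0 has the same shape with X p in
        place of p; on the left it is 0.\<close>
      have "((\<lambda>h. E p h / h) \<longlongrightarrow> 0) (at 0)"
      proof (rule filterlim_split_at)
        have "((\<lambda>h. poly (pCons 0 p) (inverse h) * exp (- inverse h)) \<longlongrightarrow> 0) (at_right (0::real))"
          by (rule filterlim_compose[OF poly_times_exp_minus_tendsto_0 filterlim_inverse_at_top_right])
        then show "((\<lambda>h. E p h / h) \<longlongrightarrow> 0) (at_right 0)"
          by (rule Lim_transform_eventually)
             (auto simp: eventually_at_filter E_def field_simps intro!: always_eventually)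
        show "((\<lambda>h. E p h / h) \<longlongrightarrow> 0) (at_left 0)"
          by (rule Lim_transform_eventually[OF tendsto_const])
             (auto simp: eventually_at_filter E_def intro!: always_eventually)
      qed
      then show ?thesis
        using 3 by (simp add: DERIV_def E_def)
    qed
  qed
  moreover have "exp_cutoff = E 1"
    by (auto simp: exp_cutoff_def E_def)
  ultimately show ?thesis
    unfolding smooth_def by (intro exI[of _ "\<lambda>n. E ((q ^^ n) 1)"]) auto
qed

text \<open>As \<open>n\<close> grows, these functions tend to the indicator of the open interval,
  with the common bound 1 and a fixed support, so dominated convergence can replace them by
  indicators.\<close>

definition bump :: "real \<Rightarrow> real \<Rightarrow> nat \<Rightarrow> real \<Rightarrow> real" where
  "bump a b n x = exp_cutoff (real n * (x - a)) * exp_cutoff (real n * (b - x))"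

lemma smooth_bump: "smooth (bump a b n)"
proof -
  have "smooth (\<lambda>x. exp_cutoff (real n * x + (- real n * a)) * exp_cutoff (- real n * x + real n * b))"
    by (intro smooth_mult smooth_affine smooth_exp_cutoff)
  then show ?thesis
    by (simp add: bump_def[abs_def] algebra_simps)
qed

lemma bump_bounds: "0 \<le> bump a b n x" "bump a b n x \<le> 1"
  by (auto simp: bump_def exp_cutoff_bounds mult_le_one)

lemma bump_support: "bump a b n x \<noteq> 0 \<Longrightarrow> a < x \<and> x < b"
  by (auto simp: bump_def exp_cutoff_def zero_less_mult_iff split: if_splits)

lemma bump_tendsto: "(\<lambda>n. bump a b n x) \<longlonglongrightarrow> indicator {a<..<b} x"
proof -
  have pos: "(\<lambda>n. exp_cutoff (real n * c)) \<longlonglongrightarrow> 1" if "c > 0" for c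
  proof -
    have "(\<lambda>n. exp (- 1 / (real n * c))) \<longlonglongrightarrow> 1"
      using that by real_asymp
    moreover have "\<forall>\<^sub>F n in sequentially. exp (- 1 / (real n * c)) = exp_cutoff (real n * c)"
      using eventually_gt_at_top[of 0] by eventually_elim (use that in \<open>simp add: exp_cutoff_def\<close>)
    ultimately show ?thesis by (rule Lim_transform_eventually)
  qed
  show ?thesis
  proof (cases "a < x \<and> x < b")
    case True
    then have "(\<lambda>n. bump a b n x) \<longlonglongrightarrow> 1 * 1"
      unfolding bump_def by (intro tendsto_mult pos) auto
    with True show ?thesis by simp
  next
    case False
    then have "bump a b n x = 0" for n
      using bump_support[of a b n x] by blast
    with False show ?thesis by auto
  qed
qed

lemma bump_measurable [measurable]: "bump a b n \<in> borel_measurable borel"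
  by (rule borel_measurable_continuous_onI) (rule smooth_continuous[OF smooth_bump])

section \<open>Tensor products as test functions\<close>

lemma partial_deriv_tensor:
  fixes f :: "'s::finite \<Rightarrow> real \<Rightarrow> real"
  assumes "\<And>i x. (f i has_real_derivative f' i x) (at x)"
  shows "(\<lambda>y. \<Prod>i\<in>UNIV. f i (y $ i)) differentiable (at y)"
    and "partial_deriv j (\<lambda>y. \<Prod>i\<in>UNIV. f i (y $ i)) = (\<lambda>y. \<Prod>i\<in>UNIV. (if i = j then f' i else f i) (y $ i))"
proof -
  have der: "((\<lambda>y. \<Prod>i\<in>UNIV. f i (y $ i)) has_derivative
      (\<lambda>h. \<Sum>i\<in>UNIV. (f' i (y $ i) * (h $ i)) * (\<Prod>k\<in>UNIV - {i}. f k (y $ k)))) (at y)" for y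
  proof (rule has_derivative_prod)
    fix i
    have "((\<lambda>y. y $ i) has_derivative (\<lambda>h. h $ i)) (at y)"
      by (intro bounded_linear_imp_has_derivative bounded_linear_vec_nth)
    from has_derivative_compose[OF this, of "f i" "(*) (f' i (y $ i))"]
    show "((\<lambda>y. f i (y $ i)) has_derivative (\<lambda>h. f' i (y $ i) * (h $ i))) (at y)"
      using assms[of i "y $ i"] by (simp add: has_field_derivative_def)
  qed
  then show "(\<lambda>y. \<Prod>i\<in>UNIV. f i (y $ i)) differentiable (at y)"
    by (auto simp: differentiable_def)
  show "partial_deriv j (\<lambda>y. \<Prod>i\<in>UNIV. f i (y $ i)) = (\<lambda>y. \<Prod>i\<in>UNIV. (if i = j then f' i else f i) (y $ i))"
  proof
    fix y
    have "partial_deriv j (\<lambda>y. \<Prod>i\<in>UNIV. f i (y $ i)) y =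
       (\<Sum>i\<in>UNIV. (f' i (y $ i) * (axis j 1 $ i)) * (\<Prod>k\<in>UNIV - {i}. f k (y $ k)))"
      unfolding partial_deriv_def by (subst frechet_derivative_at[OF der, symmetric]) simp
    also have "\<dots> = (\<Sum>i\<in>UNIV. if i = j then f' j (y $ j) * (\<Prod>k\<in>UNIV - {j}. f k (y $ k)) else 0)"
      by (intro sum.cong) (auto simp: axis_def)
    also have "\<dots> = f' j (y $ j) * (\<Prod>k\<in>UNIV - {j}. f k (y $ k))"
      by simp
    also have "\<dots> = (\<Prod>i\<in>UNIV. (if i = j then f' i else f i) (y $ i))"
      by (subst prod.remove[of UNIV j]) (auto intro!: arg_cong2[where f="(*)"] prod.cong)
    finally show "partial_deriv j (\<lambda>y. \<Prod>i\<in>UNIV. f i (y $ i)) y = (\<Prod>i\<in>UNIV. (if i = j then f' i else f i) (y $ i))" .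
  qed
qed

lemma test_function_tensor:
  fixes f :: "'s::finite \<Rightarrow> real \<Rightarrow> real"
  assumes "\<And>i. smooth (f i)" and supp: "\<And>i x. f i x \<noteq> 0 \<Longrightarrow> a i \<le> x \<and> x \<le> b i"
  shows "test_function (\<lambda>y. \<Prod>i\<in>UNIV. f i (y $ i))"
proof -
  obtain D where D: "\<And>i. D i 0 = f i" "\<And>i n x. (D i n has_real_derivative D i (Suc n) x) (at x)"
    using assms(1) unfolding smooth_def by metis
  \<comment> \<open>An iterated partial derivative differentiates the factor \<open>i\<close> as
    often as \<open>i\<close> occurs in \<open>js\<close>.\<close>
  have fold: "foldr partial_deriv js (\<lambda>y. \<Prod>i\<in>UNIV. f i (y $ i)) = (\<lambda>y. \<Prod>i\<in>UNIV. D i (count_list js i) (y $ i))" for js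
  proof (induction js)
    case Nil
    then show ?case by (simp add: D(1))
  next
    case (Cons j js)
    have "(if i = j then D i (Suc (count_list js i)) else D i (count_list js i)) = D i (count_list (j # js) i)" for i
      by auto
    then show ?case
      using partial_deriv_tensor(2)[of "\<lambda>i. D i (count_list js i)" "\<lambda>i. D i (Suc (count_list js i))" j]
      by (simp add: Cons D(2))
  qed
  have "{y. (\<Prod>i\<in>UNIV. f i (y $ i)) \<noteq> 0} \<subseteq> cbox (vec_lambda a) (vec_lambda b)"
    using supp by (auto simp: mem_box_cart)
  then have "closure {y. (\<Prod>i\<in>UNIV. f i (y $ i)) \<noteq> 0} \<subseteq> cbox (vec_lambda a) (vec_lambda b)"
    by (intro closure_minimal) auto
  then have "bounded (closure {y. (\<Prod>i\<in>UNIV. f i (y $ i)) \<noteq> 0})"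
    by (rule bounded_subset[OF bounded_cbox])
  then show ?thesis
    unfolding test_function_def fold by (auto simp: compact_eq_bounded_closed intro!: partial_deriv_tensor(1) D(2))
qed

lemma test_function_partial_deriv:
  assumes "test_function \<eta>" "compact (closure {x. partial_deriv j \<eta> x \<noteq> 0})"
  shows "test_function (partial_deriv j \<eta>)"
  unfolding test_function_def
proof (intro conjI allI)
  fix js x
  have "foldr partial_deriv js (partial_deriv j \<eta>) = foldr partial_deriv (js @ [j]) \<eta>"
    by simp
  then show "foldr partial_deriv js (partial_deriv j \<eta>) differentiable at x"
    using assms(1) unfolding test_function_def by metis
qed (rule assms)

section \<open>Local integrability and the fundamental lemma of the calculus of variations\<close>

lemma locally_integrable_measurable:
  fixes f :: "real^'s::finite \<Rightarrow> real"
  assumes "locally_integrable f"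
  shows "f \<in> borel_measurable borel"
proof (rule borel_measurable_LIMSEQ_real)
  fix n :: nat
  have "compact (cball (0 :: real^'s) (real n))" by simp
  then have "integrable lborel (\<lambda>x. indicator (cball 0 (real n)) x *\<^sub>R f x)"
    using assms unfolding locally_integrable_def set_integrable_def by blast
  then show "(\<lambda>x. indicator (cball 0 (real n)) x *\<^sub>R f x) \<in> borel_measurable borel"
    by auto
next
  fix x :: "real^'s"
  obtain N :: nat where N: "norm x \<le> real N" using real_arch_simple by blast
  have "\<forall>\<^sub>F n in sequentially. indicator (cball 0 (real n)) x *\<^sub>R f x = f x"
    using eventually_ge_at_top[of N] by eventually_elim (use N in \<open>auto simp: dist_norm\<close>)
  then show "(\<lambda>n. indicator (cball 0 (real n)) x *\<^sub>R f x) \<longlonglongrightarrow> f x"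
    by (rule tendsto_eventually)
qed

lemma locally_integrable_times_bounded:
  fixes f :: "real^'s::finite \<Rightarrow> real"
  assumes "locally_integrable f" and [measurable]: "w \<in> borel_measurable borel"
    and "\<And>x. \<bar>w x\<bar> \<le> B" "\<And>x. w x \<noteq> 0 \<Longrightarrow> x \<in> cbox a b"
  shows "integrable lborel (\<lambda>x. f x * w x)"
proof -
  have [measurable]: "f \<in> borel_measurable borel"
    by (rule locally_integrable_measurable[OF assms(1)])
  have "integrable lborel (\<lambda>x. B * (indicator (cbox a b) x *\<^sub>R f x))"
    using assms(1) unfolding locally_integrable_def set_integrable_def by (intro integrable_mult_right) auto
  moreover have "norm (f x * w x) \<le> norm (B * (indicator (cbox a b) x *\<^sub>R f x))" for x
  proof (cases "w x = 0")
    case False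
    then show ?thesis
      using assms(3)[of x] assms(4)[of x] mult_mono[of "\<bar>f x\<bar>" "\<bar>f x\<bar>" "\<bar>w x\<bar>" "\<bar>B\<bar>"]
      by (auto simp: abs_mult mult.commute)
  qed simp
  ultimately show ?thesis
    by (intro Bochner_Integration.integrable_bound[of lborel "\<lambda>x. B * (indicator (cbox a b) x *\<^sub>R f x)" "\<lambda>x. f x * w x"]) auto
qed

text \<open>The sets over which the integral vanishes form a Dynkin system, and the boxes are an
  intersection-stable generator of the Borel sets. The vanishing total integral is what handles
  complements.\<close>

lemma integral_zero_on_boxes:
  fixes f :: "'a::euclidean_space \<Rightarrow> real"
  assumes f: "integrable lborel f" and f0: "(LINT x|lborel. f x) = 0"
    and box: "\<And>a b. (LINT x|lborel. indicator (box a b) x * f x) = 0"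
  shows "AE x in lborel. f x = 0"
proof (rule sigma_finite_measure.density_zero[OF sigma_finite_lborel f])
  fix A :: "'a set" assume "A \<in> sets lborel"
  then have A: "A \<in> sigma_sets UNIV (range (\<lambda>(a, b). box a b))"
    by (simp add: borel_eq_box)
  have "Int_stable (range (\<lambda>(a, b). box a b :: 'a set))"
    by (auto simp: Int_stable_def box_Int_box)
  moreover have "range (\<lambda>(a, b). box a b) \<subseteq> Pow (UNIV :: 'a set)"
    by simp
  ultimately show "set_lebesgue_integral lborel A f = 0"
    using A unfolding set_lebesgue_integral_def real_scaleR_def
  proof (induction rule: sigma_sets_induct_disjoint)
    case (compl A)
    then have "A \<in> sets lborel" by (simp add: borel_eq_box)
    have "(LINT x|lborel. indicator (UNIV - A) x * f x) = (LINT x|lborel. f x - indicator A x * f x)"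
      by (intro Bochner_Integration.integral_cong) (auto split: split_indicator)
    also have "\<dots> = 0"
      using f f0 compl \<open>A \<in> sets lborel\<close> integrable_mult_indicator[of A lborel f]
      by (subst Bochner_Integration.integral_diff) auto
    finally show ?case .
  next
    case (union A)
    then have A: "A i \<in> sets lborel" for i by (auto simp: borel_eq_box)
    have "integrable lborel (\<lambda>x. indicator (\<Union>i. A i) x *\<^sub>R f x)"
      by (rule integrable_mult_indicator) (use A f in auto)
    then have "(LINT x:(\<Union>i. A i)|lborel. f x) = (\<Sum>i. LINT x:A i|lborel. f x)"
      using A union f by (intro lebesgue_integral_countable_add)
        (auto simp: disjoint_family_on_def set_integrable_def)
    then show ?case
      using union by (simp add: set_lebesgue_integral_def)
  qed (use box in auto)
qed

text \<open>Bumps converge to indicators of boxes, so \<open>D\<close> integrates to 0 over each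
  box. As it is only locally integrable, it is cut off to growing boxes; intersecting them with
  another box gives a box again.\<close>

lemma fundamental_lemma_bumps:
  fixes D :: "real^'s::finite \<Rightarrow> real"
  assumes D: "locally_integrable D"
    and zero: "\<And>a b n. (LINT y|lborel. D y * (\<Prod>i\<in>UNIV. bump (a i) (b i) n (y $ i))) = 0"
  shows "AE y in lborel. D y = 0"
proof -
  have Dm [measurable]: "D \<in> borel_measurable borel"
    by (rule locally_integrable_measurable[OF D])
  have box: "(LINT y|lborel. indicator (box a b) y * D y) = 0" for a b :: "real^'s"
  proof -
    let ?p = "\<lambda>n y. \<Prod>i\<in>UNIV. bump (a $ i) (b $ i) n (y $ i)"
    have p: "0 \<le> ?p n y" "?p n y \<le> 1" for n y
      by (auto intro!: prod_nonneg prod_le_1 simp: bump_bounds)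
    have psupp: "y \<in> cbox a b" if "?p n y \<noteq> 0" for n y
    proof -
      have "bump (a $ i) (b $ i) n (y $ i) \<noteq> 0" for i
        using that by simp
      then have "a $ i < y $ i \<and> y $ i < b $ i" for i
        by (rule bump_support)
      then show ?thesis
        by (auto simp: mem_box_cart intro: less_imp_le)
    qed
    have "(\<lambda>n. LINT y|lborel. D y * ?p n y) \<longlonglongrightarrow> (LINT y|lborel. indicator (box a b) y * D y)"
    proof (rule integral_dominated_convergence)
      show "integrable lborel (\<lambda>x. \<bar>indicator (cbox a b) x *\<^sub>R D x\<bar>)"
        using D unfolding locally_integrable_def set_integrable_def by auto
      show "AE x in lborel. norm (D x * ?p n x) \<le> \<bar>indicator (cbox a b) x *\<^sub>R D x\<bar>" for n
      proof (rule AE_I2)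
        fix x
        show "norm (D x * ?p n x) \<le> \<bar>indicator (cbox a b) x *\<^sub>R D x\<bar>"
        proof (cases "?p n x = 0")
          case False
          then have "x \<in> cbox a b" by (rule psupp)
          then show ?thesis
            using mult_left_le[of "?p n x" "\<bar>D x\<bar>"] p[where n=n and y=x] by (simp add: abs_mult)
        next
          case True
          show ?thesis unfolding True by simp
        qed
      qed
      have "(\<lambda>n. D y * ?p n y) \<longlonglongrightarrow> D y * (\<Prod>i\<in>UNIV. indicator {a $ i<..<b $ i} (y $ i))" for y
        by (intro tendsto_mult tendsto_const tendsto_prod bump_tendsto)
      moreover have "(\<Prod>i\<in>UNIV. indicator {a $ i<..<b $ i} (y $ i)) = (indicator (box a b) y :: real)" for y
        by (auto simp: indicator_def mem_box_cart prod_zero_iff intro!: prod.neutral)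
      ultimately show "AE x in lborel. (\<lambda>n. D x * ?p n x) \<longlonglongrightarrow> indicator (box a b) x * D x"
        by (simp add: mult.commute)
    qed measurable
    then show ?thesis
      using zero by (simp add: LIMSEQ_const_iff)
  qed
  have "AE y in lborel. y \<in> box (- (\<chi> i. real M)) (\<chi> i. real M) \<longrightarrow> D y = 0" for M :: nat
  proof -
    let ?K = "box (- (\<chi> i. real M)) (\<chi> i. real M) :: (real^'s) set"
    have "AE y in lborel. indicator ?K y * D y = 0"
    proof (rule integral_zero_on_boxes)
      show "integrable lborel (\<lambda>y. indicator ?K y * D y)"
        using locally_integrable_times_bounded[OF D, of "indicator ?K" 1 "- (\<chi> i. real M)" "\<chi> i. real M"]
          box_subset_cbox by (auto simp: mult.commute indicator_def split: if_splits)
      show "(LINT y|lborel. indicator ?K y * D y) = 0"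
        by (rule box)
      fix a b :: "real^'s"
      have "indicator (box a b) y * (indicator ?K y * D y) = indicator (box a b \<inter> ?K) y * D y" for y
        by (simp split: split_indicator)
      then have "(LINT y|lborel. indicator (box a b) y * (indicator ?K y * D y)) = (LINT y|lborel. indicator (box a b \<inter> ?K) y * D y)"
        by (simp only:)
      then show "(LINT y|lborel. indicator (box a b) y * (indicator ?K y * D y)) = 0"
        unfolding box_Int_box by (simp only: box)
    qed
    then show ?thesis by eventually_elim auto
  qed
  then have "AE y in lborel. \<forall>M::nat. y \<in> box (- (\<chi> i. real M)) (\<chi> i. real M) \<longrightarrow> D y = 0"
    by (subst AE_all_countable) (rule allI)
  then show ?thesis
  proof eventually_elim
    case (elim y)
    obtain M :: nat where "norm y < real M" using reals_Archimedean2 by blast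
    then have "y \<in> box (- (\<chi> i. real M)) (\<chi> i. real M)"
      using le_less_trans[OF component_le_norm_cart[of y] \<open>norm y < real M\<close>]
      by (auto simp: mem_box_cart abs_less_iff minus_less_iff)
    with elim show ?case by blast
  qed
qed

section \<open>Translations and integrals along lines\<close>

lemma integrable_translate_iff:
  fixes f :: "'a::euclidean_space \<Rightarrow> real"
  assumes [measurable]: "f \<in> borel_measurable borel"
  shows "integrable lborel (\<lambda>x. f (x + c)) \<longleftrightarrow> integrable lborel f"
proof -
  have "integrable (distr lborel borel ((+) c)) f \<longleftrightarrow> integrable lborel (\<lambda>x. f (c + x))"
    by (rule integrable_distr_eq) auto
  then show ?thesis by (simp add: lborel_distr_plus add.commute)
qed

lemma integral_translate:
  fixes f :: "'a::euclidean_space \<Rightarrow> real"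
  assumes [measurable]: "f \<in> borel_measurable borel"
  shows "(LINT x|lborel. f (x + c)) = (LINT x|lborel. f x)"
proof -
  have "(LINT x|distr lborel borel ((+) c). f x) = (LINT x|lborel. f (c + x))"
    by (rule integral_distr) auto
  then show ?thesis by (simp add: lborel_distr_plus add.commute)
qed

lemma nn_integral_translate:
  fixes f :: "'a::euclidean_space \<Rightarrow> ennreal"
  assumes [measurable]: "f \<in> borel_measurable borel"
  shows "(\<integral>\<^sup>+x. f (x + c) \<partial>lborel) = (\<integral>\<^sup>+x. f x \<partial>lborel)"
proof -
  have "(\<integral>\<^sup>+x. f x \<partial>distr lborel borel ((+) c)) = (\<integral>\<^sup>+x. f (c + x) \<partial>lborel)"
    by (rule nn_integral_distr) auto
  then show ?thesis by (simp add: lborel_distr_plus add.commute)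
qed

lemma AE_translate:
  fixes c :: "'a::euclidean_space"
  assumes "AE x in lborel. Q x"
  shows "AE x in lborel. Q (x + c)"
proof -
  have "AE x in distr lborel borel ((+) c). Q x"
    by (subst lborel_distr_plus) (rule assms)
  then have "AE x in lborel. Q (c + x)"
    by (rule AE_distrD[rotated]) measurable
  then show ?thesis by (simp add: add.commute)
qed

text \<open>Fubini and, for each fixed t, the translation by t e move the line integral from
  \<open>G\<close> to the weight. The bounded support of the weight makes up for \<open>G\<close>
  being merely locally integrable.\<close>

lemma line_integral_weight:
  fixes G :: "real^'s::finite \<Rightarrow> real" and e :: "real^'s"
  assumes G: "locally_integrable G" and wm [measurable]: "w \<in> borel_measurable borel"
    and w: "\<And>x. \<bar>w x\<bar> \<le> 1" "\<And>x. w x \<noteq> 0 \<Longrightarrow> norm x \<le> M"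
  shows "integrable lborel (\<lambda>x. (LINT t|lborel. indicator {0..h} t * G (x + t *\<^sub>R e)) * w x)"
    and "(LINT x|lborel. (LINT t|lborel. indicator {0..h} t * G (x + t *\<^sub>R e)) * w x) =
         (LINT x|lborel. G x * (LINT t|lborel. indicator {0..h} t * w (x - t *\<^sub>R e)))"
proof -
  have [measurable]: "G \<in> borel_measurable borel"
    by (rule locally_integrable_measurable[OF G])
  define f1 where "f1 t x = indicator {0..h} t * G (x + t *\<^sub>R e) * w x" for t x
  define f2 where "f2 t x = indicator {0..h} t * G x * w (x - t *\<^sub>R e)" for t x
  have f1m [measurable]: "case_prod f1 \<in> borel_measurable (lborel \<Otimes>\<^sub>M lborel)"
    unfolding f1_def by measurable
  have f2m [measurable]: "case_prod f2 \<in> borel_measurable (lborel \<Otimes>\<^sub>M lborel)"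
    unfolding f2_def by measurable
  \<comment> \<open>The support of \<open>w\<close> enlarged by the length of the segment: every
    point x for which x - t e lies in the support is contained in it.\<close>
  define K where "K = cball (0 :: real^'s) (M + h * norm e)"
  have [measurable]: "K \<in> sets borel" by (simp add: K_def)
  have KG: "integrable lborel (\<lambda>x. indicator K x *\<^sub>R G x)"
    using G unfolding locally_integrable_def set_integrable_def K_def by auto
  have int2: "integrable (lborel \<Otimes>\<^sub>M lborel) (case_prod f2)"
  proof (rule integrableI_bounded)
    have le: "norm (f2 t x) \<le> indicator {0..h} t * norm (indicator K x *\<^sub>R G x)" for t x
    proof (cases "t \<in> {0..h} \<and> w (x - t *\<^sub>R e) \<noteq> 0")
      case True
      then have "norm (x - t *\<^sub>R e) \<le> M" using w by blast
      moreover have "norm x \<le> norm (x - t *\<^sub>R e) + norm (t *\<^sub>R e)"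
        by (metis diff_add_cancel norm_triangle_ineq)
      moreover have "norm (t *\<^sub>R e) \<le> h * norm e"
        using True by (auto intro!: mult_right_mono)
      ultimately have "x \<in> K" by (auto simp: K_def dist_norm)
      then show ?thesis
        using True w(1)[of "x - t *\<^sub>R e"] by (auto simp: f2_def abs_mult intro!: mult_left_le)
    next
      case False
      then show ?thesis by (auto simp: f2_def)
    qed
    have "(\<integral>\<^sup>+p. ennreal (norm (case_prod f2 p)) \<partial>(lborel \<Otimes>\<^sub>M lborel)) =
        (\<integral>\<^sup>+t. \<integral>\<^sup>+x. ennreal (norm (f2 t x)) \<partial>lborel \<partial>lborel)"
      by (subst lborel.nn_integral_fst[symmetric]) auto
    also have "\<dots> \<le> (\<integral>\<^sup>+t. \<integral>\<^sup>+x. ennreal (indicator {0..h} t) * ennreal (norm (indicator K x *\<^sub>R G x)) \<partial>lborel \<partial>lborel)"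
      using le by (intro nn_integral_mono) (auto simp: ennreal_mult[symmetric] simp del: norm_scaleR)
    also have "\<dots> = (\<integral>\<^sup>+t. ennreal (indicator {0..h} t) * (\<integral>\<^sup>+x. ennreal (norm (indicator K x *\<^sub>R G x)) \<partial>lborel) \<partial>lborel)"
      by (intro nn_integral_cong nn_integral_cmult) auto
    also have "\<dots> = (\<integral>\<^sup>+t. ennreal (indicator {0..h} t) \<partial>lborel) * (\<integral>\<^sup>+x. ennreal (norm (indicator K x *\<^sub>R G x)) \<partial>lborel)"
      by (intro nn_integral_multc) auto
    also have "\<dots> < \<infinity>"
    proof -
      have "(\<integral>\<^sup>+x. ennreal (norm (indicator K x *\<^sub>R G x)) \<partial>lborel) < \<infinity>"
        using KG by (simp add: integrable_iff_bounded)
      moreover have "(\<integral>\<^sup>+t. ennreal (indicator {0..h} t) \<partial>lborel) < \<infinity>"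
        by (simp add: ennreal_indicator emeasure_lborel_Icc_eq)
      ultimately show ?thesis
        by (simp add: ennreal_mult_less_top)
    qed
    finally show "(\<integral>\<^sup>+p. ennreal (norm (case_prod f2 p)) \<partial>(lborel \<Otimes>\<^sub>M lborel)) < \<infinity>" .
  qed (rule f2m)
  have shift: "f2 t (x + t *\<^sub>R e) = f1 t x" for t x
    by (simp add: f1_def f2_def)
  have int1: "integrable (lborel \<Otimes>\<^sub>M lborel) (case_prod f1)"
  proof (rule integrableI_bounded)
    have "(\<integral>\<^sup>+p. ennreal (norm (case_prod f1 p)) \<partial>(lborel \<Otimes>\<^sub>M lborel)) =
        (\<integral>\<^sup>+t. \<integral>\<^sup>+x. ennreal (norm (f1 t x)) \<partial>lborel \<partial>lborel)"
      by (subst lborel.nn_integral_fst[symmetric]) auto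
    also have "\<dots> = (\<integral>\<^sup>+t. \<integral>\<^sup>+x. ennreal (norm (f2 t x)) \<partial>lborel \<partial>lborel)"
      unfolding shift[symmetric] by (intro nn_integral_cong nn_integral_translate) (simp add: f2_def)
    also have "\<dots> = (\<integral>\<^sup>+p. ennreal (norm (case_prod f2 p)) \<partial>(lborel \<Otimes>\<^sub>M lborel))"
      by (subst lborel.nn_integral_fst[symmetric]) auto
    also have "\<dots> < \<infinity>"
      using int2 by (simp add: integrable_iff_bounded)
    finally show "(\<integral>\<^sup>+p. ennreal (norm (case_prod f1 p)) \<partial>(lborel \<Otimes>\<^sub>M lborel)) < \<infinity>" .
  qed (rule f1m)
  have eq1: "(LINT t|lborel. indicator {0..h} t * G (x + t *\<^sub>R e)) * w x = (LINT t|lborel. f1 t x)" for x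
    by (simp add: f1_def)
  have eq2: "G x * (LINT t|lborel. indicator {0..h} t * w (x - t *\<^sub>R e)) = (LINT t|lborel. f2 t x)" for x
    by (simp add: f2_def mult_ac flip: integral_mult_right_zero)
  show "integrable lborel (\<lambda>x. (LINT t|lborel. indicator {0..h} t * G (x + t *\<^sub>R e)) * w x)"
    unfolding eq1 by (rule lborel_pair.integrable_snd[OF int1])
  have "(LINT x|lborel. LINT t|lborel. f1 t x) = (LINT t|lborel. LINT x|lborel. f1 t x)"
    by (rule lborel_pair.Fubini_integral[OF int1])
  also have "\<dots> = (LINT t|lborel. LINT x|lborel. f2 t x)"
    unfolding shift[symmetric] by (intro Bochner_Integration.integral_cong integral_translate) (simp_all add: f2_def)
  also have "\<dots> = (LINT x|lborel. LINT t|lborel. f2 t x)"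
    by (rule lborel_pair.Fubini_integral[OF int2, symmetric])
  finally show "(LINT x|lborel. (LINT t|lborel. indicator {0..h} t * G (x + t *\<^sub>R e)) * w x) =
         (LINT x|lborel. G x * (LINT t|lborel. indicator {0..h} t * w (x - t *\<^sub>R e)))"
    unfolding eq1 eq2 .
qed

text \<open>
  Tests the weak derivative with the difference of a bump function and its translate by \<open>h\<close>, integrated in
  direction \<open>j\<close>, and lets the bump tend to the indicator of a box.
\<close>

lemma weak_partial_line_nonneg:
  fixes g G :: "real^'s::finite \<Rightarrow> real"
  assumes g: "locally_integrable g" and G: "locally_integrable G"
    and weak: "\<And>\<eta>. test_function \<eta> \<Longrightarrow> (LINT y|lborel. g y * partial_deriv j \<eta> y) = - (LINT y|lborel. G y * \<eta> y)"
    and h: "0 \<le> h"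
  shows "AE x in lborel. g (x + h *\<^sub>R axis j 1) - g x = (LINT t|lborel. indicator {0..h} t * G (x + t *\<^sub>R axis j 1))"
proof -
  let ?e = "axis j 1 :: real^'s"
  have gm [measurable]: "g \<in> borel_measurable borel" by (rule locally_integrable_measurable[OF g])
  have Gm [measurable]: "G \<in> borel_measurable borel" by (rule locally_integrable_measurable[OF G])
  define I where "I x = (LINT t|lborel. indicator {0..h} t * G (x + t *\<^sub>R ?e))" for x
  have cut: "integrable lborel (\<lambda>x. g (x + h *\<^sub>R ?e) * w x)" "integrable lborel (\<lambda>x. g x * w x)"
    if [measurable]: "w \<in> borel_measurable borel" and w: "\<And>x. \<bar>w x\<bar> \<le> 1" "\<And>x. w x \<noteq> 0 \<Longrightarrow> x \<in> cbox a b" for w a b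
  proof -
    show "integrable lborel (\<lambda>x. g x * w x)"
      by (rule locally_integrable_times_bounded[OF g _ w(1)]) (use w in auto)
    have "integrable lborel (\<lambda>x. g x * w (x - h *\<^sub>R ?e))"
    proof (rule locally_integrable_times_bounded[OF g _ w(1)])
      fix x assume "w (x - h *\<^sub>R ?e) \<noteq> 0"
      then have "x - h *\<^sub>R ?e \<in> cbox a b" by (rule w(2))
      then show "x \<in> cbox (a + h *\<^sub>R ?e) (b + h *\<^sub>R ?e)"
        by (auto simp: mem_box_cart algebra_simps)
    qed measurable
    then show "integrable lborel (\<lambda>x. g (x + h *\<^sub>R ?e) * w x)"
      by (subst (asm) integrable_translate_iff[of _ "h *\<^sub>R ?e", symmetric]) auto
  qed
  have "locally_integrable (\<lambda>x. g (x + h *\<^sub>R ?e) - g x - I x)"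
    unfolding locally_integrable_def set_integrable_def
  proof (intro allI impI)
    fix K :: "(real^'s) set" assume K: "compact K"
    then obtain M where M: "\<And>x. x \<in> K \<Longrightarrow> norm x \<le> M"
      using compact_imp_bounded bounded_iff by metis
    obtain a b where ab: "K \<subseteq> cbox a b"
      using K compact_imp_bounded bounded_subset_cbox_symmetric by metis
    have [measurable]: "K \<in> sets borel" using K by (simp add: compact_imp_closed borel_closed)
    have "integrable lborel (\<lambda>x. g (x + h *\<^sub>R ?e) * indicator K x - g x * indicator K x - I x * indicator K x)"
      unfolding I_def using M ab
      by (intro Bochner_Integration.integrable_diff cut[of _ a b] line_integral_weight(1)[OF G, where M=M])
         (auto simp: indicator_def split: if_splits)
    then show "integrable lborel (\<lambda>x. indicator K x *\<^sub>R (g (x + h *\<^sub>R ?e) - g x - I x))"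
      by (simp add: algebra_simps)
  qed
  moreover have "(LINT y|lborel. (g (y + h *\<^sub>R ?e) - g y - I y) * (\<Prod>i\<in>UNIV. bump (a i) (b i) n (y $ i))) = 0" for a b n
  proof -
    define \<eta> where "\<eta> y = (\<Prod>i\<in>UNIV. bump (a i) (b i) n (y $ i))" for y :: "real^'s"
    have [measurable]: "\<eta> \<in> borel_measurable borel" unfolding \<eta>_def by measurable
    have \<eta>_le: "\<bar>\<eta> y\<bar> \<le> 1" for y
      unfolding \<eta>_def abs_prod by (intro prod_le_1) (auto simp: bump_bounds)
    have \<eta>_supp: "y \<in> cbox (vec_lambda a) (vec_lambda b)" if "\<eta> y \<noteq> 0" for y
    proof -
      have "bump (a i) (b i) n (y $ i) \<noteq> 0" for i
        using that by (simp add: \<eta>_def)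
      then have "a i < y $ i \<and> y $ i < b i" for i
        by (rule bump_support)
      then show ?thesis
        by (auto simp: mem_box_cart intro: less_imp_le)
    qed
    obtain M where M: "\<And>y. \<eta> y \<noteq> 0 \<Longrightarrow> norm y \<le> M"
      using \<eta>_supp bounded_cbox[of "vec_lambda a" "vec_lambda b"] unfolding bounded_iff by metis
    define \<beta> where "\<beta> = bump (a j) (b j) n"
    have cont: "continuous_on A \<beta>" for A
      unfolding \<beta>_def by (rule smooth_continuous[OF smooth_bump])
    have "\<exists>B. \<forall>x. (B has_real_derivative \<beta> x) (at x)"
    proof -
      obtain B where B: "\<And>x. (B has_vector_derivative \<beta> x) (at x)"
        using einterval_antiderivative[of "-\<infinity>" "\<infinity>" \<beta>] cont[of UNIV] by (auto simp: continuous_on_eq_continuous_at)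
      then show ?thesis
        by (auto simp: has_real_derivative_iff_has_vector_derivative)
    qed
    then obtain B where B: "\<And>x. (B has_real_derivative \<beta> x) (at x)" by blast
    have "smooth B"
      by (rule smooth_antiderivative[OF smooth_bump B[unfolded \<beta>_def]])
    \<comment> \<open>An antiderivative of the bump is constant on both sides of it, but not 0 on
      both sides; subtracting its translate makes the support compact.\<close>
    define \<zeta> where "\<zeta> x = B x - B (x - h)" for x
    have "smooth \<zeta>"
      unfolding \<zeta>_def using smooth_diff[OF \<open>smooth B\<close> smooth_affine[OF \<open>smooth B\<close>, of 1 "-h"]] by simp
    have \<zeta>_deriv: "(\<zeta> has_real_derivative \<beta> x - \<beta> (x - h)) (at x)" for x
      unfolding \<zeta>_def by (auto intro!: derivative_eq_intros B DERIV_chain2[OF B])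
    have \<beta>0: "\<beta> x = 0" if "x \<le> a j \<or> b j \<le> x" for x
    proof (rule ccontr)
      assume "\<beta> x \<noteq> 0"
      then have "a j < x \<and> x < b j" unfolding \<beta>_def by (rule bump_support)
      with that show False by linarith
    qed
    have const: "B x = B y" if "x \<le> y" "\<And>z. x \<le> z \<Longrightarrow> z \<le> y \<Longrightarrow> \<beta> z = 0" for x y
    proof (cases "x = y")
      case False
      with that have "x < y" by simp
      from MVT2[OF this, of B \<beta>] B obtain z where "x < z" "z < y" "B y - B x = (y - x) * \<beta> z" by blast
      with that(2)[of z] show ?thesis by simp
    qed simp
    have \<zeta>_supp: "a j \<le> x \<and> x \<le> b j + h" if "\<zeta> x \<noteq> 0" for x
    proof (rule ccontr)
      assume "\<not> (a j \<le> x \<and> x \<le> b j + h)"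
      then have "B (x - h) = B x"
        using h by (intro const \<beta>0) auto
      with that show False by (simp add: \<zeta>_def)
    qed
    \<comment> \<open>So \<zeta> integrates the translates of the bump over the segment, which is
      the form that the line integral of \<open>G\<close> takes after Fubini.\<close>
    have \<zeta>_int: "(LINT t|lborel. indicator {0..h} t * \<beta> (x - t)) = \<zeta> x" for x
    proof -
      have "(LBINT t. \<beta> (x - t) * indicator {0..h} t) = - B (x - h) - (- B (x - 0))"
      proof (rule integral_FTC_Icc_real[OF h])
        fix t
        show "((\<lambda>t. - B (x - t)) has_real_derivative \<beta> (x - t)) (at t)"
          by (auto intro!: derivative_eq_intros B DERIV_chain2[OF B])
        show "isCont (\<lambda>t. \<beta> (x - t)) t"
          using cont[of UNIV] by (intro isCont_o2[of t "\<lambda>t. x - t" \<beta>]) (auto simp: continuous_on_eq_continuous_at)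
      qed
      then show ?thesis by (simp add: \<zeta>_def mult.commute)
    qed
    define \<zeta>' where "\<zeta>' y = (\<Prod>i\<in>UNIV. (if i = j then \<zeta> else bump (a i) (b i) n) (y $ i))" for y :: "real^'s"
    have test: "test_function \<zeta>'"
      unfolding \<zeta>'_def
    proof (rule test_function_tensor)
      show "smooth (if i = j then \<zeta> else bump (a i) (b i) n)" for i
        using \<open>smooth \<zeta>\<close> smooth_bump by simp
      show "a i \<le> x \<and> x \<le> b i + h" if "(if i = j then \<zeta> else bump (a i) (b i) n) x \<noteq> 0" for i x
        using that \<zeta>_supp[of x] bump_support[of "a i" "b i" n x] h by (auto split: if_splits)
    qed
    have \<eta>_split: "\<eta> y = \<beta> (y $ j) * (\<Prod>i\<in>UNIV - {j}. bump (a i) (b i) n (y $ i))" for y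
      unfolding \<eta>_def \<beta>_def by (subst prod.remove[of UNIV j]) auto
    have \<eta>_shift: "\<eta> (y - t *\<^sub>R ?e) = \<beta> (y $ j - t) * (\<Prod>i\<in>UNIV - {j}. bump (a i) (b i) n (y $ i))" for y t
      unfolding \<eta>_split by (auto simp: axis_def intro!: arg_cong2[where f="(*)"] prod.cong)
    have \<zeta>'_split: "\<zeta>' y = \<zeta> (y $ j) * (\<Prod>i\<in>UNIV - {j}. bump (a i) (b i) n (y $ i))" for y
      unfolding \<zeta>'_def by (subst prod.remove[of UNIV j]) (auto intro!: arg_cong2[where f="(*)"] prod.cong)
    have \<zeta>'_int: "(LINT t|lborel. indicator {0..h} t * \<eta> (y - t *\<^sub>R ?e)) = \<zeta>' y" for y
      unfolding \<eta>_shift \<zeta>'_split \<zeta>_int[symmetric] by (simp add: mult.assoc[symmetric])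
    have "\<exists>d. \<forall>x. (bump (a i) (b i) n has_real_derivative d x) (at x)" for i
      by (rule smooth_has_derivative[OF smooth_bump]) blast
    then obtain d where d: "\<And>i x. (bump (a i) (b i) n has_real_derivative d i x) (at x)"
      by metis
    define D where "D i x = (if i = j then \<beta> x - \<beta> (x - h) else d i x)" for i x
    have D: "((if i = j then \<zeta> else bump (a i) (b i) n) has_real_derivative D i x) (at x)" for i x
      unfolding D_def using \<zeta>_deriv d by (cases "i = j") simp_all
    \<comment> \<open>Differentiating undoes the integration and leaves the bump minus its
      translate; tested against \<open>g\<close>, this produces the increment of \<open>g\<close>
      over the length \<open>h\<close>.\<close>
    have pd: "partial_deriv j \<zeta>' y = \<eta> y - \<eta> (y - h *\<^sub>R ?e)" for y
    proof -
      have "partial_deriv j \<zeta>' y = (\<Prod>i\<in>UNIV. (if i = j then D i else (if i = j then \<zeta> else bump (a i) (b i) n)) (y $ i))"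
        unfolding \<zeta>'_def by (subst partial_deriv_tensor(2)[OF D]) (rule refl)
      also have "\<dots> = (\<beta> (y $ j) - \<beta> (y $ j - h)) * (\<Prod>i\<in>UNIV - {j}. bump (a i) (b i) n (y $ i))"
        by (subst prod.remove[of UNIV j]) (auto simp: D_def intro!: arg_cong2[where f="(*)"] prod.cong)
      also have "\<dots> = \<eta> y - \<eta> (y - h *\<^sub>R ?e)"
        unfolding \<eta>_split[of y] \<eta>_shift by (simp add: left_diff_distrib)
      finally show ?thesis .
    qed
    have int: "integrable lborel (\<lambda>x. g (x + h *\<^sub>R ?e) * \<eta> x)" "integrable lborel (\<lambda>x. g x * \<eta> x)"
      by (rule cut[OF _ \<eta>_le \<eta>_supp], simp_all)+
    have int3: "integrable lborel (\<lambda>x. I x * \<eta> x)"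
      unfolding I_def by (rule line_integral_weight(1)[OF G _ \<eta>_le M]) auto
    have "(LINT y|lborel. (g (y + h *\<^sub>R ?e) - g y - I y) * \<eta> y) =
       (LINT y|lborel. g (y + h *\<^sub>R ?e) * \<eta> y) - (LINT y|lborel. g y * \<eta> y) - (LINT y|lborel. I y * \<eta> y)"
      using int int3 by (simp add: left_diff_distrib)
    also have "(LINT y|lborel. I y * \<eta> y) = (LINT y|lborel. G y * \<zeta>' y)"
      unfolding I_def \<zeta>'_int[symmetric] by (rule line_integral_weight(2)[OF G _ \<eta>_le M]) auto
    also have "\<dots> = - (LINT y|lborel. g y * partial_deriv j \<zeta>' y)"
      using weak[OF test] by simp
    also have "(LINT y|lborel. g (y + h *\<^sub>R ?e) * \<eta> y) = (LINT y|lborel. g y * \<eta> (y - h *\<^sub>R ?e))"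
      by (subst integral_translate[of _ "h *\<^sub>R ?e", symmetric]) auto
    also have "(LINT y|lborel. g y * partial_deriv j \<zeta>' y) = (LINT y|lborel. g y * \<eta> y) - (LINT y|lborel. g y * \<eta> (y - h *\<^sub>R ?e))"
    proof -
      have "integrable lborel (\<lambda>y. g y * \<eta> (y - h *\<^sub>R ?e))"
        using int(1) by (subst integrable_translate_iff[of _ "h *\<^sub>R ?e", symmetric]) auto
      then show ?thesis
        using int(2) by (simp add: pd right_diff_distrib)
    qed
    finally show ?thesis by (simp add: \<eta>_def)
  qed
  ultimately have "AE x in lborel. g (x + h *\<^sub>R ?e) - g x - I x = 0"
    by (rule fundamental_lemma_bumps)
  then show ?thesis
    by eventually_elim (simp add: I_def)
qed

text \<open>The difference of the two steps is -1 on (0, h] and, for negative h, 1 on (h, 0], so it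
  covers both orientations up to end points. The negative case is the nonnegative one started at x +
  h e.\<close>

lemma weak_partial_line:
  fixes g G :: "real^'s::finite \<Rightarrow> real"
  assumes g: "locally_integrable g" and G: "locally_integrable G"
    and weak: "\<And>\<eta>. test_function \<eta> \<Longrightarrow> (LINT y|lborel. g y * partial_deriv j \<eta> y) = - (LINT y|lborel. G y * \<eta> y)"
  shows "AE x in lborel. g x - g (x + h *\<^sub>R axis j 1) =
     (LINT t|lborel. (of_bool (t \<le> 0) - of_bool (t \<le> h)) * G (x + t *\<^sub>R axis j 1))"
proof (cases "h \<ge> 0")
  case True
  have [measurable]: "G \<in> borel_measurable borel" by (rule locally_integrable_measurable[OF G])
  have eq: "(LINT t|lborel. (of_bool (t \<le> 0) - of_bool (t \<le> h)) * G (x + t *\<^sub>R axis j 1)) =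
      (LINT t|lborel. - (indicator {0..h} t * G (x + t *\<^sub>R axis j 1)))" for x
    using AE_lborel_singleton[of "0::real"] True
    by (intro integral_cong_AE) (auto elim!: eventually_mono simp: indicator_def)
  have "AE x in lborel. g (x + h *\<^sub>R axis j 1) - g x = (LINT t|lborel. indicator {0..h} t * G (x + t *\<^sub>R axis j 1))"
    using True by (intro weak_partial_line_nonneg[OF g G] weak)
  then show ?thesis by eventually_elim (simp add: eq)
next
  case False
  have [measurable]: "G \<in> borel_measurable borel" by (rule locally_integrable_measurable[OF G])
  have "(LINT t|lborel. (of_bool (t \<le> 0) - of_bool (t \<le> h)) * G (x + t *\<^sub>R axis j 1)) =
      (LINT t|lborel. indicator {0..-h} t * G (x + h *\<^sub>R axis j 1 + t *\<^sub>R axis j 1))" for x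
  proof -
    have "(LINT t|lborel. (of_bool (t \<le> 0) - of_bool (t \<le> h)) * G (x + t *\<^sub>R axis j 1)) =
       (LINT t|lborel. indicator {h..0} t * G (x + t *\<^sub>R axis j 1))"
      using AE_lborel_singleton[of h] False
      by (intro integral_cong_AE) (auto elim!: eventually_mono simp: indicator_def)
    also have "\<dots> = (LINT t|lborel. indicator {h..0} (t + h) * G (x + (t + h) *\<^sub>R axis j 1))"
      by (rule integral_translate[symmetric]) auto
    also have "\<dots> = (LINT t|lborel. indicator {0..-h} t * G (x + h *\<^sub>R axis j 1 + t *\<^sub>R axis j 1))"
      by (intro Bochner_Integration.integral_cong) (auto simp: indicator_def algebra_simps)
    finally show ?thesis .
  qed
  moreover have "AE x in lborel. g (x + h *\<^sub>R axis j 1 + (-h) *\<^sub>R axis j 1) - g (x + h *\<^sub>R axis j 1) =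
      (LINT t|lborel. indicator {0..-h} t * G (x + h *\<^sub>R axis j 1 + t *\<^sub>R axis j 1))"
    using False by (intro AE_translate weak_partial_line_nonneg[OF g G] weak) auto
  ultimately show ?thesis by simp
qed

text \<open>For each fixed h the exceptional points form a null set; by Fubini, almost every point
  works for almost every h. The substitution h = \<tau> - y j turns this into an increment between
  two values of the coordinate \<open>j\<close>.\<close>

lemma weak_partial_diff:
  fixes g G :: "real^'s::finite \<Rightarrow> real"
  assumes g: "locally_integrable g" and G: "locally_integrable G"
    and weak: "\<And>\<eta>. test_function \<eta> \<Longrightarrow> (LINT y|lborel. g y * partial_deriv j \<eta> y) = - (LINT y|lborel. G y * \<eta> y)"
  shows "AE y in LP UNIV. AE \<tau> in lborel. g (vec_lambda y) - g (vec_lambda (y(j := \<tau>))) =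
     (LINT s|lborel. (of_bool (s \<le> y j) - of_bool (s \<le> \<tau>)) * G (vec_lambda (y(j := s))))"
proof -
  have psf: "pair_sigma_finite (lborel :: real measure) (lborel :: (real^'s) measure)"
    by (simp add: pair_sigma_finite_def sigma_finite_lborel)
  have gm [measurable]: "g \<in> borel_measurable borel" by (rule locally_integrable_measurable[OF g])
  have Gm [measurable]: "G \<in> borel_measurable borel" by (rule locally_integrable_measurable[OF G])
  let ?Q = "\<lambda>h x. g x - g (x + h *\<^sub>R axis j 1) =
     (LINT t|lborel. (of_bool (t \<le> 0) - of_bool (t \<le> h)) * G (x + t *\<^sub>R axis j 1))"
  have "{p \<in> space (lborel \<Otimes>\<^sub>M lborel). ?Q (fst p) (snd p)} \<in> sets (lborel \<Otimes>\<^sub>M lborel)"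
    by measurable
  note commute = pair_sigma_finite.AE_commute[OF psf this]
  have "AE x in lborel. ?Q h x" for h
    by (rule weak_partial_line[OF g G weak])
  then have "AE x in lborel. AE h in lborel. ?Q h x"
    by (subst commute[symmetric]) simp
  then have "AE y in LP UNIV. AE h in lborel. ?Q h (vec_lambda y)"
    by (rule AE_vec_lambda)
  then show ?thesis
  proof eventually_elim
    case (elim y)
    have upd: "vec_lambda y + (s - y j) *\<^sub>R axis j 1 = (vec_lambda (y(j := s)) :: real^'s)" for s
      by (auto simp: vec_eq_iff axis_def)
    have "AE \<tau> in lborel. ?Q (\<tau> + (- y j)) (vec_lambda y)"
      using elim by (rule AE_translate)
    then show ?case
    proof eventually_elim
      case (elim \<tau>)
      have "(LINT t|lborel. (of_bool (t \<le> 0) - of_bool (t \<le> \<tau> + - y j)) * G (vec_lambda y + t *\<^sub>R axis j 1)) =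
        (LINT s|lborel. (of_bool (s + - y j \<le> 0) - of_bool (s + - y j \<le> \<tau> + - y j)) * G (vec_lambda y + (s + - y j) *\<^sub>R axis j 1))"
        by (rule integral_translate[symmetric]) measurable
      then show ?case
        using elim by (simp add: upd)
    qed
  qed
qed

section \<open>Uniqueness of weak derivatives\<close>

lemma fundamental_lemma:
  fixes D :: "real^'s::finite \<Rightarrow> real"
  assumes D: "locally_integrable D"
    and zero: "\<And>\<eta>. test_function \<eta> \<Longrightarrow> (LINT y|lborel. D y * \<eta> y) = 0"
  shows "AE y in lborel. D y = 0"
proof (rule fundamental_lemma_bumps[OF D zero])
  fix a b :: "'s \<Rightarrow> real" and n
  show "test_function (\<lambda>y. \<Prod>i\<in>UNIV. bump (a i) (b i) n (y $ i))"
    using bump_support by (intro test_function_tensor[where a=a and b=b] smooth_bump) (auto intro: less_imp_le)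
qed

text \<open>A test function vanishes near each point outside its closed support, so differentiation
  does not enlarge the support.\<close>

lemma partial_deriv_test_function:
  fixes \<eta> :: "real^'s::finite \<Rightarrow> real"
  assumes "test_function \<eta>"
  shows "test_function (partial_deriv j \<eta>)"
proof (rule test_function_partial_deriv[OF assms])
  have "partial_deriv j \<eta> x = 0" if "x \<notin> closure {x. \<eta> x \<noteq> 0}" for x
  proof -
    have "((\<lambda>_. 0) has_derivative (\<lambda>_. 0)) (at x)" by simp
    then have "(\<eta> has_derivative (\<lambda>_. 0)) (at x)"
    proof (rule has_derivative_transform_within_open)
      show "open (- closure {x. \<eta> x \<noteq> 0})" by auto
      show "x \<in> - closure {x. \<eta> x \<noteq> 0}" using that by simp
      show "0 = \<eta> y" if "y \<in> - closure {x. \<eta> x \<noteq> 0}" for y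
        using that closure_subset[of "{x. \<eta> x \<noteq> 0}"] by auto
    qed
    from frechet_derivative_at[OF this] show ?thesis
      by (metis partial_deriv_def)
  qed
  then have "closure {x. partial_deriv j \<eta> x \<noteq> 0} \<subseteq> closure {x. \<eta> x \<noteq> 0}"
    by (intro closure_minimal) auto
  then show "compact (closure {x. partial_deriv j \<eta> x \<noteq> 0})"
    using assms compact_Int_closed[of "closure {x. \<eta> x \<noteq> 0}" "closure {x. partial_deriv j \<eta> x \<noteq> 0}"]
    by (simp add: test_function_def Int_absorb1)
qed

lemma locally_integrable_times_test_function:
  fixes f :: "real^'s::finite \<Rightarrow> real"
  assumes f: "locally_integrable f" and \<eta>: "test_function \<eta>"
  shows "integrable lborel (\<lambda>x. f x * \<eta> x)"
proof -
  have diff: "\<eta> differentiable (at x)" for x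
    using \<eta> unfolding test_function_def by (metis foldr_Nil id_apply)
  then have cont: "continuous_on A \<eta>" for A
    by (meson continuous_at_imp_continuous_on differentiable_imp_continuous_within)
  let ?K = "closure {x. \<eta> x \<noteq> 0}"
  have K: "compact ?K" using \<eta> by (simp add: test_function_def)
  obtain a b where ab: "?K \<subseteq> cbox a b"
    using K compact_imp_bounded bounded_subset_cbox_symmetric by metis
  have "bounded (\<eta> ` ?K)"
    using K cont by (intro compact_imp_bounded compact_continuous_image)
  then obtain B where B: "\<And>x. x \<in> ?K \<Longrightarrow> \<bar>\<eta> x\<bar> \<le> B"
    by (auto simp: bounded_iff)
  have out: "\<eta> x = 0" if "x \<notin> ?K" for x
    using that closure_subset[of "{x. \<eta> x \<noteq> 0}"] by auto
  show ?thesis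
  proof (rule locally_integrable_times_bounded[OF f])
    show "\<eta> \<in> borel_measurable borel"
      using cont by (rule borel_measurable_continuous_onI)
    show "\<bar>\<eta> x\<bar> \<le> max B 0" for x
      using B[of x] out[of x] by (cases "x \<in> ?K") auto
    show "x \<in> cbox a b" if "\<eta> x \<noteq> 0" for x
      using out[of x] that ab by auto
  qed
qed

lemma locally_integrable_diff:
  "locally_integrable f \<Longrightarrow> locally_integrable g \<Longrightarrow> locally_integrable (\<lambda>x. f x - g x)"
  by (auto simp: locally_integrable_def intro: set_integral_diff)

lemma is_weak_mixed_derivD:
  assumes "is_weak_mixed_deriv u f g" "test_function \<eta>" "distinct js" "set js = u"
  shows "(LINT y|lborel. f y * foldr partial_deriv js \<eta> y) = (-1) ^ card u * (LINT y|lborel. g y * \<eta> y)"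
  using assms unfolding is_weak_mixed_deriv_def by blast

text \<open>Makes the choice in \<open>weak_mixed_deriv\<close> harmless: up to a null set, any
  other weak derivative may take its place.\<close>

lemma weak_mixed_deriv_AE_unique:
  fixes g g' :: "real^'s::finite \<Rightarrow> real"
  assumes "is_weak_mixed_deriv u f g" "is_weak_mixed_deriv u f g'"
  shows "AE x in lborel. g x = g' x"
proof -
  obtain js where js: "distinct js" "set js = u"
    using finite_distinct_list[of u] by auto
  have l: "locally_integrable g" "locally_integrable g'"
    using assms by (auto simp: is_weak_mixed_deriv_def)
  have "AE x in lborel. g x - g' x = 0"
  proof (rule fundamental_lemma)
    show "locally_integrable (\<lambda>x. g x - g' x)"
      using l by (rule locally_integrable_diff)
    fix \<eta> :: "real^'s \<Rightarrow> real" assume \<eta>: "test_function \<eta>"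
    have "(-1) ^ card u * (LINT y|lborel. g y * \<eta> y) = (-1) ^ card u * (LINT y|lborel. g' y * \<eta> y)"
      using is_weak_mixed_derivD[OF assms(1) \<eta> js] is_weak_mixed_derivD[OF assms(2) \<eta> js] by (rule trans[OF sym])
    then have "(LINT y|lborel. g y * \<eta> y) = (LINT y|lborel. g' y * \<eta> y)"
      by simp
    then show "(LINT y|lborel. (g y - g' y) * \<eta> y) = 0"
      using locally_integrable_times_test_function[OF l(1) \<eta>] locally_integrable_times_test_function[OF l(2) \<eta>]
      by (simp add: left_diff_distrib)
  qed
  then show ?thesis by eventually_elim simp
qed

lemma merge_override: "merge u (- u) (y, z) = override_on y z (- u)"
  by (auto simp: merge_def override_on_def)

lemma weak_mixed_deriv_empty: "locally_integrable f \<Longrightarrow> is_weak_mixed_deriv {} f f"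
  by (simp add: is_weak_mixed_deriv_def)

section \<open>The representation of functions in the Sobolev space\<close>

context weighted_setting
begin

lemma sobolev_weak_deriv:
  assumes "f \<in> sobolev_space \<phi> \<gamma> \<psi>"
  shows "is_weak_mixed_deriv u f (weak_mixed_deriv u f)"
proof -
  have "\<exists>g. is_weak_mixed_deriv u f g"
    using assms unfolding sobolev_space_def by blast
  then show ?thesis
    unfolding weak_mixed_deriv_def by (rule someI_ex)
qed

text \<open>Both derivatives arise by moving derivatives off the same \<open>f\<close>, so one is
  the weak partial derivative of the other. With \<open>j\<close> last in \<open>js @ [j]\<close>,
  the test function is differentiated in direction \<open>j\<close> first; the additional element of
  \<open>insert j v\<close> accounts for the sign.\<close>

lemma sobolev_weak_deriv_partial:
  assumes f: "f \<in> sobolev_space \<phi> \<gamma> \<psi>" and "j \<notin> v" and \<eta>: "test_function \<eta>"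
  shows "(LINT y|lborel. weak_mixed_deriv v f y * partial_deriv j \<eta> y) =
     - (LINT y|lborel. weak_mixed_deriv (insert j v) f y * \<eta> y)"
proof -
  obtain js where js: "distinct js" "set js = v"
    using finite_distinct_list[of v] by auto
  have "(-1) ^ card v * (LINT y|lborel. weak_mixed_deriv v f y * partial_deriv j \<eta> y) =
     (LINT y|lborel. f y * foldr partial_deriv js (partial_deriv j \<eta>) y)"
    by (rule is_weak_mixed_derivD[OF sobolev_weak_deriv[OF f] partial_deriv_test_function[OF \<eta>] js, symmetric])
  also have "\<dots> = (LINT y|lborel. f y * foldr partial_deriv (js @ [j]) \<eta> y)"
    by simp
  also have "\<dots> = (-1) ^ card (insert j v) * (LINT y|lborel. weak_mixed_deriv (insert j v) f y * \<eta> y)"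
  proof -
    have "distinct (js @ [j])" "set (js @ [j]) = insert j v"
      using js \<open>j \<notin> v\<close> by auto
    from is_weak_mixed_derivD[OF sobolev_weak_deriv[OF f] \<eta> this] show ?thesis .
  qed
  finally have "(-1) ^ card v * ((LINT y|lborel. weak_mixed_deriv v f y * partial_deriv j \<eta> y) +
     (LINT y|lborel. weak_mixed_deriv (insert j v) f y * \<eta> y)) = 0"
    using \<open>j \<notin> v\<close> by (simp add: distrib_left)
  then show ?thesis by simp
qed

lemma inner_integral_cong:
  assumes "\<And>i. i \<in> u \<Longrightarrow> y i = y' i"
  shows "inner_integrand \<phi> f u y = inner_integrand \<phi> f u y'"
    and "inner_integral \<phi> f u y = inner_integral \<phi> f u y'"
proof -
  have ov: "override_on y z (- u) = override_on y' z (- u)" for z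
    using assms by (auto simp: override_on_def)
  show eq: "inner_integrand \<phi> f u y = inner_integrand \<phi> f u y'"
    unfolding inner_integrand_def[abs_def] merge_override ov by (rule refl)
  show "inner_integral \<phi> f u y = inner_integral \<phi> f u y'"
    by (simp add: inner_integral_def eq)
qed

lemma weak_mixed_deriv_meas:
  assumes "f \<in> sobolev_space \<phi> \<gamma> \<psi>"
  shows "(\<lambda>y. weak_mixed_deriv u f (vec_lambda y)) \<in> borel_measurable (LP UNIV)"
proof -
  have "locally_integrable (weak_mixed_deriv u f)"
    using sobolev_weak_deriv[OF assms, of u] by (simp add: is_weak_mixed_deriv_def)
  note locally_integrable_measurable[OF this, measurable]
  show ?thesis by measurable
qed

lemma inner_integral_meas:
  assumes f: "f \<in> sobolev_space \<phi> \<gamma> \<psi>"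
  shows "inner_integral \<phi> f u \<in> borel_measurable (LP UNIV)"
proof -
  interpret sigma_finite_measure "LP (- u)" by (rule sigma_finite_LP)
  note weak_mixed_deriv_meas[OF f, measurable]
  have [measurable]: "(\<lambda>x. override_on (fst x) (snd x) (- u)) \<in> LP UNIV \<Otimes>\<^sub>M LP (- u) \<rightarrow>\<^sub>M LP UNIV"
    by (intro measurable_override_on) measurable
  have "(\<lambda>(y, z). weak_mixed_deriv u f (vec_lambda (override_on y z (- u))) * (\<Prod>j\<in>- u. \<phi> (z j)))
     \<in> borel_measurable (LP UNIV \<Otimes>\<^sub>M LP (- u))"
  proof -
    have "(\<lambda>x. \<Prod>j\<in>- u. \<phi> (snd x j)) \<in> borel_measurable (LP UNIV \<Otimes>\<^sub>M LP (- u))"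
      by (intro borel_measurable_prod measurable_compose[OF measurable_LP_snd phi_meas])
    moreover have "(\<lambda>x. weak_mixed_deriv u f (vec_lambda (override_on (fst x) (snd x) (- u))))
        \<in> borel_measurable (LP UNIV \<Otimes>\<^sub>M LP (- u))"
      by (rule measurable_compose[OF _ weak_mixed_deriv_meas[OF f]]) measurable
    ultimately show ?thesis
      unfolding case_prod_beta by (intro borel_measurable_times)
  qed
  then have "(\<lambda>y. LINT z|LP (- u). weak_mixed_deriv u f (vec_lambda (override_on y z (- u))) * (\<Prod>j\<in>- u. \<phi> (z j)))
     \<in> borel_measurable (LP UNIV)"
    by (rule borel_measurable_lebesgue_integral)
  then show ?thesis
    unfolding inner_integral_def[abs_def] inner_integrand_def merge_override .
qed

lemma sobolev_term_finite:
  assumes "f \<in> sobolev_space \<phi> \<gamma> \<psi>" "\<gamma> u > 0"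
  shows "(\<integral>\<^sup>+y. ennreal ((inner_integral \<phi> f u y)\<^sup>2 * (\<Prod>j\<in>u. (\<psi> j (y j))\<^sup>2)) \<partial>LP u) < \<infinity>"
proof -
  let ?I = "\<lambda>u. \<integral>\<^sup>+y. ennreal ((inner_integral \<phi> f u y)\<^sup>2 * (\<Prod>j\<in>u. (\<psi> j (y j))\<^sup>2)) \<partial>LP u"
  have "ennreal (inverse (\<gamma> u)) * ?I u \<le> sobolev_norm_sq \<phi> \<gamma> \<psi> f"
    unfolding sobolev_norm_sq_def by (rule sum_nonneg_leq_bound[of UNIV, OF _ _ refl]) auto
  also have "\<dots> < \<infinity>"
    using assms by (simp add: sobolev_space_def)
  finally show ?thesis
    using assms(2) by (auto simp: ennreal_mult_less_top)
qed

lemma sobolev_term_le: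
  assumes f: "f \<in> sobolev_space \<phi> \<gamma> \<psi>" "sobolev_norm \<phi> \<gamma> \<psi> f \<le> 1" and pos: "\<gamma> u > 0"
  shows "(\<integral>\<^sup>+y. ennreal ((inner_integral \<phi> f u y)\<^sup>2 * (\<Prod>j\<in>u. (\<psi> j (y j))\<^sup>2)) \<partial>LP u) \<le> ennreal (\<gamma> u)"
proof -
  let ?I = "\<lambda>u. \<integral>\<^sup>+y. ennreal ((inner_integral \<phi> f u y)\<^sup>2 * (\<Prod>j\<in>u. (\<psi> j (y j))\<^sup>2)) \<partial>LP u"
  have fin: "sobolev_norm_sq \<phi> \<gamma> \<psi> f < \<infinity>"
    using f by (simp add: sobolev_space_def)
  have "enn2real (sobolev_norm_sq \<phi> \<gamma> \<psi> f) \<le> 1"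
    using f(2) by (simp add: sobolev_norm_def)
  then have "sobolev_norm_sq \<phi> \<gamma> \<psi> f \<le> 1"
    using fin by (cases "sobolev_norm_sq \<phi> \<gamma> \<psi> f") auto
  moreover have "ennreal (inverse (\<gamma> u)) * ?I u \<le> sobolev_norm_sq \<phi> \<gamma> \<psi> f"
    unfolding sobolev_norm_sq_def by (rule sum_nonneg_leq_bound[of UNIV, OF _ _ refl]) auto
  ultimately have "ennreal (inverse (\<gamma> u)) * ?I u \<le> 1" by simp
  then have "ennreal (\<gamma> u) * (ennreal (inverse (\<gamma> u)) * ?I u) \<le> ennreal (\<gamma> u) * 1"
    by (intro mult_left_mono) auto
  moreover have "ennreal (\<gamma> u) * ennreal (inverse (\<gamma> u)) = 1"
    using pos by (simp add: ennreal_mult[symmetric])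
  ultimately show ?thesis
    by (simp add: mult.assoc[symmetric])
qed

proposition sobolev_representation:
  assumes f: "f \<in> sobolev_space \<phi> \<gamma> \<psi>" and pos: "\<And>u. \<gamma> u > 0"
  shows "AE y in LP UNIV. f (vec_lambda y) =
     (\<Sum>u\<in>UNIV. LINT t|LP u. inner_integral \<phi> f u t * (\<Prod>i\<in>u. ker (y i) (t i)))"
    and "inner_integral \<phi> f {} y = weighted_integral \<phi> f"
proof -
  interpret anova \<phi> \<psi> "inner_integral \<phi> f"
    by unfold_locales
       (auto intro: inner_integral_meas[OF f] inner_integral_cong sobolev_term_finite[OF f pos, simplified])
  define g where "g v y = weak_mixed_deriv v f (vec_lambda y)" for v y
  have li: "locally_integrable (weak_mixed_deriv v f)" for v
    using sobolev_weak_deriv[OF f, of v] by (simp add: is_weak_mixed_deriv_def)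
  have lf: "locally_integrable f"
    using f by (simp add: sobolev_space_def)
  have gm: "g v \<in> borel_measurable (LP UNIV)" for v
    unfolding g_def by (rule weak_mixed_deriv_meas[OF f])
  have "AE y in LP UNIV. g {} y = H {} y"
  proof (rule anova_representation)
    show "g v \<in> borel_measurable (LP UNIV)" for v by (rule gm)
    show "AE y in LP UNIV. AE \<tau> in lborel. g v y - g v (y(j := \<tau>)) =
        (LINT s|lborel. (of_bool (s \<le> y j) - of_bool (s \<le> \<tau>)) * g (insert j v) (y(j := s)))" if "j \<notin> v" for v j
      unfolding g_def by (rule weak_partial_diff[OF li li sobolev_weak_deriv_partial[OF f that]])
    show "inner_integral \<phi> f v y = (LINT z|LP (-v). g v (override_on y z (-v)) * (\<Prod>j\<in>-v. \<phi> (z j)))" for v y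
      unfolding inner_integral_def inner_integrand_def merge_override g_def ..
    show "AE y in LP UNIV. integrable (LP (-v)) (\<lambda>z. g v (override_on y z (-v)) * (\<Prod>j\<in>-v. \<phi> (z j)))" for v
    proof -
      have "AE y in LP v. integrable (LP (-v)) (inner_integrand \<phi> f v y)"
        using f by (simp add: sobolev_space_def)
      then have "AE y in LP UNIV. integrable (LP (-v)) (inner_integrand \<phi> f v (restrict y v))"
        by (rule AE_LP_extend)
      moreover have "inner_integrand \<phi> f v (restrict y v) = inner_integrand \<phi> f v y" for y
        by (rule inner_integral_cong) simp
      moreover have "inner_integrand \<phi> f v y = (\<lambda>z. g v (override_on y z (-v)) * (\<Prod>j\<in>-v. \<phi> (z j)))" for y
        unfolding inner_integrand_def merge_override g_def ..
      ultimately show ?thesis by (simp only:)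
    qed
  qed
  moreover have "AE x in lborel. f x = weak_mixed_deriv {} f x"
    by (rule weak_mixed_deriv_AE_unique[OF weak_mixed_deriv_empty[OF lf] sobolev_weak_deriv[OF f]])
  then have fg: "AE y in LP UNIV. f (vec_lambda y) = g {} y"
    unfolding g_def by (rule AE_vec_lambda)
  ultimately show "AE y in LP UNIV. f (vec_lambda y) =
     (\<Sum>u\<in>UNIV. LINT t|LP u. inner_integral \<phi> f u t * (\<Prod>i\<in>u. ker (y i) (t i)))"
    unfolding H_empty by eventually_elim simp
  note gm[measurable] and locally_integrable_measurable[OF lf, measurable]
  have "weighted_integral \<phi> f = (LINT y|LP UNIV. f (vec_lambda y) * (\<Prod>j\<in>UNIV. \<phi> (y j)))"
    unfolding weighted_integral_def by (subst integral_vec) auto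
  also have "\<dots> = (LINT y|LP UNIV. g {} y * (\<Prod>j\<in>UNIV. \<phi> (y j)))"
    using fg by (intro integral_cong_AE) (measurable, auto elim!: eventually_mono)
  also have "\<dots> = inner_integral \<phi> f {} y"
  proof -
    have "override_on y z UNIV = z" for z
      by (simp add: override_on_def)
    then show ?thesis
      unfolding inner_integral_def inner_integrand_def merge_override g_def by simp
  qed
  finally show "inner_integral \<phi> f {} y = weighted_integral \<phi> f" ..
qed

text \<open>The supremum in the theorem is taken in the reals and is bounded by
  \<open>cSUP_least\<close>, which asks for a nonempty set. The weak derivatives chosen for 0 vanish
  only almost everywhere, so the inner integrals have to be treated almost everywhere as
  well.\<close>

lemma zero_in_sobolev_space:
  "(\<lambda>_. 0) \<in> sobolev_space \<phi> \<gamma> \<psi>" "sobolev_norm \<phi> \<gamma> \<psi> (\<lambda>_. 0) = 0"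
proof -
  let ?f = "\<lambda>_ :: real^'s. 0 :: real"
  have li: "locally_integrable ?f"
    by (simp add: locally_integrable_def set_integrable_def)
  have z: "is_weak_mixed_deriv u ?f ?f" for u
    using li by (simp add: is_weak_mixed_deriv_def)
  have w: "is_weak_mixed_deriv u ?f (weak_mixed_deriv u ?f)" for u
    unfolding weak_mixed_deriv_def by (rule someI[of "is_weak_mixed_deriv u ?f", OF z])
  have ae: "AE y in LP u. AE z in LP (-u). inner_integrand \<phi> ?f u y z = 0" for u
  proof -
    have "AE x in lborel. weak_mixed_deriv u ?f x = 0"
      by (rule weak_mixed_deriv_AE_unique[OF w z])
    then have "AE y in LP UNIV. weak_mixed_deriv u ?f (vec_lambda y) = 0"
      by (rule AE_vec_lambda)
    then have "AE y in LP (u \<union> -u). weak_mixed_deriv u ?f (vec_lambda y) = 0"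
      unfolding Compl_partition .
    then have "AE y in LP u. AE z in LP (-u). weak_mixed_deriv u ?f (vec_lambda (merge u (-u) (y, z))) = 0"
      by (intro AE_LP_Un) auto
    then show ?thesis
      by (rule AE_mp) (auto intro!: AE_I2 elim!: eventually_mono simp: inner_integrand_def)
  qed
  have meas: "inner_integrand \<phi> ?f u y \<in> borel_measurable (LP (-u))" for u y
  proof -
    have "locally_integrable (weak_mixed_deriv u ?f)"
      using w[of u] by (simp add: is_weak_mixed_deriv_def)
    note locally_integrable_measurable[OF this, measurable]
    have [measurable]: "(\<lambda>z. override_on y z (- u)) \<in> LP (- u) \<rightarrow>\<^sub>M LP UNIV"
      by (intro measurable_override_on) (auto simp: space_PiM)
    show ?thesis
      unfolding inner_integrand_def[abs_def] merge_override by measurable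
  qed
  have norm: "sobolev_norm_sq \<phi> \<gamma> \<psi> ?f = 0"
  proof -
    have "(\<integral>\<^sup>+y. ennreal ((inner_integral \<phi> ?f u y)\<^sup>2 * (\<Prod>j\<in>u. (\<psi> j (y j))\<^sup>2)) \<partial>LP u) =
       (\<integral>\<^sup>+y. 0 \<partial>LP u)" for u
    proof (rule nn_integral_cong_AE)
      show "AE y in LP u. ennreal ((inner_integral \<phi> ?f u y)\<^sup>2 * (\<Prod>j\<in>u. (\<psi> j (y j))\<^sup>2)) = 0"
        using ae[of u]
      proof eventually_elim
        case (elim y)
        then have "inner_integral \<phi> ?f u y = 0"
          unfolding inner_integral_def by (rule integral_eq_zero_AE)
        then show ?case by simp
      qed
    qed
    then show ?thesis by (simp add: sobolev_norm_sq_def)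
  qed
  then show "sobolev_norm \<phi> \<gamma> \<psi> ?f = 0"
    by (simp add: sobolev_norm_def)
  have "AE y in LP u. integrable (LP (-u)) (inner_integrand \<phi> ?f u y)" for u
    using ae[of u]
  proof eventually_elim
    case (elim y)
    then show ?case
      using integrable_cong_AE[of "inner_integrand \<phi> ?f u y" "LP (-u)" "\<lambda>_. 0"] meas by simp
  qed
  then show "?f \<in> sobolev_space \<phi> \<gamma> \<psi>"
    unfolding sobolev_space_def using li z norm by auto
qed

end

section \<open>Fourier series of the kernel\<close>

text \<open>1 - e^(i\<alpha>) = 2 sin(\<alpha>/2) e^(i(\<alpha> - \<pi>)/2), where the modulus is
  positive and the angle lies in the range of the principal logarithm.\<close>

lemma Im_Ln_one_minus_cis:
  assumes "0 < \<alpha>" "\<alpha> < 2 * pi"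
  shows "Im (Ln (1 - cis \<alpha>)) = (\<alpha> - pi) / 2" "1 - cis \<alpha> \<noteq> 0" "0 < Re (1 - cis \<alpha>)"
proof -
  have s: "sin (\<alpha> / 2) > 0"
    using assms by (intro sin_gt_zero) auto
  have c: "cos \<alpha> = 1 - 2 * (sin (\<alpha> / 2))\<^sup>2" "sin \<alpha> = 2 * sin (\<alpha> / 2) * cos (\<alpha> / 2)"
    using cos_double_sin[of "\<alpha> / 2"] sin_double[of "\<alpha> / 2"] by simp_all
  have "1 - cis \<alpha> = of_real (2 * sin (\<alpha> / 2)) * cis ((\<alpha> - pi) / 2)"
    by (simp add: complex_eq_iff c cos_diff sin_diff diff_divide_distrib power2_eq_square)
  also have "\<dots> = exp (of_real (ln (2 * sin (\<alpha> / 2))) + \<i> * of_real ((\<alpha> - pi) / 2))"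
  proof -
    have "exp (complex_of_real (ln (2 * sin (\<alpha> / 2)))) = of_real (2 * sin (\<alpha> / 2))"
      using s unfolding exp_of_real by simp
    then show ?thesis
      by (simp only: exp_add cis_conv_exp)
  qed
  finally have eq: "1 - cis \<alpha> = exp (of_real (ln (2 * sin (\<alpha> / 2))) + \<i> * of_real ((\<alpha> - pi) / 2))" .
  show "Im (Ln (1 - cis \<alpha>)) = (\<alpha> - pi) / 2"
    unfolding eq using assms by (subst Ln_exp) auto
  show "1 - cis \<alpha> \<noteq> 0" unfolding eq by simp
  show "0 < Re (1 - cis \<alpha>)" using s by (simp add: c)
qed

text \<open>The factor r^n makes the differentiated series converge uniformly. Its sum is minus the
  imaginary part of the logarithm series, and the fundamental theorem of calculus recovers the
  original series.\<close>

lemma cos_series_abel: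
  assumes r: "0 < r" "r < 1" and \<theta>: "0 \<le> \<theta>"
  shows "(\<Sum>n. r ^ Suc n * (1 - cos (real (Suc n) * \<theta>)) / (real (Suc n))\<^sup>2) =
    (LBINT \<alpha>. - Im (Ln (1 - of_real r * cis \<alpha>)) * indicator {0..\<theta>} \<alpha>)"
proof -
  let ?f = "\<lambda>n \<alpha>. r ^ Suc n * (1 - cos (real (Suc n) * \<alpha>)) / (real (Suc n))\<^sup>2"
  let ?f' = "\<lambda>n \<alpha>. r ^ Suc n * sin (real (Suc n) * \<alpha>) / real (Suc n)"
  have pos: "0 < Re (1 - of_real r * cis \<alpha>)" for \<alpha>
  proof -
    have "r * cos \<alpha> \<le> r" using r by (simp add: mult_left_le)
    then have "r * cos \<alpha> < 1" using r by linarith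
    then show ?thesis by simp
  qed
  have sums: "(\<lambda>n. ?f' n \<alpha>) sums (- Im (Ln (1 - of_real r * cis \<alpha>)))" for \<alpha>
  proof -
    have "(\<lambda>n. - ((- (- (of_real r * cis \<alpha>))) ^ n) / of_nat n) sums Ln (1 + - (of_real r * cis \<alpha>))"
      using r by (intro Ln_series') (simp add: norm_mult)
    from sums_Im[OF this] have "(\<lambda>n. - (r ^ n * sin (real n * \<alpha>) / real n)) sums Im (Ln (1 - of_real r * cis \<alpha>))"
      by (simp add: power_mult_distrib Complex.DeMoivre flip: of_real_power)
    from sums_minus[OF this] show ?thesis
      by (subst sums_Suc_iff[of "\<lambda>n. r ^ n * sin (real n * \<alpha>) / real n"]) simp
  qed
  have "\<exists>g. \<forall>x\<in>UNIV. (\<lambda>n. ?f n x) sums g x \<and> (g has_field_derivative (- Im (Ln (1 - of_real r * cis x)))) (at x within UNIV)"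
  proof (rule has_field_derivative_series)
    show "(?f n has_field_derivative ?f' n x) (at x within UNIV)" for n x
      by (auto intro!: derivative_eq_intros simp: power2_eq_square simp del: of_nat_Suc)
    have "uniform_limit UNIV (\<lambda>n x. \<Sum>i<n. ?f' i x) (\<lambda>x. \<Sum>i. ?f' i x) sequentially"
    proof (rule Weierstrass_m_test)
      show "norm (?f' n x) \<le> r ^ Suc n" for n x
      proof -
        have "\<bar>sin (real (Suc n) * x)\<bar> \<le> real (Suc n)"
          using abs_sin_le_one[of "real (Suc n) * x"] by linarith
        then have "r ^ Suc n * \<bar>sin (real (Suc n) * x)\<bar> \<le> r ^ Suc n * real (Suc n)"
          using r by (intro mult_left_mono) auto
        then show ?thesis
          using r by (simp add: abs_mult divide_le_eq power_abs del: of_nat_Suc power_Suc)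
      qed
      show "summable (\<lambda>n. r ^ Suc n)"
        using r by (subst summable_Suc_iff) (auto intro: summable_geometric)
    qed
    then show "uniform_limit UNIV (\<lambda>n x. \<Sum>i<n. ?f' i x) (\<lambda>x. - Im (Ln (1 - of_real r * cis x))) sequentially"
      using sums by (simp add: sums_iff)
    show "summable (\<lambda>n. ?f n 0)" by simp
  qed auto
  then obtain g where g: "\<And>x. (\<lambda>n. ?f n x) sums g x"
    "\<And>x. (g has_real_derivative (- Im (Ln (1 - of_real r * cis x)))) (at x)"
    by auto
  have "(LBINT \<alpha>. - Im (Ln (1 - of_real r * cis \<alpha>)) * indicator {0..\<theta>} \<alpha>) = g \<theta> - g 0"
  proof (rule integral_FTC_Icc_real[OF \<theta> g(2)])
    fix x
    have "1 - of_real r * cis x \<notin> \<real>\<^sub>\<le>\<^sub>0"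
      using pos[of x] by (auto simp: complex_nonpos_Reals_iff)
    then show "isCont (\<lambda>\<alpha>. - Im (Ln (1 - of_real r * cis \<alpha>))) x"
      unfolding cis_conv_exp by (intro continuous_intros) (auto simp: cis_conv_exp)
  qed
  moreover have "g 0 = 0"
    using g(1)[of 0] by (simp add: sums_iff)
  ultimately show ?thesis
    using g(1)[of \<theta>] by (simp add: sums_iff)
qed

lemma inverse_squares_Suc_summable: "summable (\<lambda>n. 1 / (real (Suc n))\<^sup>2)"
  using inverse_power_summable[of 2, where 'a=real]
  by (subst summable_Suc_iff[of "\<lambda>n. 1 / (real n)\<^sup>2"]) (simp add: inverse_eq_divide)

text \<open>Lets r tend to 1. Tannery's theorem with the bound 2/n^2 treats the series; dominated
  convergence with the bound \<pi> treats the integral, whose integrand tends to (\<pi> -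
  \<alpha>)/2 except possibly at the ends of the period.\<close>

lemma cos_series:
  assumes \<theta>: "0 \<le> \<theta>" "\<theta> \<le> 2 * pi"
  shows "(\<lambda>n. (1 - cos (real (Suc n) * \<theta>)) / (real (Suc n))\<^sup>2) sums (pi * \<theta> / 2 - \<theta>\<^sup>2 / 4)"
proof -
  \<comment> \<open>The summand 2 keeps \<open>r 0\<close> positive.\<close>
  define r where "r k = 1 - inverse (real k + 2)" for k :: nat
  have r: "0 < r k" "r k < 1" for k
    by (auto simp: r_def field_simps)
  have r1: "r \<longlonglongrightarrow> 1"
    unfolding r_def by real_asymp
  let ?f = "\<lambda>n k. r k ^ Suc n * (1 - cos (real (Suc n) * \<theta>)) / (real (Suc n))\<^sup>2"
  have bound: "norm (x * (1 - cos y) / (real (Suc n))\<^sup>2) \<le> 2 * (1 / (real (Suc n))\<^sup>2)" if "0 \<le> x" "x \<le> 1" for x y n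
  proof -
    have "\<bar>x * (1 - cos y)\<bar> \<le> 1 * 2"
      unfolding abs_mult using that abs_cos_le_one[of y] by (intro mult_mono) auto
    then show ?thesis by (simp add: divide_right_mono del: of_nat_Suc)
  qed
  have sm: "summable (\<lambda>n. 2 * (1 / (real (Suc n))\<^sup>2))"
    by (intro summable_mult inverse_squares_Suc_summable)
  have lim1: "(\<lambda>k. \<Sum>n. ?f n k) \<longlonglongrightarrow> (\<Sum>n. 1 ^ Suc n * (1 - cos (real (Suc n) * \<theta>)) / (real (Suc n))\<^sup>2)"
  proof (rule tannerys_theorem[where M="\<lambda>n. 2 * (1 / (real (Suc n))\<^sup>2)", THEN conjunct2, THEN conjunct2])
    show "(?f n \<longlongrightarrow> 1 ^ Suc n * (1 - cos (real (Suc n) * \<theta>)) / (real (Suc n))\<^sup>2) sequentially" for n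
      by (intro tendsto_intros r1) simp
    show "\<forall>\<^sub>F (n, k) in at_top \<times>\<^sub>F sequentially. norm (?f n k) \<le> 2 * (1 / (real (Suc n))\<^sup>2)"
    proof (intro always_eventually allI, clarify)
      fix n k
      show "norm (?f n k) \<le> 2 * (1 / (real (Suc n))\<^sup>2)"
        using r[of k] by (intro bound) (auto intro!: power_le_one simp: less_imp_le simp del: power_Suc)
    qed
  qed (use sm in auto)
  have lim2: "(\<lambda>k. LBINT \<alpha>. - Im (Ln (1 - of_real (r k) * cis \<alpha>)) * indicator {0..\<theta>} \<alpha>)
      \<longlonglongrightarrow> (LBINT \<alpha>. (pi - \<alpha>) / 2 * indicator {0..\<theta>} \<alpha>)"
  proof (rule integral_dominated_convergence)
    show "integrable lborel (\<lambda>\<alpha>. pi * indicator {0..\<theta>} \<alpha>)"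
      by (intro integrable_mult_right integrable_real_indicator) (auto simp: emeasure_lborel_Icc_eq)
    have "0 < Re (1 - of_real (r k) * cis \<alpha>)" for k \<alpha>
    proof -
      have "r k * cos \<alpha> \<le> r k" using r[of k] by (simp add: mult_left_le)
      then have "r k * cos \<alpha> < 1" using r[of k] by linarith
      then show ?thesis by simp
    qed
    then have nz: "1 - of_real (r k) * cis \<alpha> \<noteq> 0" for k \<alpha>
      by (metis less_irrefl zero_complex.simps(1))
    show "AE \<alpha> in lborel. norm (- Im (Ln (1 - of_real (r k) * cis \<alpha>)) * indicator {0..\<theta>} \<alpha>) \<le> pi * indicator {0..\<theta>} \<alpha>" for k
      using mpi_less_Im_Ln[OF nz] Im_Ln_le_pi[OF nz] by (intro AE_I2) (auto simp: indicator_def abs_le_iff minus_le_iff less_imp_le)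
    show "AE \<alpha> in lborel. (\<lambda>k. - Im (Ln (1 - of_real (r k) * cis \<alpha>)) * indicator {0..\<theta>} \<alpha>) \<longlonglongrightarrow> (pi - \<alpha>) / 2 * indicator {0..\<theta>} \<alpha>"
      using AE_lborel_singleton[of "0::real"] AE_lborel_singleton[of "2 * pi"]
    proof eventually_elim
      case (elim \<alpha>)
      show ?case
      proof (cases "\<alpha> \<in> {0..\<theta>}")
        case True
        then have \<alpha>: "0 < \<alpha>" "\<alpha> < 2 * pi" using elim \<theta> by auto
        have "1 - of_real 1 * cis \<alpha> \<notin> \<real>\<^sub>\<le>\<^sub>0"
          using Im_Ln_one_minus_cis(3)[OF \<alpha>] by (auto simp: complex_nonpos_Reals_iff)
        then have "(\<lambda>k. - Im (Ln (1 - of_real (r k) * cis \<alpha>))) \<longlonglongrightarrow> - Im (Ln (1 - of_real 1 * cis \<alpha>))"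
          by (intro tendsto_intros r1)
        then show ?thesis
          using True Im_Ln_one_minus_cis(1)[OF \<alpha>] by (simp add: diff_divide_distrib)
      qed simp
    qed
    show "(\<lambda>\<alpha>. - Im (Ln (1 - of_real (r k) * cis \<alpha>)) * indicator {0..\<theta>} \<alpha>) \<in> borel_measurable lborel" for k
    proof -
      have "continuous_on UNIV (\<lambda>\<alpha>. - Im (Ln (1 - of_real (r k) * cis \<alpha>)))"
        unfolding cis_conv_exp using \<open>\<And>k \<alpha>. 0 < Re (1 - of_real (r k) * cis \<alpha>)\<close>
        by (intro continuous_intros) (auto simp: cis_conv_exp complex_nonpos_Reals_iff not_le)
      then have [measurable]: "(\<lambda>\<alpha>. - Im (Ln (1 - of_real (r k) * cis \<alpha>))) \<in> borel_measurable borel"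
        by (rule borel_measurable_continuous_onI)
      show ?thesis by measurable
    qed
  qed measurable
  have ftc: "(LBINT \<alpha>. (pi - \<alpha>) / 2 * indicator {0..\<theta>} \<alpha>) = (pi * \<theta> / 2 - \<theta>\<^sup>2 / 4) - (pi * 0 / 2 - 0\<^sup>2 / 4)"
    by (rule integral_FTC_Icc_real[OF \<theta>(1)]) (auto intro!: derivative_eq_intros simp: field_simps)
  also have "\<dots> = pi * \<theta> / 2 - \<theta>\<^sup>2 / 4" by simp
  finally have "(\<lambda>k. \<Sum>n. ?f n k) \<longlonglongrightarrow> pi * \<theta> / 2 - \<theta>\<^sup>2 / 4"
    using lim2 cos_series_abel[OF r \<theta>(1)] by (simp only:)
  from LIMSEQ_unique[OF lim1 this]
  have "(\<Sum>n. (1 - cos (real (Suc n) * \<theta>)) / (real (Suc n))\<^sup>2) = pi * \<theta> / 2 - \<theta>\<^sup>2 / 4"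
    by (simp del: of_nat_Suc)
  moreover have "summable (\<lambda>n. (1 - cos (real (Suc n) * \<theta>)) / (real (Suc n))\<^sup>2)"
    by (rule summable_comparison_test'[OF sm]) (use bound[of 1] in \<open>simp del: of_nat_Suc\<close>)
  ultimately show ?thesis by (simp add: sums_iff del: of_nat_Suc)
qed

lemma cos_frac: "cos (2 * pi * real n * frac x) = cos (2 * pi * real n * x)"
proof -
  have "2 * pi * real n * x = 2 * pi * real n * frac x + 2 * pi * of_int (int n * \<lfloor>x\<rfloor>)"
    by (simp add: frac_def algebra_simps)
  then show ?thesis
    by (simp only: cos_add cos_int_2pin sin_int_2pin mult_1_right mult_zero_right diff_zero)
qed

lemma cos_series_frac:
  "(\<lambda>n. (1 - cos (2 * pi * real (Suc n) * x)) / (real (Suc n))\<^sup>2) sums (pi\<^sup>2 * (frac x * (1 - frac x)))"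
proof -
  have "(\<lambda>n. (1 - cos (real (Suc n) * (2 * pi * frac x))) / (real (Suc n))\<^sup>2) sums (pi * (2 * pi * frac x) / 2 - (2 * pi * frac x)\<^sup>2 / 4)"
    using frac_lt_1[of x] by (intro cos_series) (auto simp: frac_ge_0 less_imp_le)
  moreover have "real (Suc n) * (2 * pi * frac x) = 2 * pi * real (Suc n) * frac x" for n
    by simp
  ultimately show ?thesis
    by (simp only: cos_frac) (simp add: power2_eq_square algebra_simps)
qed

text \<open>Equal to 1/6 minus the periodic Bernoulli polynomial of degree 2.\<close>

definition parab :: "real \<Rightarrow> real" where
  "parab x = frac x * (1 - frac x)"

lemma has_sum_nonzero_ints:
  fixes f :: "int \<Rightarrow> 'a::banach"
  assumes "summable (\<lambda>n. norm (f (int (Suc n))))" "summable (\<lambda>n. norm (f (- int (Suc n))))"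
    and "(\<lambda>n. f (int (Suc n))) sums a" "(\<lambda>n. f (- int (Suc n))) sums b"
  shows "(f has_sum (a + b)) (UNIV - {0})"
proof -
  have "((\<lambda>n. f (int (Suc n))) has_sum a) UNIV" "((\<lambda>n. f (- int (Suc n))) has_sum b) UNIV"
    using assms by (auto intro!: norm_summable_imp_has_sum)
  then have "(f has_sum a) (range (\<lambda>n. int (Suc n)))" "(f has_sum b) (range (\<lambda>n. - int (Suc n)))"
    by (subst has_sum_reindex; simp add: inj_on_def o_def)+
  moreover have "range (\<lambda>n. int (Suc n)) \<inter> range (\<lambda>n. - int (Suc n)) = {}"
    by auto
  ultimately have "(f has_sum (a + b)) (range (\<lambda>n. int (Suc n)) \<union> range (\<lambda>n. - int (Suc n)))"
    by (rule has_sum_Un_disjoint)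
  also have "range (\<lambda>n. int (Suc n)) \<union> range (\<lambda>n. - int (Suc n)) = UNIV - {0}"
  proof -
    have "h \<in> range (\<lambda>n. int (Suc n)) \<union> range (\<lambda>n. - int (Suc n))" if "h \<noteq> 0" for h
    proof (cases "h > 0")
      case True
      then have "h = int (Suc (nat (h - 1)))" by simp
      then show ?thesis by blast
    next
      case False
      with that have "h = - int (Suc (nat (- h - 1)))" by simp
      then show ?thesis by blast
    qed
    then show ?thesis by auto
  qed
  finally show ?thesis .
qed

lemma norm_sine_coeff:
  "\<bar>(sin (pi * x * \<tau>))\<^sup>2 / (pi\<^sup>2 * x\<^sup>2)\<bar> \<le> 1 / x\<^sup>2"
proof -
  have "(sin (pi * x * \<tau>))\<^sup>2 \<le> 1"
    by (simp add: abs_square_le_1)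
  moreover have "1 \<le> pi\<^sup>2"
    using pi_ge_two by (intro one_le_power) linarith
  ultimately have "(sin (pi * x * \<tau>))\<^sup>2 \<le> pi\<^sup>2" by linarith
  then show ?thesis
    by (cases "x = 0") (auto simp: field_simps)
qed

text \<open>By the addition theorems, sin^2(\<pi>h\<tau>) cos(2\<pi>hd) is a combination of cosines
  at d, d + \<tau> and d - \<tau>, and the constants of the three cosine series cancel. The
  imaginary parts belonging to h and -h cancel, too.\<close>

lemma sine_square_series:
  "((\<lambda>h::int. of_real ((sin (pi * of_int h * \<tau>))\<^sup>2 / (pi\<^sup>2 * (of_int h)\<^sup>2)) * cis (2 * pi * of_int h * d))
      has_sum of_real ((parab (d + \<tau>) + parab (d - \<tau>)) / 2 - parab d)) (UNIV - {0})"
proof -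
  define c where "c x = (sin (pi * x * \<tau>))\<^sup>2 / (pi\<^sup>2 * x\<^sup>2)" for x
  let ?f = "\<lambda>h::int. of_real (c (of_int h)) * cis (2 * pi * of_int h * d)"
  let ?S = "(parab (d + \<tau>) + parab (d - \<tau>)) / 2 - parab d"
  have cminus: "c (- x) = c x" for x by (simp add: c_def)
  have c_le: "\<bar>c x\<bar> \<le> 1 / x\<^sup>2" for x
    unfolding c_def by (rule norm_sine_coeff)
  have sm: "summable (\<lambda>n. \<bar>c (real (Suc n))\<bar>)"
    by (rule summable_comparison_test'[OF inverse_squares_Suc_summable]) (use c_le in simp)
  have re: "(\<lambda>n. c (real (Suc n)) * cos (2 * pi * real (Suc n) * d)) sums (?S / 2)"
  proof -
    let ?g = "\<lambda>x n. (1 - cos (2 * pi * real (Suc n) * x)) / (real (Suc n))\<^sup>2"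
    have "(\<lambda>n. (?g (d + \<tau>) n / 2 + ?g (d - \<tau>) n / 2 - ?g d n) / (2 * pi\<^sup>2)) sums
       ((pi\<^sup>2 * parab (d + \<tau>) / 2 + pi\<^sup>2 * parab (d - \<tau>) / 2 - pi\<^sup>2 * parab d) / (2 * pi\<^sup>2))"
      unfolding parab_def by (intro sums_divide sums_diff sums_add cos_series_frac)
    moreover have "(?g (d + \<tau>) n / 2 + ?g (d - \<tau>) n / 2 - ?g d n) / (2 * pi\<^sup>2) = c (real (Suc n)) * cos (2 * pi * real (Suc n) * d)" for n
    proof -
      have lin: "(1 - A) / 2 + (1 - B) / 2 - (1 - C) = 2 * S" if "A + B = 2 * C - 4 * S" for A B C S :: real
        using that by (simp add: field_simps)
      define x where "x = real (Suc n)"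
      have x: "x > 0" by (simp add: x_def)
      have e: "2 * pi * x * (d + \<tau>) = 2 * pi * x * d + 2 * (pi * x * \<tau>)" "2 * pi * x * (d - \<tau>) = 2 * pi * x * d - 2 * (pi * x * \<tau>)"
        by (simp_all add: algebra_simps)
      have "cos (2 * pi * x * (d + \<tau>)) + cos (2 * pi * x * (d - \<tau>)) =
          2 * cos (2 * pi * x * d) - 4 * ((sin (pi * x * \<tau>))\<^sup>2 * cos (2 * pi * x * d))"
        unfolding e cos_add cos_diff cos_double_sin by (simp add: algebra_simps)
      then have e2: "(1 - cos (2 * pi * x * (d + \<tau>))) / 2 + (1 - cos (2 * pi * x * (d - \<tau>))) / 2 - (1 - cos (2 * pi * x * d))
           = 2 * ((sin (pi * x * \<tau>))\<^sup>2 * cos (2 * pi * x * d))"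
        by (rule lin)
      have "?g (d + \<tau>) n / 2 + ?g (d - \<tau>) n / 2 - ?g d n =
         ((1 - cos (2 * pi * x * (d + \<tau>))) / 2 + (1 - cos (2 * pi * x * (d - \<tau>))) / 2 - (1 - cos (2 * pi * x * d))) / x\<^sup>2"
        unfolding x_def[symmetric] by (simp add: add_divide_distrib diff_divide_distrib)
      also have "\<dots> = 2 * ((sin (pi * x * \<tau>))\<^sup>2 * cos (2 * pi * x * d)) / x\<^sup>2"
        unfolding e2 ..
      finally show ?thesis
        unfolding c_def x_def[symmetric] by simp
    qed
    moreover have "(pi\<^sup>2 * parab (d + \<tau>) / 2 + pi\<^sup>2 * parab (d - \<tau>) / 2 - pi\<^sup>2 * parab d) / (2 * pi\<^sup>2) = ?S / 2"
      by (simp add: field_simps)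
    ultimately show ?thesis by (simp only:)
  qed
  have im: "summable (\<lambda>n. c (real (Suc n)) * sin (2 * pi * real (Suc n) * d))"
    by (rule summable_comparison_test'[OF sm]) (auto simp: abs_mult intro!: mult_left_le)
  let ?T = "\<Sum>n. c (real (Suc n)) * sin (2 * pi * real (Suc n) * d)"
  have "(\<lambda>n. ?f (int (Suc n))) sums Complex (?S / 2) ?T"
    using re summable_sums[OF im] by (subst sums_complex_iff) (simp del: of_nat_Suc)
  moreover have "(\<lambda>n. ?f (- int (Suc n))) sums Complex (?S / 2) (- ?T)"
    using re sums_minus[OF summable_sums[OF im]] by (subst sums_complex_iff) (simp add: cminus del: of_nat_Suc)
  ultimately have "(?f has_sum (Complex (?S / 2) ?T + Complex (?S / 2) (- ?T))) (UNIV - {0})"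
    using sm by (intro has_sum_nonzero_ints) (simp_all add: norm_mult cminus del: of_nat_Suc)
  moreover have "Complex (?S / 2) ?T + Complex (?S / 2) (- ?T) = of_real ?S"
    by (simp add: complex_eq_iff)
  ultimately show ?thesis
    by (simp only: c_def)
qed

section \<open>Correlations of the sawtooth function\<close>

lemma integral_periodic:
  fixes p :: "real \<Rightarrow> real"
  assumes [measurable]: "p \<in> borel_measurable borel" and bd: "\<And>x. \<bar>p x\<bar> \<le> B"
    and per: "\<And>x. p (x + 1) = p x"
  shows "(LINT x|lborel. indicator {0..<1} x * p (x + a)) = (LINT x|lborel. indicator {0..<1} x * p x)"
proof -
  have int: "integrable lborel (\<lambda>x. indicator {l..<u} x * p x)" for l u
  proof (rule Bochner_Integration.integrable_bound)
    show "integrable lborel (\<lambda>x. B * indicator {l..u} x)"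
      by (intro integrable_mult_right integrable_real_indicator) (auto simp: emeasure_lborel_Icc_eq)
    show "AE x in lborel. norm (indicator {l..<u} x * p x) \<le> norm (B * indicator {l..u} x)"
    proof (rule AE_I2)
      fix x
      have "\<bar>p x\<bar> \<le> \<bar>B\<bar>" using bd[of x] by linarith
      then show "norm (indicator {l..<u} x * p x) \<le> norm (B * indicator {l..u} x)"
        by (simp add: indicator_def)
    qed
  qed measurable
  have per_int: "p (x + of_int n) = p x" for x n
  proof (induction n rule: int_induct[of _ 0])
    case (step1 i)
    then show ?case using per[of "x + of_int i"] by (simp add: add.assoc)
  next
    case (step2 i)
    then show ?case using per[of "x + of_int (i - 1)"] by (simp add: add.assoc)
  qed simp
  define b where "b = frac a"
  have b: "0 \<le> b" "b < 1" by (auto simp: b_def frac_lt_1)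
  have "p (x + a) = p (x + b)" for x
    using per_int[of "x + b" "\<lfloor>a\<rfloor>"] by (simp add: b_def frac_def)
  then have "(LINT x|lborel. indicator {0..<1} x * p (x + a)) = (LINT x|lborel. indicator {b..<1 + b} (x + b) * p (x + b))"
    by (intro Bochner_Integration.integral_cong) (auto simp: indicator_def)
  also have "\<dots> = (LINT x|lborel. indicator {b..<1 + b} x * p x)"
    by (rule integral_translate) measurable
  also have "\<dots> = (LINT x|lborel. indicator {b..<1} x * p x + indicator {1..<1 + b} x * p x)"
    using b by (intro Bochner_Integration.integral_cong) (auto simp: indicator_def)
  also have "\<dots> = (LINT x|lborel. indicator {b..<1} x * p x) + (LINT x|lborel. indicator {1..<1 + b} x * p x)"
    by (intro Bochner_Integration.integral_add int)
  also have "(LINT x|lborel. indicator {1..<1 + b} x * p x) = (LINT x|lborel. indicator {1..<1 + b} (x + 1) * p (x + 1))"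
    by (rule integral_translate[symmetric]) measurable
  also have "\<dots> = (LINT x|lborel. indicator {0..<b} x * p x)"
    by (intro Bochner_Integration.integral_cong) (auto simp: indicator_def per)
  also have "(LINT x|lborel. indicator {b..<1} x * p x) + (LINT x|lborel. indicator {0..<b} x * p x) =
      (LINT x|lborel. indicator {b..<1} x * p x + indicator {0..<b} x * p x)"
    by (intro Bochner_Integration.integral_add[symmetric] int)
  also have "\<dots> = (LINT x|lborel. indicator {0..<1} x * p x)"
    using b by (intro Bochner_Integration.integral_cong) (auto simp: indicator_def)
  finally show ?thesis .
qed

text \<open>The autocorrelation of the periodic Bernoulli polynomial of degree 1. Periodicity
  removes the common shift; for the remaining lag d, the argument x + d wraps around at x = 1 - d,
  which leaves two integrals of polynomials.\<close>

lemma frac_correlation: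
  "(LINT x|lborel. indicator {0..<1} x * ((frac (x + a) - 1 / 2) * (frac (x + b) - 1 / 2))) = 1 / 12 - parab (a - b) / 2"
proof -
  define d where "d = frac (a - b)"
  have d: "0 \<le> d" "d < 1" by (auto simp: d_def frac_lt_1)
  let ?p = "\<lambda>x. (frac (x + d) - 1 / 2) * (frac x - 1 / 2)"
  have fr: "frac (x + a) = frac ((x + b) + d)" for x
  proof -
    have "x + b + d = x + a - of_int \<lfloor>a - b\<rfloor>" by (simp add: d_def frac_def)
    moreover have "frac (y - of_int n) = frac y" for y :: real and n by (simp add: frac_def)
    ultimately show ?thesis by (simp only:)
  qed
  have half: "\<bar>frac x - 1 / 2\<bar> \<le> 1" for x :: real
    using frac_ge_0[of x] frac_lt_1[of x] by linarith
  have frac_meas [measurable]: "(\<lambda>x::real. frac x) \<in> borel_measurable borel"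
    unfolding frac_def by measurable
  have "(LINT x|lborel. indicator {0..<1} x * ((frac (x + a) - 1 / 2) * (frac (x + b) - 1 / 2))) =
      (LINT x|lborel. indicator {0..<1} x * ?p (x + b))"
    by (simp only: fr)
  also have "\<dots> = (LINT x|lborel. indicator {0..<1} x * ?p x)"
  proof (rule integral_periodic)
    show "\<bar>?p x\<bar> \<le> 1" for x
      unfolding abs_mult by (intro mult_le_one half) auto
    show "?p (x + 1) = ?p x" for x
    proof -
      have "frac (y + 1) = frac y" for y :: real by (simp add: frac_def)
      from this[of x] this[of "x + d"] show ?thesis by (simp add: add_ac)
    qed
  qed measurable
  also have "\<dots> = (LINT x|lborel. (x + d - 1 / 2) * (x - 1 / 2) * indicator {0..1 - d} x +
      (x + d - 1 - 1 / 2) * (x - 1 / 2) * indicator {1 - d..1} x)"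
  proof (rule integral_cong_AE)
    show "AE x in lborel. indicator {0..<1} x * ?p x = (x + d - 1 / 2) * (x - 1 / 2) * indicator {0..1 - d} x +
      (x + d - 1 - 1 / 2) * (x - 1 / 2) * indicator {1 - d..1} x"
      using AE_lborel_singleton[of "1 - d"] AE_lborel_singleton[of "1::real"]
    proof eventually_elim
      case (elim x)
      have "frac x = x" if "0 \<le> x" "x < 1" using that by (simp add: frac_eq)
      moreover have "frac (x + d) = x + d" if "0 \<le> x" "x < 1 - d"
        using that d by (simp add: frac_eq)
      moreover have "frac (x + d) = x + d - 1" if "x > 1 - d" "x < 1"
        using that d by (intro frac_unique_iff[THEN iffD2]) auto
      ultimately show ?case
        using elim d by (auto simp: indicator_def)
    qed
  qed measurable
  also have "\<dots> = (LINT x|lborel. (x + d - 1 / 2) * (x - 1 / 2) * indicator {0..1 - d} x) +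
      (LINT x|lborel. (x + d - 1 - 1 / 2) * (x - 1 / 2) * indicator {1 - d..1} x)"
    using d by (intro Bochner_Integration.integral_add borel_integrable_atLeastAtMost) (auto intro!: continuous_intros)
  also have "\<dots> = 1 / 12 - d * (1 - d) / 2"
  proof -
    define F where "F c x = x ^ 3 / 3 + (c - 1) * x\<^sup>2 / 2 + (1 / 4 - c / 2) * x" for c x :: real
    have F: "(F c has_real_derivative (x + c - 1 / 2) * (x - 1 / 2)) (at x)" for c x
      unfolding F_def by (auto intro!: derivative_eq_intros simp: field_simps power2_eq_square)
    have 1: "(LINT x|lborel. (x + d - 1 / 2) * (x - 1 / 2) * indicator {0..1 - d} x) = F d (1 - d) - F d 0"
      using d F[of d] by (intro integral_FTC_Icc_real) (auto intro!: continuous_intros)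
    have 2: "(LINT x|lborel. (x + d - 1 - 1 / 2) * (x - 1 / 2) * indicator {1 - d..1} x) = F (d - 1) 1 - F (d - 1) (1 - d)"
      using d F[of "d - 1"] by (intro integral_FTC_Icc_real) (auto intro!: continuous_intros simp: algebra_simps)
    show ?thesis
      unfolding 1 2 F_def by (simp add: field_simps power2_eq_square power3_eq_cube)
  qed
  finally show ?thesis by (simp add: parab_def d_def)
qed

text \<open>The kernel in the coordinates x = \<Phi> y and \<tau> = \<Phi> t, continued with period
  1 in x.\<close>

definition saw :: "real \<Rightarrow> real \<Rightarrow> real" where
  "saw \<tau> x = of_bool (\<tau> \<le> frac x) - (1 - \<tau>)"

lemma saw_alt:
  assumes "0 \<le> \<tau>" "\<tau> \<le> 1"
  shows "saw \<tau> x = frac x - frac (x - \<tau>)"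
proof -
  consider "\<tau> \<le> frac x" "\<tau> < 1" | "frac x < \<tau>" "\<tau> < 1" | "\<tau> = 1"
    using assms by linarith
  then show ?thesis
  proof cases
    case 1
    moreover have "x - \<tau> - (frac x - \<tau>) \<in> \<int>" by (simp add: frac_def)
    ultimately have "frac (x - \<tau>) = frac x - \<tau>"
      using assms frac_lt_1[of x] unfolding frac_unique_iff by linarith
    with 1 show ?thesis by (simp add: saw_def)
  next
    case 2
    moreover have "x - \<tau> - (frac x - \<tau> + 1) \<in> \<int>" by (simp add: frac_def)
    ultimately have "frac (x - \<tau>) = frac x - \<tau> + 1"
      using assms frac_ge_0[of x] unfolding frac_unique_iff by linarith
    with 2 show ?thesis by (simp add: saw_def)
  next
    case 3
    have "frac (x - 1) = frac x" by (simp add: frac_def)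
    with 3 frac_lt_1[of x] show ?thesis by (simp add: saw_def)
  qed
qed

lemma frac_meas [measurable]: "(frac :: real \<Rightarrow> real) \<in> borel_measurable borel"
  unfolding frac_def[abs_def] by measurable

text \<open>By \<open>saw_alt\<close> this is bilinear in differences of two sawtooths, hence
  reduces to four correlations. The right-hand side is that of \<open>sine_square_series\<close>;
  together the two are Parseval's identity in one variable with lag a - b.\<close>

lemma saw_correlation:
  assumes \<tau>: "0 \<le> \<tau>" "\<tau> \<le> 1"
  shows "(LINT x|lborel. indicator {0..<1} x * (saw \<tau> (x + a) * saw \<tau> (x + b))) =
     (parab (a - b + \<tau>) + parab (a - b - \<tau>)) / 2 - parab (a - b)"
proof -
  define R where "R a b x = indicator {0..<1} x * ((frac (x + a) - 1 / 2) * (frac (x + b) - 1 / 2))" for a b x :: real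
  have half: "\<bar>frac x - 1 / 2\<bar> \<le> 1" for x :: real
    using frac_ge_0[of x] frac_lt_1[of x] by linarith
  have int: "integrable lborel (R a b)" for a b
  proof (rule Bochner_Integration.integrable_bound)
    show "integrable lborel (\<lambda>x::real. indicator {0..1} x :: real)"
      by (intro integrable_real_indicator) (auto simp: emeasure_lborel_Icc_eq)
    show "AE x in lborel. norm (R a b x) \<le> norm (indicator {0..1} x :: real)"
      unfolding R_def using half by (intro AE_I2) (auto simp: indicator_def abs_mult intro!: mult_le_one)
    show "R a b \<in> borel_measurable lborel"
      unfolding R_def[abs_def] by measurable
  qed
  have Rint: "integral\<^sup>L lborel (R a b) = 1 / 12 - parab (a - b) / 2" for a b
    unfolding R_def by (rule frac_correlation)
  have "indicator {0..<1} x * (saw \<tau> (x + a) * saw \<tau> (x + b)) =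
      R a b x - R a (b - \<tau>) x - R (a - \<tau>) b x + R (a - \<tau>) (b - \<tau>) x" for x
    unfolding saw_alt[OF \<tau>] R_def by (simp add: algebra_simps)
  then have "(LINT x|lborel. indicator {0..<1} x * (saw \<tau> (x + a) * saw \<tau> (x + b))) =
      integral\<^sup>L lborel (R a b) - integral\<^sup>L lborel (R a (b - \<tau>)) - integral\<^sup>L lborel (R (a - \<tau>) b) + integral\<^sup>L lborel (R (a - \<tau>) (b - \<tau>))"
    using int by simp
  also have "\<dots> = (parab (a - b + \<tau>) + parab (a - b - \<tau>)) / 2 - parab (a - b)"
    unfolding Rint by (simp add: field_simps)
  finally show ?thesis .
qed

abbreviation nonzero_ints :: "int measure" where
  "nonzero_ints \<equiv> count_space (UNIV - {0})"

text \<open>Squared modulus of the Fourier coefficient of \<open>saw \<tau>\<close> at the frequency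
  h.\<close>

definition sine_coeff :: "real \<Rightarrow> int \<Rightarrow> real" where
  "sine_coeff \<tau> h = (sin (pi * of_int h * \<tau>))\<^sup>2 / (pi\<^sup>2 * (of_int h)\<^sup>2)"

lemma sine_coeff_nonneg: "0 \<le> sine_coeff \<tau> h"
  by (simp add: sine_coeff_def)

text \<open>Writes the series as an integral over a counting measure, so that products over
  coordinates become integrals over product measures.\<close>

lemma sine_coeff_integral:
  shows "integrable nonzero_ints (\<lambda>h. of_real (sine_coeff \<tau> h) * cis (2 * pi * of_int h * d))"
    and "(LINT h|nonzero_ints. of_real (sine_coeff \<tau> h) * cis (2 * pi * of_int h * d)) =
      of_real ((parab (d + \<tau>) + parab (d - \<tau>)) / 2 - parab d)"
proof -
  let ?f = "\<lambda>h. of_real (sine_coeff \<tau> h) * cis (2 * pi * of_int h * d)"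
  have norm_f: "norm (?f h) = sine_coeff \<tau> h" for h
    by (simp add: norm_mult sine_coeff_nonneg)
  have le: "norm (sine_coeff \<tau> h) \<le> 1 / (real_of_int h)\<^sup>2" for h
    unfolding sine_coeff_def using norm_sine_coeff[of "real_of_int h" \<tau>] by simp
  have sm: "summable (\<lambda>n. norm (sine_coeff \<tau> (int (Suc n))))" "summable (\<lambda>n. norm (sine_coeff \<tau> (- int (Suc n))))"
    using le[of "int (Suc _)"] le[of "- int (Suc _)"]
    by (auto intro!: summable_comparison_test'[OF inverse_squares_Suc_summable] simp del: of_nat_Suc)
  have "(sine_coeff \<tau> has_sum ((\<Sum>n. sine_coeff \<tau> (int (Suc n))) + (\<Sum>n. sine_coeff \<tau> (- int (Suc n))))) (UNIV - {0})"
    by (rule has_sum_nonzero_ints[OF sm]) (intro summable_sums summable_norm_cancel[OF sm(1)] summable_norm_cancel[OF sm(2)])+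
  then have "(\<lambda>h. norm (?f h)) summable_on (UNIV - {0})"
    unfolding norm_f by (rule has_sum_imp_summable)
  then have abs: "Infinite_Set_Sum.abs_summable_on ?f (UNIV - {0})"
    by (simp add: abs_summable_equivalent)
  then show "integrable nonzero_ints ?f"
    by (simp add: abs_summable_on_def)
  have "(LINT h|nonzero_ints. ?f h) = infsum ?f (UNIV - {0})"
    using infsetsum_infsum[OF abs] by (simp add: infsetsum_def)
  also have "\<dots> = of_real ((parab (d + \<tau>) + parab (d - \<tau>)) / 2 - parab d)"
    using sine_square_series[of \<tau> d] unfolding sine_coeff_def by (rule infsumI)
  finally show "(LINT h|nonzero_ints. ?f h) = of_real ((parab (d + \<tau>) + parab (d - \<tau>)) / 2 - parab d)" .
qed

section \<open>Character sums and the mean square over the shifts\<close>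

lemma cis_eq_1_imp_Ints:
  assumes "cis (2 * pi * x) = 1"
  shows "x \<in> \<int>"
proof -
  have "exp (\<i> * of_real (2 * pi * x)) = 1"
    using assms by (simp add: cis_conv_exp)
  then obtain n :: int where "2 * pi * x = real_of_int (2 * n) * pi"
    unfolding exp_eq_1 by auto
  then have "x = of_int n" by simp
  then show ?thesis by simp
qed

lemma character_sum:
  assumes "N \<ge> 1"
  shows "(\<Sum>n=1..N. cis (2 * pi * (real n * of_int x / real N))) = (if int N dvd x then of_nat N else 0)"
proof -
  define w where "w = cis (2 * pi * (of_int x / real N))"
  have pow: "cis (2 * pi * (real n * of_int x / real N)) = w ^ n" for n
    unfolding w_def by (simp add: Complex.DeMoivre mult_ac)
  have "w = 1 \<longleftrightarrow> int N dvd x"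
  proof
    assume "w = 1"
    then have "of_int x / real N \<in> \<int>"
      unfolding w_def by (rule cis_eq_1_imp_Ints)
    then obtain m :: int where "of_int x / real N = of_int m"
      by (elim Ints_cases)
    then have "real_of_int x = of_int (int N * m)"
      using assms by (simp add: field_simps)
    then show "int N dvd x"
      unfolding of_int_eq_iff by simp
  next
    assume "int N dvd x"
    then obtain m where "x = int N * m" by (elim dvdE)
    then have "w = cis (2 * pi * of_int m)"
      using assms by (simp add: w_def)
    then show "w = 1" by (simp add: cis_multiple_2pi)
  qed
  moreover have "(\<Sum>n=1..N. w ^ n) = 0" if "w \<noteq> 1"
  proof -
    have "w ^ N = cis (2 * pi * of_int x)"
      unfolding pow[symmetric] using assms by simp
    then have "w ^ N = 1" by (simp add: cis_multiple_2pi)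
    have "(\<Sum>n=1..N. w ^ n) = w * (\<Sum>n<N. w ^ n)"
      unfolding sum_distrib_left by (rule sum.reindex_bij_witness[of _ Suc "\<lambda>n. n - 1"]) (auto simp flip: power_Suc)
    also have "(\<Sum>n<N. w ^ n) = 0"
      using that \<open>w ^ N = 1\<close> by (simp add: geometric_sum)
    finally show ?thesis by simp
  qed
  ultimately show ?thesis
    unfolding pow by (cases "int N dvd x") auto
qed

lemma character_double_sum:
  assumes "N \<ge> 1"
  shows "(\<Sum>n=1..N. \<Sum>m=1..N. cis (2 * pi * of_int x * ((real n - real m) / real N))) =
     (if int N dvd x then (of_nat N)\<^sup>2 else 0)"
proof -
  have "cis (2 * pi * of_int x * ((real n - real m) / real N)) =
     cis (2 * pi * (real n * of_int x / real N)) * cis (2 * pi * (real m * of_int (- x) / real N))" for n m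
    by (simp add: cis_mult field_simps diff_divide_distrib)
  then have "(\<Sum>n=1..N. \<Sum>m=1..N. cis (2 * pi * of_int x * ((real n - real m) / real N))) =
     (\<Sum>n=1..N. cis (2 * pi * (real n * of_int x / real N))) * (\<Sum>m=1..N. cis (2 * pi * (real m * of_int (- x) / real N)))"
    by (simp only: sum_product)
  also have "\<dots> = (if int N dvd x then (of_nat N)\<^sup>2 else 0)"
    unfolding character_sum[OF assms] by (simp add: power2_eq_square)
  finally show ?thesis .
qed

interpretation CB: product_sigma_finite "\<lambda>_. nonzero_ints"
  by (intro product_sigma_finite.intro sigma_finite_measure_count_space_countable) auto

lemma saw_meas [measurable (raw)]:
  assumes [measurable]: "f \<in> borel_measurable M" "g \<in> borel_measurable M"
  shows "(\<lambda>x. saw (f x) (g x)) \<in> borel_measurable M"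
proof -
  have [measurable]: "(\<lambda>x. frac (g x)) \<in> borel_measurable M"
    by (rule measurable_compose[OF _ frac_meas]) fact
  show ?thesis unfolding saw_def by measurable
qed

lemma saw_le1:
  assumes "0 \<le> \<tau>" "\<tau> \<le> 1"
  shows "\<bar>saw \<tau> x\<bar> \<le> 1"
  using assms by (auto simp: saw_def of_bool_def)

definition avg_saw :: "nat \<Rightarrow> ('s \<Rightarrow> nat) \<Rightarrow> 's set \<Rightarrow> ('s \<Rightarrow> real) \<Rightarrow> ('s \<Rightarrow> real) \<Rightarrow> real" where
  "avg_saw N z u \<tau> \<Delta> = 1 / real N * (\<Sum>n=1..N. \<Prod>j\<in>u. saw (\<tau> j) (real n * real (z j) / real N + \<Delta> j))"

text \<open>The square is expanded into a double sum over lattice points n and m. For each pair, the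
  integral over the shift factorises into one-dimensional correlations, whose Fourier series
  multiply to a series over frequency vectors h. Summing its characters over n and m leaves N^2 if N
  divides the inner product of h and z, and 0 otherwise. In this way Parseval's identity is used in
  one variable only.\<close>

lemma avg_saw_mean_square:
  fixes u :: "'s::finite set" and \<tau> :: "'s \<Rightarrow> real"
  assumes N: "N \<ge> 1" and \<tau>: "\<And>j. 0 \<le> \<tau> j" "\<And>j. \<tau> j \<le> 1"
  shows "integrable (LP UNIV) (\<lambda>\<Delta>. (\<Prod>j\<in>UNIV. indicator {0..<1} (\<Delta> j)) * (avg_saw N z u \<tau> \<Delta>)\<^sup>2)" (is ?int)
    and "(LINT \<Delta>|LP UNIV. (\<Prod>j\<in>UNIV. indicator {0..<1} (\<Delta> j)) * (avg_saw N z u \<tau> \<Delta>)\<^sup>2) =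
      (LINT h|PiM u (\<lambda>_. nonzero_ints). of_bool (int N dvd (\<Sum>j\<in>u. h j * int (z j))) * (\<Prod>j\<in>u. sine_coeff (\<tau> j) (h j)))" (is ?eq)
    and "integrable (PiM u (\<lambda>_. nonzero_ints)) (\<lambda>h. of_bool (int N dvd (\<Sum>j\<in>u. h j * int (z j))) * (\<Prod>j\<in>u. sine_coeff (\<tau> j) (h j)))" (is ?int')
proof -
  define x where "x n j = real n * real (z j) / real N" for n j
  \<comment> \<open>Coordinates outside \<open>u\<close> contribute only the indicator, with
    integral 1.\<close>
  define p where "p n m j y = indicator {0..<1} y * (if j \<in> u then saw (\<tau> j) (y + x n j) * saw (\<tau> j) (y + x m j) else 1)" for n m j y
  have p_meas [measurable]: "p n m j \<in> borel_measurable lborel" for n m j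
    unfolding p_def[abs_def] by (cases "j \<in> u") auto
  have p_int: "integrable lborel (p n m j)" for n m j
  proof (rule Bochner_Integration.integrable_bound)
    show "integrable lborel (\<lambda>x::real. indicator {0..1} x :: real)"
      by (intro integrable_real_indicator) (auto simp: emeasure_lborel_Icc_eq)
    show "AE y in lborel. norm (p n m j y) \<le> norm (indicator {0..1} y :: real)"
      unfolding p_def using saw_le1[OF \<tau>] by (intro AE_I2) (auto simp: indicator_def abs_mult intro!: mult_le_one)
  qed measurable
  define A where "A n m j = (parab (x n j - x m j + \<tau> j) + parab (x n j - x m j - \<tau> j)) / 2 - parab (x n j - x m j)" for n m j
  have p_val: "integral\<^sup>L lborel (p n m j) = (if j \<in> u then A n m j else 1)" for n m j
    unfolding p_def A_def using saw_correlation[OF \<tau>, of j "x n j" "x m j"] by simp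
  have sq: "(\<Prod>j\<in>UNIV. indicator {0..<1} (\<Delta> j)) * (avg_saw N z u \<tau> \<Delta>)\<^sup>2 =
     (1 / (real N)\<^sup>2) * (\<Sum>n=1..N. \<Sum>m=1..N. \<Prod>j\<in>UNIV. p n m j (\<Delta> j))" for \<Delta>
  proof -
    have "(\<Prod>j\<in>UNIV. p n m j (\<Delta> j)) = (\<Prod>j\<in>UNIV. indicator {0..<1} (\<Delta> j)) *
        ((\<Prod>j\<in>u. saw (\<tau> j) (x n j + \<Delta> j)) * (\<Prod>j\<in>u. saw (\<tau> j) (x m j + \<Delta> j)))" for n m
    proof -
      have "(\<Prod>j\<in>UNIV. if j \<in> u then saw (\<tau> j) (\<Delta> j + x n j) * saw (\<tau> j) (\<Delta> j + x m j) else 1) =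
         (\<Prod>j\<in>u. saw (\<tau> j) (\<Delta> j + x n j) * saw (\<tau> j) (\<Delta> j + x m j))"
        by (simp add: prod.If_cases)
      then show ?thesis
        unfolding p_def prod.distrib by (simp add: add.commute prod.distrib)
    qed
    then show ?thesis
      unfolding avg_saw_def x_def[symmetric] power2_eq_square
      by (simp add: sum_product sum_distrib_left sum_divide_distrib mult_ac)
  qed
  have int: "integrable (LP UNIV) (\<lambda>\<Delta>. \<Prod>j\<in>UNIV. p n m j (\<Delta> j))" for n m
    by (rule LP.product_integrable_prod) (auto intro: p_int)
  show ?int
    unfolding sq by (intro integrable_mult_right Bochner_Integration.integrable_sum int)
  have val: "(LINT \<Delta>|LP UNIV. (\<Prod>j\<in>UNIV. p n m j (\<Delta> j))) = (\<Prod>j\<in>u. A n m j)" for n m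
    by (simp add: LP.product_integral_prod p_int p_val prod.If_cases)
  have lhs: "(LINT \<Delta>|LP UNIV. (\<Prod>j\<in>UNIV. indicator {0..<1} (\<Delta> j)) * (avg_saw N z u \<tau> \<Delta>)\<^sup>2) =
     (1 / (real N)\<^sup>2) * (\<Sum>n=1..N. \<Sum>m=1..N. \<Prod>j\<in>u. A n m j)"
    unfolding sq by (simp add: int val)
  define c where "c h = (\<Prod>j\<in>u. sine_coeff (\<tau> j) (h j))" for h
  define s where "s h = (\<Sum>j\<in>u. h j * int (z j))" for h
  have prod_cis: "(\<Prod>j\<in>u. cis (f j)) = cis (\<Sum>j\<in>u. f j)" for f :: "'s \<Rightarrow> real"
    by (induction u rule: infinite_finite_induct) (auto simp: cis_mult)
  have cint: "integrable (PiM u (\<lambda>_. nonzero_ints)) (\<lambda>h. of_real (c h) * cis (2 * pi * of_int (s h) * ((real n - real m) / real N)))"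
    and cval: "(LINT h|PiM u (\<lambda>_. nonzero_ints). of_real (c h) * cis (2 * pi * of_int (s h) * ((real n - real m) / real N))) =
      of_real (\<Prod>j\<in>u. A n m j)" for n m
  proof -
    have eq: "(\<Prod>j\<in>u. of_real (sine_coeff (\<tau> j) (h j)) * cis (2 * pi * of_int (h j) * (x n j - x m j))) =
       of_real (c h) * cis (2 * pi * of_int (s h) * ((real n - real m) / real N))" for h
    proof -
      have "2 * pi * of_int (h j) * (x n j - x m j) = of_int (h j * int (z j)) * (2 * pi * ((real n - real m) / real N))" for j
        by (simp add: x_def algebra_simps diff_divide_distrib)
      then have "(\<Sum>j\<in>u. 2 * pi * of_int (h j) * (x n j - x m j)) = of_int (s h) * (2 * pi * ((real n - real m) / real N))"
        by (simp only: s_def of_int_sum sum_distrib_right)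
      also have "\<dots> = 2 * pi * of_int (s h) * ((real n - real m) / real N)" by simp
      finally have "(\<Sum>j\<in>u. 2 * pi * of_int (h j) * (x n j - x m j)) = 2 * pi * of_int (s h) * ((real n - real m) / real N)" .
      then show ?thesis
        unfolding prod.distrib prod_cis c_def by simp
    qed
    show "integrable (PiM u (\<lambda>_. nonzero_ints)) (\<lambda>h. of_real (c h) * cis (2 * pi * of_int (s h) * ((real n - real m) / real N)))"
      unfolding eq[symmetric] by (rule CB.product_integrable_prod) (auto intro: sine_coeff_integral)
    have "(LINT h|PiM u (\<lambda>_. nonzero_ints). (\<Prod>j\<in>u. of_real (sine_coeff (\<tau> j) (h j)) * cis (2 * pi * of_int (h j) * (x n j - x m j)))) =
       (\<Prod>j\<in>u. of_real (A n m j))"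
      by (subst CB.product_integral_prod) (auto intro: sine_coeff_integral simp: sine_coeff_integral(2) A_def)
    then show "(LINT h|PiM u (\<lambda>_. nonzero_ints). of_real (c h) * cis (2 * pi * of_int (s h) * ((real n - real m) / real N))) =
      of_real (\<Prod>j\<in>u. A n m j)"
      unfolding eq by simp
  qed
  \<comment> \<open>Reads the divisibility condition as a normalised double character sum, so that
    the series can be matched term by term with the pairs n, m.\<close>
  have cN: "of_real (of_bool (int N dvd s h) * c h) = (1 / (of_nat N)\<^sup>2) *
     (\<Sum>n=1..N. \<Sum>m=1..N. of_real (c h) * cis (2 * pi * of_int (s h) * ((real n - real m) / real N)))" for h
    using N unfolding sum_distrib_left[symmetric] character_double_sum[OF N] by simp
  have "integrable (PiM u (\<lambda>_. nonzero_ints)) (\<lambda>h. of_real (of_bool (int N dvd s h) * c h) :: complex)"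
    unfolding cN by (intro integrable_mult_right Bochner_Integration.integrable_sum cint)
  from integrable_Re[OF this] show int': ?int'
    unfolding c_def s_def by (simp only: Re_complex_of_real)
  have "of_real (LINT h|PiM u (\<lambda>_. nonzero_ints). of_bool (int N dvd s h) * c h) =
     (LINT h|PiM u (\<lambda>_. nonzero_ints). of_real (of_bool (int N dvd s h) * c h) :: complex)"
    by (rule integral_complex_of_real[symmetric])
  also have "\<dots> = (1 / (of_nat N)\<^sup>2) * (\<Sum>n=1..N. \<Sum>m=1..N. of_real (\<Prod>j\<in>u. A n m j))"
  proof -
    have "(LINT h|PiM u (\<lambda>_. nonzero_ints). (\<Sum>n=1..N. \<Sum>m=1..N. of_real (c h) * cis (2 * pi * of_int (s h) * ((real n - real m) / real N)))) =
      (\<Sum>n=1..N. LINT h|PiM u (\<lambda>_. nonzero_ints). (\<Sum>m=1..N. of_real (c h) * cis (2 * pi * of_int (s h) * ((real n - real m) / real N))))"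
      by (intro Bochner_Integration.integral_sum Bochner_Integration.integrable_sum cint)
    also have "\<dots> = (\<Sum>n=1..N. \<Sum>m=1..N. of_real (\<Prod>j\<in>u. A n m j))"
      by (intro sum.cong refl) (subst Bochner_Integration.integral_sum, rule cint, simp only: cval)
    finally show ?thesis
      unfolding cN integral_mult_right_zero by (simp only:)
  qed
  also have "\<dots> = of_real ((1 / (real N)\<^sup>2) * (\<Sum>n=1..N. \<Sum>m=1..N. \<Prod>j\<in>u. A n m j))"
    by simp
  finally show ?eq
    unfolding lhs of_real_eq_iff c_def s_def by simp
qed

section \<open>The mean square error over the shifts\<close>

context weighted_setting
begin

text \<open>Ensures that the Bochner integral in \<open>theta_hat\<close> is not 0 by convention.
  The sine is at most \<pi>|h|\<Phi> in modulus, and since h is an integer, its square is unchanged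
  when \<Phi> is replaced by 1 - \<Phi>; these are the two bounds required by
  \<open>weight_integral_finite\<close>.\<close>

lemma theta_hat_nn:
  assumes "h \<noteq> 0"
  shows "(\<integral>\<^sup>+t. ennreal (sine_coeff (dist_fun \<phi> t) h / (\<psi> j t)\<^sup>2) \<partial>lborel) = ennreal (theta_hat \<phi> \<psi> j h)"
proof -
  let ?m = "\<lambda>t. sin (pi * real_of_int h * dist_fun \<phi> t)"
  have bound: "(sin (pi * real_of_int h * a))\<^sup>2 \<le> (pi * real_of_int h)\<^sup>2 * a" if "0 \<le> a" "a \<le> 1" for a
  proof -
    have "(sin (pi * real_of_int h * a))\<^sup>2 \<le> (pi * real_of_int h * a)\<^sup>2"
      using abs_sin_x_le_abs_x[of "pi * real_of_int h * a"] by (rule abs_le_square_iff[THEN iffD1])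
    also have "\<dots> = (pi * real_of_int h)\<^sup>2 * a\<^sup>2"
      by (simp add: power_mult_distrib)
    also have "\<dots> \<le> (pi * real_of_int h)\<^sup>2 * a"
      using that power_decreasing[of 1 2 a] by (intro mult_left_mono) auto
    finally show ?thesis .
  qed
  have refl: "(sin (pi * real_of_int h * a))\<^sup>2 = (sin (pi * real_of_int h * (1 - a)))\<^sup>2" for a
  proof -
    have "sin (pi * real_of_int h * (1 - a)) = sin (pi * real_of_int h) * cos (pi * real_of_int h * a) - cos (pi * real_of_int h) * sin (pi * real_of_int h * a)"
      by (simp add: right_diff_distrib sin_diff)
    moreover have "sin (pi * real_of_int h) = 0"
      using sin_npi_int[of h] by (simp add: mult.commute)
    moreover have "(cos (pi * real_of_int h))\<^sup>2 = 1"
      using sin_cos_squared_add[of "pi * real_of_int h"] \<open>sin (pi * real_of_int h) = 0\<close> by simp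
    ultimately show ?thesis by (simp add: power_mult_distrib)
  qed
  have fin: "(\<integral>\<^sup>+t. ennreal ((?m t)\<^sup>2 / (\<psi> j t)\<^sup>2) \<partial>lborel) < \<infinity>"
  proof (rule weight_integral_finite[where c=0 and C="(pi * real_of_int h)\<^sup>2"])
    show "(?m t)\<^sup>2 \<le> (pi * real_of_int h)\<^sup>2 * dist_fun \<phi> t" for t
      by (rule bound) auto
    show "(?m t)\<^sup>2 \<le> (pi * real_of_int h)\<^sup>2 * (1 - dist_fun \<phi> t)" for t
      unfolding refl[of "dist_fun \<phi> t"] by (rule bound) auto
  qed measurable
  then have int: "integrable lborel (\<lambda>t. (?m t)\<^sup>2 / (\<psi> j t)\<^sup>2)"
    by (intro integrableI_nonneg) auto
  have eq: "sine_coeff (dist_fun \<phi> t) h / (\<psi> j t)\<^sup>2 = (1 / (pi\<^sup>2 * (real_of_int h)\<^sup>2)) * ((?m t)\<^sup>2 / (\<psi> j t)\<^sup>2)" for t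
    by (simp add: sine_coeff_def)
  have "(\<integral>\<^sup>+t. ennreal ((1 / (pi\<^sup>2 * (real_of_int h)\<^sup>2)) * ((?m t)\<^sup>2 / (\<psi> j t)\<^sup>2)) \<partial>lborel) =
      ennreal (LINT t|lborel. (1 / (pi\<^sup>2 * (real_of_int h)\<^sup>2)) * ((?m t)\<^sup>2 / (\<psi> j t)\<^sup>2))"
    by (intro nn_integral_eq_integral integrable_mult_right int AE_I2 mult_nonneg_nonneg) auto
  then show ?thesis
    unfolding eq theta_hat_def integral_mult_right_zero .
qed

lemma theta_hat_nonneg: "0 \<le> theta_hat \<phi> \<psi> j h"
  unfolding theta_hat_def by (intro mult_nonneg_nonneg integral_nonneg) auto

text \<open>Squared norm of the averaged kernel product, dual to the term for \<open>u\<close> in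
  the Sobolev norm; duality inverts the weights. It depends on the sample, but not on the function
  to be integrated.\<close>

definition shift_error :: "nat \<Rightarrow> ('s \<Rightarrow> nat) \<Rightarrow> 's set \<Rightarrow> ('s \<Rightarrow> real) \<Rightarrow> ennreal" where
  "shift_error N z u \<Delta> = (\<integral>\<^sup>+t. ennreal ((avg_saw N z u (\<lambda>j. dist_fun \<phi> (t j)) \<Delta>)\<^sup>2 * (\<Prod>j\<in>u. 1 / (\<psi> j (t j))\<^sup>2)) \<partial>LP u)"

lemma avg_saw_pair_meas [measurable]:
  "(\<lambda>(\<Delta>, t). avg_saw N z u (\<lambda>j. dist_fun \<phi> (t j)) \<Delta>) \<in> borel_measurable (LP UNIV \<Otimes>\<^sub>M LP u)"
  unfolding avg_saw_def case_prod_beta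
proof (intro borel_measurable_times borel_measurable_const borel_measurable_sum borel_measurable_prod)
  fix n j assume j: "j \<in> u"
  note measurable_LP_snd[OF j, measurable]
  show "(\<lambda>x. saw (dist_fun \<phi> (snd x j)) (real n * real (z j) / real N + fst x j)) \<in> borel_measurable (LP UNIV \<Otimes>\<^sub>M LP u)"
    by (intro saw_meas measurable_compose[OF _ dist_meas]) measurable
qed

lemma psi_prod_meas [measurable]: "(\<lambda>t. \<Prod>j\<in>u. 1 / (\<psi> j (t j))\<^sup>2) \<in> borel_measurable (LP u)"
  by measurable

lemma shift_error_meas [measurable]: "shift_error N z u \<in> borel_measurable (LP UNIV)"
proof -
  interpret sigma_finite_measure "LP u" by (rule sigma_finite_LP)
  have "(\<lambda>(\<Delta>, t). ennreal ((avg_saw N z u (\<lambda>j. dist_fun \<phi> (t j)) \<Delta>)\<^sup>2 * (\<Prod>j\<in>u. 1 / (\<psi> j (t j))\<^sup>2)))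
      \<in> borel_measurable (LP UNIV \<Otimes>\<^sub>M LP u)"
    using avg_saw_pair_meas[of N z u] measurable_compose[OF measurable_snd psi_prod_meas[of u], of "LP UNIV"]
    by (simp add: case_prod_beta)
  then show ?thesis
    unfolding shift_error_def[abs_def] by (rule borel_measurable_nn_integral)
qed

text \<open>All terms are nonnegative, so by Tonelli the shift can be integrated out first, which
  gives the dual lattice series of \<open>sine_coeff\<close>. Integrating this series term by term
  against 1/\<psi>^2 turns each factor into \<open>theta_hat\<close>.\<close>

proposition mean_shift_error:
  assumes N: "N \<ge> 1"
  shows "(\<integral>\<^sup>+\<Delta>. (\<Prod>j\<in>UNIV. indicator {0..<1} (\<Delta> j)) * shift_error N z u \<Delta> \<partial>LP UNIV) =
     (\<integral>\<^sup>+h. of_bool (int N dvd (\<Sum>j\<in>u. h j * int (z j))) * (\<Prod>j\<in>u. ennreal (theta_hat \<phi> \<psi> j (h j))) \<partial>count_space (PiE u (\<lambda>_. UNIV - {0})))"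
proof -
  interpret pair_sigma_finite "LP UNIV :: ('s \<Rightarrow> real) measure" "LP u" by (rule pair_sigma_finite_LP)
  have cs: "PiM u (\<lambda>_. nonzero_ints) = count_space (PiE u (\<lambda>_. UNIV - {0}))"
    by (rule count_space_PiM_finite) auto
  let ?I = "\<lambda>\<Delta> :: 's \<Rightarrow> real. \<Prod>j\<in>UNIV. indicator {0..<1} (\<Delta> j)"
  let ?w = "\<lambda>t. \<Prod>j\<in>u. 1 / (\<psi> j (t j))\<^sup>2"
  let ?a = "\<lambda>t. avg_saw N z u (\<lambda>j. dist_fun \<phi> (t j))"
  let ?d = "\<lambda>h. int N dvd (\<Sum>j\<in>u. h j * int (z j))"
  have w0: "0 \<le> ?w t" for t by (intro prod_nonneg) auto
  have am: "(\<lambda>x. ?a (snd x) (fst x)) \<in> borel_measurable (LP UNIV \<Otimes>\<^sub>M LP u)"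
    using avg_saw_pair_meas[of N z u] by (simp add: case_prod_beta)
  note am[measurable] measurable_compose[OF measurable_snd psi_prod_meas[of u], measurable]
  have Ie: "(\<Prod>j\<in>UNIV. indicator {0..<1} (\<Delta> j)) = ennreal (?I \<Delta>)" for \<Delta> :: "'s \<Rightarrow> real"
    by (subst prod_ennreal[symmetric]) (auto simp: ennreal_indicator)
  have I0: "(0::real) \<le> ?I \<Delta>" for \<Delta> by (intro prod_nonneg) auto
  have "(\<integral>\<^sup>+\<Delta>. (\<Prod>j\<in>UNIV. indicator {0..<1} (\<Delta> j)) * shift_error N z u \<Delta> \<partial>LP UNIV) =
     (\<integral>\<^sup>+\<Delta>. \<integral>\<^sup>+t. ennreal (?w t) * ennreal (?I \<Delta> * (?a t \<Delta>)\<^sup>2) \<partial>LP u \<partial>LP UNIV)"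
  proof (intro nn_integral_cong)
    fix \<Delta> :: "'s \<Rightarrow> real" assume "\<Delta> \<in> space (LP UNIV)"
    have [measurable]: "(\<lambda>t. ?a t \<Delta>) \<in> borel_measurable (LP u)"
      using measurable_compose[OF measurable_Pair1'[OF \<open>\<Delta> \<in> space (LP UNIV)\<close>] am] by simp
    show "(\<Prod>j\<in>UNIV. indicator {0..<1} (\<Delta> j)) * shift_error N z u \<Delta> =
       (\<integral>\<^sup>+t. ennreal (?w t) * ennreal (?I \<Delta> * (?a t \<Delta>)\<^sup>2) \<partial>LP u)"
      unfolding Ie shift_error_def
      by (subst nn_integral_cmult[symmetric]) (auto intro!: nn_integral_cong simp: ennreal_mult[symmetric] w0 I0 mult_ac)
  qed
  also have "\<dots> = (\<integral>\<^sup>+t. \<integral>\<^sup>+\<Delta>. ennreal (?w t) * ennreal (?I \<Delta> * (?a t \<Delta>)\<^sup>2) \<partial>LP UNIV \<partial>LP u)"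
    by (rule Fubini'[symmetric]) measurable
  also have "\<dots> = (\<integral>\<^sup>+t. ennreal (?w t) * ennreal (LINT \<Delta>|LP UNIV. ?I \<Delta> * (?a t \<Delta>)\<^sup>2) \<partial>LP u)"
    using avg_saw_mean_square(1)[OF N, of _ z u]
    by (intro nn_integral_cong, subst nn_integral_cmult, simp, subst nn_integral_eq_integral)
       (auto intro!: mult_nonneg_nonneg I0)
  also have "\<dots> = (\<integral>\<^sup>+t. \<integral>\<^sup>+h. of_bool (?d h) * (\<Prod>j\<in>u. ennreal (sine_coeff (dist_fun \<phi> (t j)) (h j) / (\<psi> j (t j))\<^sup>2))
      \<partial>PiM u (\<lambda>_. nonzero_ints) \<partial>LP u)"
  proof (intro nn_integral_cong)
    fix t
    let ?c = "\<lambda>h. of_bool (?d h) * (\<Prod>j\<in>u. sine_coeff (dist_fun \<phi> (t j)) (h j))"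
    have c0: "0 \<le> ?c h" for h
      by (auto intro!: mult_nonneg_nonneg prod_nonneg sine_coeff_nonneg)
    have "ennreal (LINT \<Delta>|LP UNIV. ?I \<Delta> * (?a t \<Delta>)\<^sup>2) = (\<integral>\<^sup>+h. ennreal (?c h) \<partial>PiM u (\<lambda>_. nonzero_ints))"
      by (subst avg_saw_mean_square(2)[OF N]) (auto intro!: nn_integral_eq_integral[symmetric] avg_saw_mean_square(3)[OF N] c0)
    also have "ennreal (?w t) * \<dots> = (\<integral>\<^sup>+h. ennreal (?w t) * ennreal (?c h) \<partial>PiM u (\<lambda>_. nonzero_ints))"
      unfolding cs by (rule nn_integral_cmult[symmetric]) simp
    also have "\<dots> = (\<integral>\<^sup>+h. of_bool (?d h) * (\<Prod>j\<in>u. ennreal (sine_coeff (dist_fun \<phi> (t j)) (h j) / (\<psi> j (t j))\<^sup>2))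
      \<partial>PiM u (\<lambda>_. nonzero_ints))"
    proof (intro nn_integral_cong)
      fix h
      have "(\<Prod>j\<in>u. ennreal (sine_coeff (dist_fun \<phi> (t j)) (h j) / (\<psi> j (t j))\<^sup>2)) =
         ennreal (?w t * (\<Prod>j\<in>u. sine_coeff (dist_fun \<phi> (t j)) (h j)))"
        by (subst prod_ennreal) (auto simp: sine_coeff_nonneg prod.distrib[symmetric])
      then show "ennreal (?w t) * ennreal (?c h) = of_bool (?d h) * (\<Prod>j\<in>u. ennreal (sine_coeff (dist_fun \<phi> (t j)) (h j) / (\<psi> j (t j))\<^sup>2))"
        using w0 by (cases "?d h") (auto simp: ennreal_mult prod_nonneg sine_coeff_nonneg)
    qed
    finally show "ennreal (?w t) * ennreal (LINT \<Delta>|LP UNIV. ?I \<Delta> * (?a t \<Delta>)\<^sup>2) =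
       (\<integral>\<^sup>+h. of_bool (?d h) * (\<Prod>j\<in>u. ennreal (sine_coeff (dist_fun \<phi> (t j)) (h j) / (\<psi> j (t j))\<^sup>2)) \<partial>PiM u (\<lambda>_. nonzero_ints))" .
  qed
  also have "\<dots> = (\<integral>\<^sup>+h. \<integral>\<^sup>+t. of_bool (?d h) * (\<Prod>j\<in>u. ennreal (sine_coeff (dist_fun \<phi> (t j)) (h j) / (\<psi> j (t j))\<^sup>2))
      \<partial>LP u \<partial>count_space (PiE u (\<lambda>_. UNIV - {0})))"
    unfolding cs
  proof (rule nn_integral_count_space_nn_integral)
    show "countable (PiE u (\<lambda>_. UNIV - {0 :: int}))"
      by (rule countable_PiE) auto
    show "(\<lambda>t. of_bool (?d h) * (\<Prod>j\<in>u. ennreal (sine_coeff (dist_fun \<phi> (t j)) (h j) / (\<psi> j (t j))\<^sup>2))) \<in> borel_measurable (LP u)" for h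
      unfolding sine_coeff_def by measurable
  qed
  also have "\<dots> = (\<integral>\<^sup>+h. of_bool (?d h) * (\<Prod>j\<in>u. ennreal (theta_hat \<phi> \<psi> j (h j))) \<partial>count_space (PiE u (\<lambda>_. UNIV - {0})))"
  proof (intro nn_integral_cong)
    fix h assume "h \<in> space (count_space (PiE u (\<lambda>_. UNIV - {0 :: int})))"
    then have h: "h j \<noteq> 0" if "j \<in> u" for j
      using that by (auto simp: PiE_iff)
    have [measurable]: "(\<lambda>t. sine_coeff (dist_fun \<phi> t) k / (\<psi> j t)\<^sup>2) \<in> borel_measurable lborel" for k j
      unfolding sine_coeff_def by measurable
    have "(\<integral>\<^sup>+t. of_bool (?d h) * (\<Prod>j\<in>u. ennreal (sine_coeff (dist_fun \<phi> (t j)) (h j) / (\<psi> j (t j))\<^sup>2)) \<partial>LP u) =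
       of_bool (?d h) * (\<integral>\<^sup>+t. (\<Prod>j\<in>u. ennreal (sine_coeff (dist_fun \<phi> (t j)) (h j) / (\<psi> j (t j))\<^sup>2)) \<partial>LP u)"
      by (cases "?d h") auto
    also have "(\<integral>\<^sup>+t. (\<Prod>j\<in>u. ennreal (sine_coeff (dist_fun \<phi> (t j)) (h j) / (\<psi> j (t j))\<^sup>2)) \<partial>LP u) =
       (\<Prod>j\<in>u. (\<integral>\<^sup>+t. ennreal (sine_coeff (dist_fun \<phi> t) (h j) / (\<psi> j t)\<^sup>2) \<partial>lborel))"
      by (rule LP.product_nn_integral_prod) auto
    also have "\<dots> = (\<Prod>j\<in>u. ennreal (theta_hat \<phi> \<psi> j (h j)))"
      by (intro prod.cong theta_hat_nn h) auto
    finally show "(\<integral>\<^sup>+t. of_bool (?d h) * (\<Prod>j\<in>u. ennreal (sine_coeff (dist_fun \<phi> (t j)) (h j) / (\<psi> j (t j))\<^sup>2)) \<partial>LP u) =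
       of_bool (?d h) * (\<Prod>j\<in>u. ennreal (theta_hat \<phi> \<psi> j (h j)))" .
  qed
  finally show ?thesis .
qed

end

section \<open>Averages over generators\<close>

abbreviation divisor_count :: "nat \<Rightarrow> nat" where
  "divisor_count n \<equiv> card {d. d dvd n}"

text \<open>Each divisor is a power p^i with i <= a times a divisor of m.\<close>

lemma divisor_count_prime_power_mult:
  assumes "prime p" "m > 0"
  shows "divisor_count (p ^ a * m) \<le> (a + 1) * divisor_count m"
proof -
  have "{d. d dvd p ^ a * m} \<subseteq> (\<lambda>(i, e). p ^ i * e) ` ({..a} \<times> {e. e dvd m})"
  proof
    fix d assume "d \<in> {d. d dvd p ^ a * m}"
    then obtain b c where "d = b * c" "b dvd p ^ a" "c dvd m"
      using division_decomp[of d "p ^ a" m] by auto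
    moreover from this obtain i where "i \<le> a" "b = p ^ i"
      using assms(1) by (auto simp: divides_primepow_nat)
    ultimately show "d \<in> (\<lambda>(i, e). p ^ i * e) ` ({..a} \<times> {e. e dvd m})"
      by auto
  qed
  then have "divisor_count (p ^ a * m) \<le> card ({..a} \<times> {e. e dvd m})"
    using assms(2) by (intro surj_card_le) auto
  then show ?thesis by (simp add: card_cartesian_product)
qed

text \<open>
  \<open>a + 1 \<le> p powr (a * \<delta>)\<close> for \<open>p powr \<delta> \<ge> 2\<close>, and each of the finitely many other primes costs one factor \<open>K\<close>.
\<close>

lemma divisor_count_le_powr:
  assumes "\<delta> > 0"
  shows "\<exists>C>0. \<forall>n\<ge>1. real (divisor_count n) \<le> C * real n powr \<delta>"
proof -
  \<comment> \<open>Since K >= 1 and K \<delta> ln 2 >= 1, the inequality 1 + x <= e^x gives a + 1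
    <= K (1 + a \<delta> ln 2) <= K 2^(a\<delta>).\<close>
  define K where "K = max 1 (1 / (\<delta> * ln 2))"
  define S where "S = {p::nat. real p powr \<delta> < 2}"
  have K1: "K \<ge> 1" by (simp add: K_def)
  have fin: "finite S"
  proof (rule finite_subset)
    show "S \<subseteq> {p. p \<le> nat \<lceil>2 powr (1 / \<delta>)\<rceil>}"
    proof
      fix p assume "p \<in> S"
      then have "(real p powr \<delta>) powr (1 / \<delta>) \<le> 2 powr (1 / \<delta>)"
        using assms by (intro powr_mono2) (auto simp: S_def)
      then have "real p \<le> 2 powr (1 / \<delta>)"
        using assms by (cases "p = 0") (auto simp: powr_powr)
      then show "p \<in> {p. p \<le> nat \<lceil>2 powr (1 / \<delta>)\<rceil>}"
        by (auto intro!: le_nat_iff[THEN iffD2] simp: le_ceiling_iff)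
    qed
  qed auto
  have local: "real (a + 1) \<le> (if p \<in> S then K else 1) * real (p ^ a) powr \<delta>" if "prime p" for p a
  proof -
    have p2: "real p \<ge> 2" using prime_ge_2_nat[OF that] by simp
    have pa: "real (p ^ a) powr \<delta> = (real p powr \<delta>) ^ a"
      using p2 by (simp add: powr_powr powr_realpow[symmetric] mult.commute)
    show ?thesis
    proof (cases "p \<in> S")
      case True
      have "1 + real a * (\<delta> * ln 2) \<le> exp (real a * (\<delta> * ln 2))"
        by (rule exp_ge_add_one_self)
      also have "\<dots> = (2 powr \<delta>) ^ a"
        by (simp add: powr_def exp_of_nat_mult mult.assoc)
      also have "\<dots> \<le> (real p powr \<delta>) ^ a"
        using assms p2 by (intro power_mono powr_mono2) auto
      finally have 1: "1 + real a * (\<delta> * ln 2) \<le> (real p powr \<delta>) ^ a" .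
      have "1 / (\<delta> * ln 2) \<le> K" by (simp add: K_def)
      then have "1 \<le> K * (\<delta> * ln 2)"
        using assms by (simp add: field_simps)
      then have "real a * 1 \<le> real a * (K * (\<delta> * ln 2))"
        by (intro mult_left_mono) auto
      then have "real (a + 1) \<le> K * (1 + real a * (\<delta> * ln 2))"
        using K1 by (simp add: algebra_simps)
      also have "\<dots> \<le> K * (real p powr \<delta>) ^ a"
        using 1 K1 by (intro mult_left_mono) auto
      finally show ?thesis using True by (simp only: pa if_True)
    next
      case False
      then have "2 ^ a \<le> (real p powr \<delta>) ^ a"
        by (intro power_mono) (auto simp: S_def)
      moreover have "real (a + 1) \<le> 2 ^ a"
        by (induction a) auto
      ultimately have "real (a + 1) \<le> (real p powr \<delta>) ^ a" by linarith
      then show ?thesis using False by (simp only: pa if_False mult_1_left)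
    qed
  qed
  \<comment> \<open>The exponent of K counts the small primes dividing n; splitting off the full
    power of one of them lowers it by at least one.\<close>
  have main: "real (divisor_count n) \<le> K ^ card {p \<in> S. prime p \<and> p dvd n} * real n powr \<delta>" if "n \<ge> 1" for n
    using that
  proof (induction n rule: less_induct)
    case (less n)
    show ?case
    proof (cases "n = 1")
      case True
      have "{d::nat. d dvd 1} = {1}" by auto
      with True have "divisor_count n = 1" by simp
      moreover have "1 \<le> K ^ card {p \<in> S. prime p \<and> p dvd n}" using K1 by (rule one_le_power)
      ultimately show ?thesis using True by simp
    next
      case False
      then obtain p where p: "prime p" "p dvd n"
        using prime_factor_nat by blast
      define a where "a = multiplicity p n"
      have "n \<noteq> 0" "\<not> is_unit p"
        using less.prems p(1) not_prime_unit by auto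
      from multiplicity_decompose'[OF this] obtain m where m: "n = p ^ a * m" "\<not> p dvd m"
        unfolding a_def by blast
      have "a > 0" using p less.prems unfolding a_def by (simp add: prime_multiplicity_gt_zero_iff)
      then have "p ^ a > 1" by (rule one_less_power[OF prime_gt_1_nat[OF p(1)]])
      moreover have m0: "m > 0" using m less.prems by (cases m) auto
      ultimately have "m < n" using m(1) by simp
      let ?P = "\<lambda>n. {p \<in> S. prime p \<and> p dvd n}"
      have card: "(if p \<in> S then K else 1) * K ^ card (?P m) \<le> K ^ card (?P n)"
      proof (cases "p \<in> S")
        case True
        have "insert p (?P m) \<subseteq> ?P n" using True p m(1) by auto
        then have "card (insert p (?P m)) \<le> card (?P n)"
          using fin by (intro card_mono) auto
        moreover have "card (insert p (?P m)) = Suc (card (?P m))"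
          using fin m(2) by (subst card_insert_disjoint) auto
        ultimately have "K ^ Suc (card (?P m)) \<le> K ^ card (?P n)"
          using K1 by (intro power_increasing) auto
        with True show ?thesis by simp
      next
        case False
        have "card (?P m) \<le> card (?P n)"
          using fin m(1) by (intro card_mono) auto
        with False K1 show ?thesis by (simp add: power_increasing)
      qed
      have "real (divisor_count (p ^ a * m)) \<le> real ((a + 1) * divisor_count m)"
        unfolding of_nat_le_iff by (rule divisor_count_prime_power_mult[OF p(1) m0])
      then have "real (divisor_count n) \<le> real (a + 1) * real (divisor_count m)"
        by (simp only: m(1) of_nat_mult)
      also have "\<dots> \<le> ((if p \<in> S then K else 1) * real (p ^ a) powr \<delta>) * (K ^ card (?P m) * real m powr \<delta>)"
      proof (rule mult_mono[OF local[OF p(1)] less.IH[OF \<open>m < n\<close>]])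
        show "1 \<le> m" using m0 by simp
        have "0 \<le> (if p \<in> S then K else 1)" using K1 by auto
        then show "0 \<le> (if p \<in> S then K else 1) * real (p ^ a) powr \<delta>"
          by (rule mult_nonneg_nonneg) (rule powr_ge_zero)
      qed simp
      also have "\<dots> = ((if p \<in> S then K else 1) * K ^ card (?P m)) * (real (p ^ a) powr \<delta> * real m powr \<delta>)"
        by (simp only: mult_ac)
      also have "real (p ^ a) powr \<delta> * real m powr \<delta> = real n powr \<delta>"
        unfolding m(1) of_nat_mult by (rule powr_mult[symmetric])
      also have "((if p \<in> S then K else 1) * K ^ card (?P m)) * real n powr \<delta> \<le> K ^ card (?P n) * real n powr \<delta>"
        by (intro mult_right_mono card) auto
      finally show ?thesis .
    qed
  qed
  show ?thesis
  proof (intro exI[of _ "K ^ card S"] conjI allI impI)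
    show "K ^ card S > 0" using K1 by simp
    fix n :: nat assume n: "n \<ge> 1"
    have "K ^ card {p \<in> S. prime p \<and> p dvd n} \<le> K ^ card S"
      using fin K1 by (intro power_increasing card_mono) auto
    then show "real (divisor_count n) \<le> K ^ card S * real n powr \<delta>"
      using main[OF n] by (meson mult_right_mono order_trans powr_ge_zero)
  qed
qed

section \<open>Counting the generators with a given dual vector\<close>

text \<open>n is the sum of \<open>totient d\<close> over its divisors d, and each of these is at
  most \<open>totient n\<close>. With the divisor bound, the restriction to generators coprime to N
  costs only a small power of N.\<close>

lemma le_totient_times_divisor_count:
  assumes "n \<ge> 1"
  shows "n \<le> totient n * divisor_count n"
proof -
  have "n = (\<Sum>d | d dvd n. totient d)"
    by (rule totient_divisor_sum[symmetric])
  also have "\<dots> \<le> (\<Sum>d | d dvd n. totient n)"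
    using assms by (intro sum_mono totient_dvd_mono) auto
  finally show ?thesis by (simp add: mult.commute)
qed

text \<open>With g the gcd and M = N/g, two solutions differ by a multiple of M. So each of the g
  blocks of M consecutive numbers contains at most one; the blocks are numbered by (y - 1) div M
  because y starts at 1.\<close>

lemma card_linear_congruence:
  fixes h b :: int
  assumes "N \<ge> 1"
  shows "card {y \<in> {1..N}. int N dvd h * int y + b} \<le> gcd (nat \<bar>h\<bar>) N"
proof -
  define g where "g = gcd (nat \<bar>h\<bar>) N"
  have g: "g dvd N" unfolding g_def by (rule gcd_dvd2)
  have "N > 0" using assms by simp
  then have "g > 0" using g by (rule dvd_pos_nat)
  note g = this g
  define M where "M = N div g"
  have N: "N = g * M" using g by (simp add: M_def)
  have M: "M > 0" using N assms by (cases M) auto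
  have dvd: "int M dvd int y - int y'" if "int N dvd h * int y + b" "int N dvd h * int y' + b" for y y'
  proof -
    have "int N dvd h * (int y - int y')"
      using dvd_diff[OF that] by (simp add: algebra_simps)
    have gcd: "int g = gcd h (int N)"
      unfolding g_def gcd_int_def by (simp only: abs_of_nat nat_int)
    then have "int g dvd h" by (simp only: gcd_dvd1)
    then obtain h' where h': "h = int g * h'" by (elim dvdE)
    have "int g * int M dvd int g * (h' * (int y - int y'))"
      using \<open>int N dvd h * (int y - int y')\<close> unfolding h' N of_nat_mult by (simp only: mult.assoc)
    then have "int M dvd h' * (int y - int y')"
      using g(1) by simp
    moreover have "coprime (int M) h'"
    proof -
      have "gcd (int g * h') (int g * int M) = int g"
        using gcd unfolding h' N of_nat_mult by (rule sym)
      then have "int g * gcd h' (int M) = int g"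
        using gcd_mult_distrib_int[of "int g" h' "int M"] by (simp only: abs_of_nat)
      then show ?thesis using g(1) by (simp add: coprime_iff_gcd_eq_1 gcd.commute)
    qed
    ultimately show ?thesis by (simp add: coprime_dvd_mult_right_iff)
  qed
  have "inj_on (\<lambda>y. (y - 1) div M) {y \<in> {1..N}. int N dvd h * int y + b}"
  proof (rule inj_onI)
    fix y y' assume y: "y \<in> {y \<in> {1..N}. int N dvd h * int y + b}" "y' \<in> {y \<in> {1..N}. int N dvd h * int y + b}"
      and eq: "(y - 1) div M = (y' - 1) div M"
    have "int M dvd int y - int y'"
      using y dvd[of y y'] by simp
    moreover have "int y - int y' = int (y - 1) - int (y' - 1)"
      using y by auto
    ultimately have "int (y - 1) mod int M = int (y' - 1) mod int M"
      by (simp add: mod_eq_dvd_iff)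
    then have "(y - 1) mod M = (y' - 1) mod M"
      by (simp only: zmod_int[symmetric] of_nat_eq_iff)
    with eq have "y - 1 = y' - 1"
      by (metis div_mult_mod_eq)
    with y show "y = y'" by auto
  qed
  moreover have "(\<lambda>y. (y - 1) div M) ` {y \<in> {1..N}. int N dvd h * int y + b} \<subseteq> {..<g}"
    using M N by (auto simp: div_less_iff_less_mult)
  ultimately have "card {y \<in> {1..N}. int N dvd h * int y + b} \<le> card {..<g}"
    by (intro card_inj_on_le) auto
  then show ?thesis by (simp add: g_def)
qed

lemma generators_eq: "N \<ge> 1 \<Longrightarrow> generators N = totatives N"
  by (auto simp: generators_def totatives_def)

lemma card_generators: "N \<ge> 1 \<Longrightarrow> card (generators N) = totient N"
  by (simp add: generators_eq totient_def)

abbreviation generator_vecs :: "nat \<Rightarrow> ('s \<Rightarrow> nat) set" where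
  "generator_vecs N \<equiv> {z. \<forall>j. z j \<in> generators N}"

lemma finite_generators [simp]: "finite (generators N)"
  by (simp add: generators_def)

lemma generator_vecs_PiE: "generator_vecs N = PiE UNIV (\<lambda>_. generators N)"
  by auto

text \<open>All coordinates of z except \<open>z j\<close> are free, and \<open>z j\<close> solves a
  linear congruence. It may range over all of 1..N here, while the mean divides by
  \<open>totient N\<close>; \<open>le_totient_times_divisor_count\<close> bounds this loss.\<close>

lemma card_dual:
  fixes u :: "'s::finite set"
  assumes N: "N \<ge> 1" and j: "j \<in> u"
  shows "card {z \<in> generator_vecs N. int N dvd (\<Sum>i\<in>u. h i * int (z i))}
     \<le> card (generators N) ^ (CARD('s) - 1) * gcd (nat \<bar>h j\<bar>) N"
proof -
  let ?G = "generators N"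
  let ?W = "PiE (UNIV - {j}) (\<lambda>_. ?G)"
  let ?Y = "\<lambda>w. {y \<in> {1..N}. int N dvd h j * int y + (\<Sum>i\<in>u - {j}. h i * int (w i))}"
  have "{z \<in> generator_vecs N. int N dvd (\<Sum>i\<in>u. h i * int (z i))} \<subseteq> (\<lambda>(w, y). w(j := y)) ` (SIGMA w:?W. ?Y w)"
  proof
    fix z assume z: "z \<in> {z \<in> generator_vecs N. int N dvd (\<Sum>i\<in>u. h i * int (z i))}"
    let ?w = "restrict z (UNIV - {j})"
    have "z = ?w(j := z j)" by auto
    moreover have "?w \<in> ?W" using z by auto
    moreover have "z j \<in> ?Y ?w"
    proof -
      have "(\<Sum>i\<in>u. h i * int (z i)) = h j * int (z j) + (\<Sum>i\<in>u - {j}. h i * int (z i))"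
        using j by (intro sum.remove) auto
      also have "(\<Sum>i\<in>u - {j}. h i * int (z i)) = (\<Sum>i\<in>u - {j}. h i * int (?w i))"
        by (intro sum.cong) auto
      finally have "(\<Sum>i\<in>u. h i * int (z i)) = h j * int (z j) + (\<Sum>i\<in>u - {j}. h i * int (?w i))" .
      moreover have "z j \<in> ?G" using z by simp
      ultimately show ?thesis using z by (auto simp: generators_def)
    qed
    ultimately show "z \<in> (\<lambda>(w, y). w(j := y)) ` (SIGMA w:?W. ?Y w)"
      by (intro image_eqI[where x="(?w, z j)"]) (simp_all only: prod.case mem_Sigma_iff)
  qed
  then have "card {z \<in> generator_vecs N. int N dvd (\<Sum>i\<in>u. h i * int (z i))} \<le> card (SIGMA w:?W. ?Y w)"
    by (intro surj_card_le finite_SigmaI finite_PiE) auto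
  also have "\<dots> = (\<Sum>w\<in>?W. card (?Y w))"
    by (intro card_SigmaI finite_PiE) auto
  also have "\<dots> \<le> (\<Sum>w\<in>?W. gcd (nat \<bar>h j\<bar>) N)"
    by (intro sum_mono card_linear_congruence N)
  also have "\<dots> = card ?G ^ (CARD('s) - 1) * gcd (nat \<bar>h j\<bar>) N"
    by (simp add: card_PiE card_Diff_singleton)
  finally show ?thesis .
qed

definition zeta_ints :: "real \<Rightarrow> ennreal" where
  "zeta_ints a = (\<integral>\<^sup>+h. ennreal (\<bar>of_int h\<bar> powr - a) \<partial>nonzero_ints)"

lemma zeta_ints_finite:
  assumes "a > 1"
  shows "zeta_ints a < \<infinity>"
proof -
  let ?f = "\<lambda>h::int. \<bar>of_int h\<bar> powr - a :: real"
  have "summable (\<lambda>n. real n powr - a)"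
    using assms by (simp add: summable_real_powr_iff)
  then have sm: "summable (\<lambda>n. real (Suc n) powr - a)"
    by (subst summable_Suc_iff[of "\<lambda>n. real n powr - a"])
  then have "(?f has_sum ((\<Sum>n. real (Suc n) powr - a) + (\<Sum>n. real (Suc n) powr - a))) (UNIV - {0})"
    by (intro has_sum_nonzero_ints) (auto simp del: of_nat_Suc intro: summable_sums)
  then have "(\<lambda>h. norm (?f h)) summable_on (UNIV - {0})"
    by (simp add: has_sum_imp_summable)
  then have "Infinite_Set_Sum.abs_summable_on ?f (UNIV - {0})"
    by (simp add: abs_summable_equivalent[symmetric])
  then show ?thesis
    by (simp add: zeta_ints_def abs_summable_on_def integrable_iff_bounded)
qed

text \<open>The gcd is one of the common divisors of h and N, hence at most their sum. For a fixed
  divisor d, the substitution h = d k produces the factor d^(1 - a) <= 1.\<close>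

lemma sum_gcd_le:
  assumes N: "N \<ge> 1" and a: "a > 1"
  shows "(\<integral>\<^sup>+h. ennreal (\<bar>of_int h\<bar> powr - a) * of_nat (gcd (nat \<bar>h\<bar>) N) \<partial>nonzero_ints)
     \<le> of_nat (divisor_count N) * zeta_ints a"
proof -
  have fin: "finite {d. d dvd N}" using N by auto
  have "(\<integral>\<^sup>+h. ennreal (\<bar>of_int h\<bar> powr - a) * of_nat (gcd (nat \<bar>h\<bar>) N) \<partial>nonzero_ints) \<le>
     (\<integral>\<^sup>+h. (\<Sum>d | d dvd N. ennreal (\<bar>of_int h\<bar> powr - a) * (of_nat d * of_bool (int d dvd h))) \<partial>nonzero_ints)"
  proof (intro nn_integral_mono)
    fix h :: int
    let ?g = "gcd (nat \<bar>h\<bar>) N"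
    have "int ?g dvd int (nat \<bar>h\<bar>)"
      unfolding of_nat_dvd_iff by (rule gcd_dvd1)
    then have "int ?g dvd h" by simp
    then have "ennreal (\<bar>of_int h\<bar> powr - a) * of_nat ?g = ennreal (\<bar>of_int h\<bar> powr - a) * (of_nat ?g * of_bool (int ?g dvd h))"
      by (simp only: of_bool_eq mult_1_right)
    also have "\<dots> \<le> (\<Sum>d | d dvd N. ennreal (\<bar>of_int h\<bar> powr - a) * (of_nat d * of_bool (int d dvd h)))"
    proof -
      have "?g \<in> {d. d dvd N}" by (rule CollectI, rule gcd_dvd2)
      then show ?thesis by (rule member_le_sum) (use fin in auto)
    qed
    finally show "ennreal (\<bar>of_int h\<bar> powr - a) * of_nat ?g \<le> (\<Sum>d | d dvd N. ennreal (\<bar>of_int h\<bar> powr - a) * (of_nat d * of_bool (int d dvd h)))" .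
  qed
  also have "\<dots> = (\<Sum>d | d dvd N. \<integral>\<^sup>+h. ennreal (\<bar>of_int h\<bar> powr - a) * (of_nat d * of_bool (int d dvd h)) \<partial>nonzero_ints)"
    by (rule nn_integral_sum) auto
  also have "\<dots> \<le> (\<Sum>d | d dvd N. zeta_ints a)"
  proof (rule sum_mono)
    fix d assume "d \<in> {d. d dvd N}"
    then have d: "d \<ge> 1" using N by (cases d) auto
    have "(\<integral>\<^sup>+h. ennreal (\<bar>of_int h\<bar> powr - a) * (of_nat d * of_bool (int d dvd h)) \<partial>nonzero_ints) =
       (\<integral>\<^sup>+h. ennreal (\<bar>of_int h\<bar> powr - a) * of_nat d \<partial>count_space {h. h \<noteq> 0 \<and> int d dvd h})"
    proof -
      have "(\<integral>\<^sup>+h. ennreal (\<bar>of_int h\<bar> powr - a) * (of_nat d * of_bool (int d dvd h)) \<partial>nonzero_ints) =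
        (\<integral>\<^sup>+h. ennreal (\<bar>of_int h\<bar> powr - a) * of_nat d * indicator {h. h \<noteq> 0 \<and> int d dvd h} h \<partial>nonzero_ints)"
        by (intro nn_integral_cong) (auto simp: indicator_def)
      also have "\<dots> = (\<integral>\<^sup>+h. ennreal (\<bar>of_int h\<bar> powr - a) * of_nat d \<partial>count_space {h. h \<noteq> 0 \<and> int d dvd h})"
        by (subst (1 2) nn_integral_count_space_indicator) (auto intro!: nn_integral_cong simp: indicator_def)
      finally show ?thesis .
    qed
    also have "\<dots> = (\<integral>\<^sup>+k. ennreal (\<bar>of_int (int d * k)\<bar> powr - a) * of_nat d \<partial>nonzero_ints)"
    proof (rule nn_integral_bij_count_space[symmetric])
      show "bij_betw ((*) (int d)) (UNIV - {0}) {h. h \<noteq> 0 \<and> int d dvd h}"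
        using d by (auto simp: bij_betw_def inj_on_def elim!: dvdE)
    qed
    also have "\<dots> \<le> (\<integral>\<^sup>+k. ennreal (\<bar>of_int k\<bar> powr - a) \<partial>nonzero_ints)"
    proof (intro nn_integral_mono)
      fix k :: int
      have "\<bar>of_int (int d * k)\<bar> powr - a * real d = real d powr (1 - a) * \<bar>of_int k\<bar> powr - a"
        using d by (simp add: abs_mult powr_mult powr_diff powr_minus field_simps)
      also have "\<dots> \<le> 1 * \<bar>of_int k\<bar> powr - a"
        using powr_mono[of "1 - a" 0 "real d"] d a by (intro mult_right_mono) auto
      finally have "ennreal (\<bar>of_int (int d * k)\<bar> powr - a * real d) \<le> ennreal (\<bar>of_int k\<bar> powr - a)"
        by (intro ennreal_leI) simp
      then show "ennreal (\<bar>of_int (int d * k)\<bar> powr - a) * of_nat d \<le> ennreal (\<bar>of_int k\<bar> powr - a)"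
        by (simp add: ennreal_mult ennreal_of_nat_eq_real_of_nat)
    qed
    finally show "(\<integral>\<^sup>+h. ennreal (\<bar>of_int h\<bar> powr - a) * (of_nat d * of_bool (int d dvd h)) \<partial>nonzero_ints) \<le> zeta_ints a"
      by (simp add: zeta_ints_def)
  qed
  finally show ?thesis by simp
qed

text \<open>All components of h in \<open>u\<close> are nonzero: these are the vectors of the dual
  lattice with support exactly \<open>u\<close>.\<close>

definition dual_sum :: "real \<Rightarrow> nat \<Rightarrow> ('s \<Rightarrow> nat) \<Rightarrow> 's set \<Rightarrow> ennreal" where
  "dual_sum a N z u = (\<integral>\<^sup>+h. of_bool (int N dvd (\<Sum>i\<in>u. h i * int (z i))) * ennreal (\<Prod>i\<in>u. \<bar>of_int (h i)\<bar> powr - a)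
      \<partial>count_space (PiE u (\<lambda>_. UNIV - {0})))"

text \<open>After interchanging the sums, each frequency vector is counted by
  \<open>card_dual\<close> for one fixed \<open>j\<close> in \<open>u\<close>. The gcd then affects
  only the factor of coordinate \<open>j\<close>, treated by \<open>sum_gcd_le\<close>; the other
  factors are plain zeta series.\<close>

lemma mean_dual_sum:
  fixes u :: "'s::finite set"
  assumes N: "N \<ge> 1" and a: "a > 1" and u: "u \<noteq> {}"
  shows "(\<Sum>z\<in>generator_vecs N. dual_sum a N z u) \<le>
     of_nat (card (generators N) ^ (CARD('s) - 1)) * (of_nat (divisor_count N) * zeta_ints a ^ card u)"
proof -
  obtain j where j: "j \<in> u" using u by auto
  let ?H = "PiE u (\<lambda>_. UNIV - {0 :: int})"
  let ?G = "card (generators N) ^ (CARD('s) - 1)"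
  let ?d = "\<lambda>z h. int N dvd (\<Sum>i\<in>u. h i * int (z i))"
  have finG: "finite (generator_vecs N :: ('s \<Rightarrow> nat) set)"
    unfolding generator_vecs_PiE by (intro finite_PiE) auto
  have "(\<Sum>z\<in>generator_vecs N. dual_sum a N z u) =
     (\<integral>\<^sup>+h. (\<Sum>z\<in>generator_vecs N. of_bool (?d z h) * ennreal (\<Prod>i\<in>u. \<bar>of_int (h i)\<bar> powr - a)) \<partial>count_space ?H)"
    unfolding dual_sum_def by (rule nn_integral_sum[symmetric]) auto
  also have "\<dots> \<le> (\<integral>\<^sup>+h. of_nat ?G * (of_nat (gcd (nat \<bar>h j\<bar>) N) * ennreal (\<Prod>i\<in>u. \<bar>of_int (h i)\<bar> powr - a)) \<partial>count_space ?H)"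
  proof (intro nn_integral_mono)
    fix h
    have "(\<Sum>z\<in>generator_vecs N. of_bool (?d z h) :: ennreal) = of_nat (card {z \<in> generator_vecs N. ?d z h})"
      using finG by (simp add: sum.inter_filter[symmetric] of_bool_def sum.If_cases Int_def)
    also have "\<dots> \<le> of_nat (?G * gcd (nat \<bar>h j\<bar>) N)"
      using card_dual[OF N j, of h] by (simp only: of_nat_le_iff)
    finally show "(\<Sum>z\<in>generator_vecs N. of_bool (?d z h) * ennreal (\<Prod>i\<in>u. \<bar>of_int (h i)\<bar> powr - a)) \<le>
       of_nat ?G * (of_nat (gcd (nat \<bar>h j\<bar>) N) * ennreal (\<Prod>i\<in>u. \<bar>of_int (h i)\<bar> powr - a))"
      unfolding sum_distrib_right[symmetric] mult.assoc[symmetric] of_nat_mult[symmetric] by (intro mult_right_mono) auto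
  qed
  also have "\<dots> = of_nat ?G * (\<integral>\<^sup>+h. of_nat (gcd (nat \<bar>h j\<bar>) N) * ennreal (\<Prod>i\<in>u. \<bar>of_int (h i)\<bar> powr - a) \<partial>count_space ?H)"
    by (rule nn_integral_cmult) simp
  also have "(\<integral>\<^sup>+h. of_nat (gcd (nat \<bar>h j\<bar>) N) * ennreal (\<Prod>i\<in>u. \<bar>of_int (h i)\<bar> powr - a) \<partial>count_space ?H) \<le>
     of_nat (divisor_count N) * zeta_ints a ^ card u"
  proof -
    let ?q = "\<lambda>i k. ennreal (\<bar>of_int k\<bar> powr - a) * (if i = j then of_nat (gcd (nat \<bar>k\<bar>) N) else 1)"
    have "(\<integral>\<^sup>+h. of_nat (gcd (nat \<bar>h j\<bar>) N) * ennreal (\<Prod>i\<in>u. \<bar>of_int (h i)\<bar> powr - a) \<partial>count_space ?H) =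
       (\<integral>\<^sup>+h. (\<Prod>i\<in>u. ?q i (h i)) \<partial>PiM u (\<lambda>_. nonzero_ints))"
      unfolding count_space_PiM_finite[OF finite countable_subset[OF subset_UNIV countableI_type]]
    proof (intro nn_integral_cong)
      fix h
      have "(\<Prod>i\<in>u. ?q i (h i)) = (\<Prod>i\<in>u. ennreal (\<bar>of_int (h i)\<bar> powr - a)) * (\<Prod>i\<in>u. if i = j then of_nat (gcd (nat \<bar>h i\<bar>) N) else 1)"
        by (rule prod.distrib)
      also have "(\<Prod>i\<in>u. if i = j then of_nat (gcd (nat \<bar>h i\<bar>) N) else 1) = (of_nat (gcd (nat \<bar>h j\<bar>) N) :: ennreal)"
        using j by simp
      also have "(\<Prod>i\<in>u. ennreal (\<bar>of_int (h i)\<bar> powr - a)) = ennreal (\<Prod>i\<in>u. \<bar>of_int (h i)\<bar> powr - a)"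
        by (rule prod_ennreal) simp
      finally show "of_nat (gcd (nat \<bar>h j\<bar>) N) * ennreal (\<Prod>i\<in>u. \<bar>of_int (h i)\<bar> powr - a) = (\<Prod>i\<in>u. ?q i (h i))"
        by (simp only: mult.commute)
    qed
    also have "\<dots> = (\<Prod>i\<in>u. \<integral>\<^sup>+k. ?q i k \<partial>nonzero_ints)"
      by (rule CB.product_nn_integral_prod) auto
    also have "\<dots> = (\<integral>\<^sup>+k. ?q j k \<partial>nonzero_ints) * (\<Prod>i\<in>u - {j}. \<integral>\<^sup>+k. ?q i k \<partial>nonzero_ints)"
      using j by (intro prod.remove) auto
    also have "(\<Prod>i\<in>u - {j}. \<integral>\<^sup>+k. ?q i k \<partial>nonzero_ints) = (\<Prod>i\<in>u - {j}. zeta_ints a)"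
      by (intro prod.cong) (auto simp: zeta_ints_def)
    also have "(\<integral>\<^sup>+k. ?q j k \<partial>nonzero_ints) \<le> of_nat (divisor_count N) * zeta_ints a"
      using sum_gcd_le[OF N a] by simp
    finally have "(\<integral>\<^sup>+h. of_nat (gcd (nat \<bar>h j\<bar>) N) * ennreal (\<Prod>i\<in>u. \<bar>of_int (h i)\<bar> powr - a) \<partial>count_space ?H) \<le>
      of_nat (divisor_count N) * zeta_ints a * (\<Prod>i\<in>u - {j}. zeta_ints a)"
      by (simp add: mult_right_mono)
    also have "\<dots> = of_nat (divisor_count N) * zeta_ints a ^ card u"
      using j by (simp add: mult.assoc card_gt_0_iff power_Suc[symmetric] card_Diff_singleton
          del: power_Suc) (metis Suc_pred card_gt_0_iff emptyE finite power_Suc)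
    finally show ?thesis .
  qed
  finally show ?thesis
    by (simp add: mult_left_mono)
qed

text \<open>For q <= 1 the l^q quasinorm dominates the l^1 norm: each single term satisfies f^q <=
  S, so f = f^(1 - q) f^q <= S^((1 - q)/q) f^q.\<close>

lemma nn_integral_powr_le:
  fixes f :: "'a \<Rightarrow> real"
  assumes q: "0 < q" "q \<le> 1" and nonneg: "\<And>h. 0 \<le> f h" and S: "0 \<le> S"
    and le: "(\<integral>\<^sup>+h. ennreal (f h powr q) \<partial>count_space H) \<le> ennreal S"
  shows "(\<integral>\<^sup>+h. ennreal (f h) \<partial>count_space H) \<le> ennreal (S powr (1 / q))"
proof -
  have "f h \<le> S powr ((1 - q) / q) * f h powr q" if "h \<in> H" for h
  proof (cases "f h = 0")
    case False
    have "ennreal (f h powr q) \<le> (\<integral>\<^sup>+h. ennreal (f h powr q) \<partial>count_space H)"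
      using that by (rule nn_integral_ge_point)
    with le have "ennreal (f h powr q) \<le> ennreal S" by (rule order_trans[rotated])
    then have "f h powr q \<le> S" using S by (simp add: ennreal_le_iff)
    then have "(f h powr q) powr ((1 - q) / q) \<le> S powr ((1 - q) / q)"
      using q by (intro powr_mono2) auto
    moreover have "(f h powr q) powr ((1 - q) / q) = f h powr (1 - q)"
      using q by (simp add: powr_powr)
    moreover have "f h = f h powr (1 - q) * f h powr q"
      using nonneg[of h] False by (simp add: powr_add[symmetric])
    ultimately show ?thesis
      by (metis mult_right_mono powr_ge_zero)
  qed simp
  then have "(\<integral>\<^sup>+h. ennreal (f h) \<partial>count_space H) \<le> (\<integral>\<^sup>+h. ennreal (S powr ((1 - q) / q)) * ennreal (f h powr q) \<partial>count_space H)"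
    by (intro nn_integral_mono) (auto simp: ennreal_mult[symmetric] intro!: ennreal_leI)
  also have "\<dots> = ennreal (S powr ((1 - q) / q)) * (\<integral>\<^sup>+h. ennreal (f h powr q) \<partial>count_space H)"
    by (rule nn_integral_cmult) simp
  also have "\<dots> \<le> ennreal (S powr ((1 - q) / q)) * ennreal S"
    by (intro mult_left_mono le) auto
  also have "\<dots> = ennreal (S powr (1 / q))"
  proof (cases "S = 0")
    case False
    then have "S powr ((1 - q) / q) * S powr 1 = S powr (1 / q)"
      unfolding powr_add[symmetric] using q by (simp add: field_simps)
    then show ?thesis using S False by (simp add: ennreal_mult[symmetric])
  qed simp
  finally show ?thesis .
qed

section \<open>The quantile transform of shifted lattice points\<close>

lemma AE_LP_component:
  fixes j :: "'t::finite"
  assumes "AE x in lborel. S x"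
  shows "AE y in LP UNIV. S (y j)"
proof -
  have "AE x in distr (LP {j}) lborel (\<lambda>x. x j). S x"
    by (subst LP.distr_singleton) (rule assms)
  then have "AE x in LP {j}. S (x j)"
    by (rule AE_distrD[rotated]) simp
  then have "AE y in LP UNIV. S (restrict y {j} j)"
    by (rule AE_LP_extend)
  then show ?thesis by simp
qed

text \<open>The inverse distribution function is meaningful on (0,1) only, so the value 0 of the
  fractional part has to be excluded.\<close>

lemma AE_frac_pos: "AE x in lborel. 0 < frac (x + a :: real)"
proof -
  have "countable ((\<lambda>m. of_int m - a) ` (UNIV :: int set))" by simp
  then have "AE x in lborel. x \<notin> (\<lambda>m. of_int m - a) ` (UNIV :: int set)"
    by (intro AE_not_in countable_imp_null_set_lborel)
  then show ?thesis
  proof eventually_elim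
    case (elim x)
    have "frac (x + a) \<noteq> 0"
    proof
      assume "frac (x + a) = 0"
      then have "x = of_int \<lfloor>x + a\<rfloor> - a" by (simp add: frac_def)
      with elim show False by blast
    qed
    then show ?case using frac_ge_0[of "x + a"] by linarith
  qed
qed

context weighted_setting
begin

text \<open>Agrees with \<open>dist_inv \<phi>\<close> on (0,1); fixing the value elsewhere gives a
  measurable function.\<close>

definition quantile :: "real \<Rightarrow> real" where
  "quantile p = (if 0 < p \<and> p < 1 then dist_inv \<phi> p else 0)"

lemma dist_quantile:
  assumes "0 < p" "p < 1"
  shows "dist_fun \<phi> (quantile p) = p"
proof -
  have "\<exists>!y. dist_fun \<phi> y = p"
    using inv assms by (auto simp: dist_invertible_def)
  from theI'[OF this] show ?thesis
    using assms by (simp add: quantile_def dist_inv_def)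
qed

lemma quantile_unique:
  assumes "0 < p" "p < 1" "dist_fun \<phi> y = p"
  shows "y = quantile p"
proof -
  have "\<exists>!y. dist_fun \<phi> y = p"
    using inv assms by (auto simp: dist_invertible_def)
  then show ?thesis
    using assms dist_quantile by blast
qed

text \<open>Monotonicity gives one direction. The other uses that p is attained only once, which
  excludes a flat piece of \<Phi> at the level p.\<close>

lemma le_quantile_iff:
  assumes "0 < p" "p < 1"
  shows "t \<le> quantile p \<longleftrightarrow> dist_fun \<phi> t \<le> p"
  using dist_mono[of t "quantile p"] dist_mono[of "quantile p" t] dist_quantile[OF assms] quantile_unique[OF assms, of t]
  by (metis linorder_le_cases order_antisym)

lemma quantile_le_iff:
  assumes "0 < p" "p < 1"
  shows "quantile p \<le> t \<longleftrightarrow> p \<le> dist_fun \<phi> t"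
  using dist_mono[of t "quantile p"] dist_mono[of "quantile p" t] dist_quantile[OF assms] quantile_unique[OF assms, of t]
  by (metis linorder_le_cases order_antisym)

lemma quantile_meas [measurable]: "quantile \<in> borel_measurable borel"
proof (rule borel_measurableI_le)
  fix x
  have "{p \<in> space borel. quantile p \<le> x} = ({0<..<1} \<inter> {..dist_fun \<phi> x}) \<union> (if 0 \<le> x then - {0<..<1} else {})"
    using quantile_le_iff[of _ x] by (auto simp: quantile_def split: if_splits)
  then show "{p \<in> space borel. quantile p \<le> x} \<in> sets borel" by simp
qed

text \<open>Turns the kernel at a shifted point into the periodic function whose correlations have
  been computed.\<close>

lemma ker_quantile:
  assumes "0 < frac x"
  shows "ker (quantile (frac x)) t = saw (dist_fun \<phi> t) x"
  using le_quantile_iff[OF assms frac_lt_1, of t] by (simp add: ker_def saw_def)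

abbreviation (input) unit_uniform :: "real measure" where
  "unit_uniform \<equiv> density lborel (indicator {0..<1})"

lemma emeasure_unit_uniform:
  assumes [measurable]: "A \<in> sets borel"
  shows "emeasure unit_uniform A = emeasure lborel ({0..<1} \<inter> A)"
proof -
  have "emeasure unit_uniform A = (\<integral>\<^sup>+x. indicator {0..<1} x * indicator A x \<partial>lborel)"
    by (rule emeasure_density) auto
  also have "\<dots> = (\<integral>\<^sup>+x. indicator ({0..<1} \<inter> A) x \<partial>lborel)"
    by (intro nn_integral_cong) (simp split: split_indicator)
  also have "\<dots> = emeasure lborel ({0..<1} \<inter> A)"
    by (rule nn_integral_indicator) auto
  finally show ?thesis .
qed

lemma prob_space_unit_uniform: "prob_space unit_uniform"
  by (rule prob_spaceI) (subst emeasure_unit_uniform, simp_all add: space_density)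

text \<open>Inverse transform sampling, by comparison of the distribution functions.\<close>

lemma quantile_distr: "distr unit_uniform borel quantile = P"
proof (rule cdf_unique)
  interpret U: prob_space unit_uniform by (rule prob_space_unit_uniform)
  show "real_distribution P" by (rule real_distribution_P)
  have [measurable]: "quantile \<in> borel_measurable unit_uniform" by simp
  show "real_distribution (distr unit_uniform borel quantile)"
    by (rule U.real_distribution_distr) measurable
  show "cdf (distr unit_uniform borel quantile) = cdf P"
  proof
    fix x
    have "cdf (distr unit_uniform borel quantile) x = measure unit_uniform (quantile -` {..x})"
      unfolding cdf_def by (subst measure_distr) (auto simp: space_density)
    also have "\<dots> = measure lborel ({0..<1} \<inter> quantile -` {..x})"
      unfolding measure_def by (subst emeasure_unit_uniform) (auto intro!: measurable_sets_borel[OF quantile_meas])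
    also have "\<dots> = measure lborel {0..dist_fun \<phi> x}"
    proof (rule measure_eq_AE)
      show "AE p in lborel. (p \<in> {0..<1} \<inter> quantile -` {..x}) = (p \<in> {0..dist_fun \<phi> x})"
        using AE_lborel_singleton[of "0::real"] AE_lborel_singleton[of "1::real"]
      proof eventually_elim
        case (elim p)
        show ?case
        proof (cases "0 < p \<and> p < 1")
          case True
          then show ?thesis using quantile_le_iff[of p x] by auto
        next
          case False
          then have "p < 0 \<or> 1 < p" using elim by auto
          then show ?thesis using dist_le1[of x] by (auto simp del: dist_le1)
        qed
      qed
    qed (auto intro!: sets.Int measurable_sets_borel[OF quantile_meas])
    also have "\<dots> = dist_fun \<phi> x" by simp
    finally show "cdf (distr unit_uniform borel quantile) x = cdf P x"
      by (simp add: dist_fun_def)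
  qed
qed

text \<open>Rotation modulo 1 preserves the uniform distribution, so a shifted point has the same
  law as an unshifted one.\<close>

lemma quantile_shift_emeasure:
  assumes [measurable]: "A \<in> sets borel"
  shows "(\<integral>\<^sup>+x. indicator {0..<1} x * indicator A (quantile (frac (x + a))) \<partial>lborel) = emeasure P A"
proof -
  have [measurable]: "(\<lambda>x::real. frac (x + b)) \<in> borel_measurable borel" for b
    unfolding frac_def by measurable
  have int: "integrable lborel (\<lambda>x::real. indicator {0..<1} x * indicator A (quantile (frac (x + b))) :: real)" for b
    by (rule Bochner_Integration.integrable_bound[of _ "indicator {0..1::real} :: real \<Rightarrow> real"])
       (auto simp: indicator_def intro!: AE_I2)
  have "(\<integral>\<^sup>+x. indicator {0..<1} x * indicator A (quantile (frac (x + b))) \<partial>lborel) =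
     ennreal (LINT x|lborel. indicator {0..<1} x * indicator A (quantile (frac (x + b))))" for b
  proof -
    have "(\<integral>\<^sup>+x. indicator {0..<1} x * indicator A (quantile (frac (x + b))) \<partial>lborel) =
       (\<integral>\<^sup>+x. ennreal (indicator {0..<1} x * indicator A (quantile (frac (x + b)))) \<partial>lborel)"
      by (intro nn_integral_cong) (simp split: split_indicator)
    then show ?thesis
      by (simp only:) (intro nn_integral_eq_integral int AE_I2, simp)
  qed
  note nn = this
  have "(LINT x|lborel. indicator {0..<1} x * indicator A (quantile (frac (x + a)))) =
     (LINT x|lborel. indicator {0..<1} x * indicator A (quantile (frac x)) :: real)"
  proof (rule integral_periodic[where B=1])
    show "(\<lambda>x. indicator A (quantile (frac x)) :: real) \<in> borel_measurable borel"
      by measurable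
    show "indicator A (quantile (frac (x + 1))) = indicator A (quantile (frac x))" for x
      by (simp add: frac_def)
  qed (auto simp: indicator_def)
  then have "(\<integral>\<^sup>+x. indicator {0..<1} x * indicator A (quantile (frac (x + a))) \<partial>lborel) =
     (\<integral>\<^sup>+x. indicator {0..<1} x * indicator A (quantile (frac (x + 0))) \<partial>lborel)"
    unfolding nn by simp
  also have "\<dots> = (\<integral>\<^sup>+x. indicator {0..<1} x * indicator (quantile -` A) x \<partial>lborel)"
    by (intro nn_integral_cong) (auto simp: indicator_def frac_eq[THEN iffD2])
  also have "\<dots> = emeasure unit_uniform (quantile -` A)"
    by (subst emeasure_density) (auto intro!: measurable_sets_borel[OF quantile_meas])
  also have "\<dots> = emeasure (distr unit_uniform borel quantile) A"
    by (subst emeasure_distr) (auto simp: space_density)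
  also have "\<dots> = emeasure P A"
    by (simp only: quantile_distr)
  finally show ?thesis .
qed

text \<open>
  The representation of \<open>f\<close> only holds almost everywhere; shifted points have the density
  \<open>\<Prod>j. \<phi> (y j)\<close>, hence almost surely avoid the exceptional set.
\<close>

lemma quantile_vec_distr:
  "distr (density (LP UNIV) (\<lambda>\<Delta>. \<Prod>j\<in>UNIV. indicator {0..<1} (\<Delta> j))) (LP UNIV) (\<lambda>\<Delta> j. quantile (frac (\<Delta> j + a j))) =
   density (LP (UNIV :: 's set)) (\<lambda>y. \<Prod>j\<in>UNIV. ennreal (\<phi> (y j)))" (is "?M1 = ?M2")
proof -
  interpret PP: product_sigma_finite "\<lambda>_. P" by standard
  have [measurable]: "(\<lambda>x::real. frac (x + b)) \<in> borel_measurable borel" for b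
    unfolding frac_def by measurable
  have T [measurable]: "(\<lambda>\<Delta> j. quantile (frac (\<Delta> j + a j))) \<in> LP UNIV \<rightarrow>\<^sub>M LP UNIV"
    by (rule measurable_abs_UNIV) measurable
  have sets: "sets (PiM UNIV (\<lambda>_::'s. P)) = sets (LP UNIV)"
    by (intro sets_PiM_cong) auto
  \<comment> \<open>Both sides are the product of the laws of the single coordinates, which is
    checked on rectangles.\<close>
  have "?M1 = PiM UNIV (\<lambda>_. P)"
  proof (rule PP.PiM_eqI)
    fix A assume "\<And>i :: 's. i \<in> UNIV \<Longrightarrow> A i \<in> sets P"
    then have A [measurable]: "A i \<in> sets borel" for i by simp
    have pre: "(\<lambda>\<Delta> j. quantile (frac (\<Delta> j + a j))) -` (PiE UNIV A) \<inter> space (LP UNIV) \<in> sets (LP UNIV)"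
      by (rule measurable_sets[OF T]) auto
    have "emeasure ?M1 (PiE UNIV A) = emeasure (density (LP UNIV) (\<lambda>\<Delta>. \<Prod>j\<in>UNIV. indicator {0..<1} (\<Delta> j)))
        ((\<lambda>\<Delta> j. quantile (frac (\<Delta> j + a j))) -` (PiE UNIV A) \<inter> space (LP UNIV))"
      by (subst emeasure_distr) (auto simp: space_density)
    also have "\<dots> = (\<integral>\<^sup>+\<Delta>. (\<Prod>j\<in>UNIV. indicator {0..<1} (\<Delta> j)) *
        indicator ((\<lambda>\<Delta> j. quantile (frac (\<Delta> j + a j))) -` (PiE UNIV A) \<inter> space (LP UNIV)) \<Delta> \<partial>LP UNIV)"
      using pre by (intro emeasure_density) auto
    also have "\<dots> = (\<integral>\<^sup>+\<Delta>. (\<Prod>j\<in>UNIV. indicator {0..<1} (\<Delta> j) * indicator (A j) (quantile (frac (\<Delta> j + a j)))) \<partial>LP UNIV)"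
    proof (intro nn_integral_cong)
      fix \<Delta> :: "'s \<Rightarrow> real"
      have "indicator ((\<lambda>\<Delta> j. quantile (frac (\<Delta> j + a j))) -` (PiE UNIV A) \<inter> space (LP UNIV)) \<Delta> =
         (\<Prod>j\<in>UNIV. indicator (A j) (quantile (frac (\<Delta> j + a j))) :: ennreal)"
        by (auto simp: indicator_def space_PiM PiE_iff prod_zero_iff intro!: prod.neutral[symmetric])
      then show "(\<Prod>j\<in>UNIV. indicator {0..<1} (\<Delta> j)) *
        indicator ((\<lambda>\<Delta> j. quantile (frac (\<Delta> j + a j))) -` (PiE UNIV A) \<inter> space (LP UNIV)) \<Delta> =
        (\<Prod>j\<in>UNIV. indicator {0..<1} (\<Delta> j) * indicator (A j) (quantile (frac (\<Delta> j + a j))) :: ennreal)"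
        by (simp only: prod.distrib)
    qed
    also have "\<dots> = (\<Prod>j\<in>UNIV. (\<integral>\<^sup>+x. indicator {0..<1} x * indicator (A j) (quantile (frac (x + a j))) \<partial>lborel))"
      by (rule LP.product_nn_integral_prod) auto
    also have "\<dots> = (\<Prod>j\<in>UNIV. emeasure P (A j))"
      by (simp only: quantile_shift_emeasure[OF A])
    finally show "emeasure ?M1 (PiE UNIV A) = (\<Prod>j\<in>UNIV. emeasure P (A j))" .
  qed (simp_all add: sets)
  moreover have "?M2 = PiM UNIV (\<lambda>_. P)"
  proof (rule PP.PiM_eqI)
    fix A assume "\<And>i :: 's. i \<in> UNIV \<Longrightarrow> A i \<in> sets P"
    then have A [measurable]: "A i \<in> sets borel" for i by simp
    have "emeasure ?M2 (PiE UNIV A) = (\<integral>\<^sup>+y. (\<Prod>j\<in>UNIV. ennreal (\<phi> (y j))) * indicator (PiE UNIV A) y \<partial>LP UNIV)"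
      by (rule emeasure_density) auto
    also have "\<dots> = (\<integral>\<^sup>+y. (\<Prod>j\<in>UNIV. ennreal (\<phi> (y j)) * indicator (A j) (y j)) \<partial>LP UNIV)"
    proof (intro nn_integral_cong)
      fix y :: "'s \<Rightarrow> real"
      have "indicator (PiE UNIV A) y = (\<Prod>j\<in>UNIV. indicator (A j) (y j) :: ennreal)"
        by (auto simp: indicator_def PiE_iff prod_zero_iff intro!: prod.neutral[symmetric])
      then show "(\<Prod>j\<in>UNIV. ennreal (\<phi> (y j))) * indicator (PiE UNIV A) y = (\<Prod>j\<in>UNIV. ennreal (\<phi> (y j)) * indicator (A j) (y j))"
        by (simp only: prod.distrib)
    qed
    also have "\<dots> = (\<Prod>j\<in>UNIV. (\<integral>\<^sup>+x. ennreal (\<phi> x) * indicator (A j) x \<partial>lborel))"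
      by (rule LP.product_nn_integral_prod) auto
    also have "\<dots> = (\<Prod>j\<in>UNIV. emeasure P (A j))"
      by (intro prod.cong refl emeasure_density[symmetric]) auto
    finally show "emeasure ?M2 (PiE UNIV A) = (\<Prod>j\<in>UNIV. emeasure P (A j))" .
  qed (simp_all add: sets)
  ultimately show ?thesis by simp
qed

lemma AE_quantile_shift:
  fixes a :: "'s \<Rightarrow> real"
  assumes "AE y in LP UNIV. Q y"
  shows "AE \<Delta> in LP UNIV. (\<forall>j. \<Delta> j \<in> {0..<1}) \<longrightarrow> Q (\<lambda>j. quantile (frac (\<Delta> j + a j)))"
proof -
  have [measurable]: "(\<lambda>x::real. frac (x + b)) \<in> borel_measurable borel" for b
    unfolding frac_def by measurable
  have T: "(\<lambda>\<Delta> j. quantile (frac (\<Delta> j + a j))) \<in> LP UNIV \<rightarrow>\<^sub>M LP UNIV"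
    by (rule measurable_abs_UNIV) measurable
  have "AE y in density (LP UNIV) (\<lambda>y. \<Prod>j\<in>UNIV. ennreal (\<phi> (y j))). Q y"
    using assms by (subst AE_density) (auto elim!: eventually_mono)
  then have "AE y in distr (density (LP UNIV) (\<lambda>\<Delta>. \<Prod>j\<in>UNIV. indicator {0..<1} (\<Delta> j))) (LP UNIV) (\<lambda>\<Delta> j. quantile (frac (\<Delta> j + a j))). Q y"
    by (subst quantile_vec_distr)
  then have "AE \<Delta> in density (LP UNIV) (\<lambda>\<Delta>. \<Prod>j\<in>UNIV. indicator {0..<1} (\<Delta> j)). Q (\<lambda>j. quantile (frac (\<Delta> j + a j)))"
    by (rule AE_distrD[rotated]) (use T in \<open>simp cong: measurable_cong_sets\<close>)
  then show ?thesis
    by (subst (asm) AE_density) (auto elim!: eventually_mono simp: indicator_def)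
qed

section \<open>The error of a shifted lattice rule on the unit ball\<close>

lemma anova_inner_integral:
  assumes "f \<in> sobolev_space \<phi> \<gamma> \<psi>" "\<And>u. \<gamma> u > 0"
  shows "anova \<phi> \<psi> (inner_integral \<phi> f)"
  using assms
  by unfold_locales
     (auto intro: inner_integral_meas inner_integral_cong sobolev_term_finite[simplified])

text \<open>Cauchy-Schwarz in the form 2|xv| <= c x^2 + v^2/c under the integral. The two square
  integrals are at most \<open>\<gamma> u\<close> and t^2 / \<open>\<gamma> u\<close>; taking c = t
  / \<open>\<gamma> u\<close> balances them, and each half contributes t/2.\<close>

lemma integral_avg_saw_bound:
  assumes f: "f \<in> sobolev_space \<phi> \<gamma> \<psi>" "sobolev_norm \<phi> \<gamma> \<psi> f \<le> 1" and pos: "\<And>u. \<gamma> u > 0"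
    and t: "t > 0" and small: "shift_error N z u \<Delta> < ennreal (t\<^sup>2 / \<gamma> u)"
  shows "\<bar>LINT y|LP u. inner_integral \<phi> f u y * avg_saw N z u (\<lambda>j. dist_fun \<phi> (y j)) \<Delta>\<bar> \<le> t"
proof -
  let ?F = "inner_integral \<phi> f u"
  let ?a = "\<lambda>y. avg_saw N z u (\<lambda>j. dist_fun \<phi> (y j)) \<Delta>"
  let ?A = "\<lambda>y. (?F y)\<^sup>2 * (\<Prod>j\<in>u. (\<psi> j (y j))\<^sup>2)"
  let ?B = "\<lambda>y. (?a y)\<^sup>2 * (\<Prod>j\<in>u. 1 / (\<psi> j (y j))\<^sup>2)"
  interpret anova \<phi> \<psi> "inner_integral \<phi> f"
    by (rule anova_inner_integral[OF f(1) pos])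
  have Fm [measurable]: "?F \<in> borel_measurable (LP u)" by (rule F_LP_meas)
  have am [measurable]: "?a \<in> borel_measurable (LP u)"
    using measurable_compose[OF measurable_Pair1'[of \<Delta> "LP UNIV" "LP u"] avg_saw_pair_meas[of N z u]]
    by (simp add: space_PiM)
  have A0: "0 \<le> ?A y" and B0: "0 \<le> ?B y" for y
    by (auto intro!: mult_nonneg_nonneg prod_nonneg)
  have Ale: "(\<integral>\<^sup>+y. ennreal (?A y) \<partial>LP u) \<le> ennreal (\<gamma> u)"
    using f pos by (intro sobolev_term_le) auto
  have Aint: "integrable (LP u) ?A"
    using A0 le_less_trans[OF Ale ennreal_less_top] by (intro integrableI_nonneg) auto
  have Bint: "integrable (LP u) ?B"
    using B0 less_trans[OF small ennreal_less_top] unfolding shift_error_def by (intro integrableI_nonneg) auto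
  have Aval: "integral\<^sup>L (LP u) ?A \<le> \<gamma> u"
    using Ale pos[of u] A0 by (subst (asm) nn_integral_eq_integral[OF Aint]) (auto simp: ennreal_le_iff less_imp_le)
  have Bval: "integral\<^sup>L (LP u) ?B \<le> t\<^sup>2 / \<gamma> u"
    using small pos[of u] B0 unfolding shift_error_def
    by (subst (asm) nn_integral_eq_integral[OF Bint]) (auto simp: ennreal_less_iff integral_nonneg)
  let ?k = "t / \<gamma> u"
  have k: "?k > 0" using t pos[of u] by simp
  have bound: "\<bar>?F y * ?a y\<bar> \<le> 1 / 2 * (?k * ?A y) + 1 / 2 * (?B y / ?k)" for y
  proof -
    let ?w = "\<Prod>j\<in>u. \<psi> j (y j)"
    have w: "?w > 0" by (intro prod_pos) (simp add: psi_pos)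
    have A: "?A y = (?F y * ?w)\<^sup>2" by (simp add: power_mult_distrib prod_power_distrib)
    have B: "?B y = (?a y / ?w)\<^sup>2" by (simp add: power_divide prod_dividef prod_power_distrib)
    have "2 * \<bar>x * v\<bar> \<le> c * x\<^sup>2 + v\<^sup>2 / c" if "c > 0" for x v c :: real
    proof -
      have "(c * \<bar>x\<bar> - \<bar>v\<bar>)\<^sup>2 = c * (c * \<bar>x\<bar>\<^sup>2) - 2 * (c * \<bar>x * v\<bar>) + \<bar>v\<bar>\<^sup>2"
        by (simp only: abs_mult power2_eq_square) algebra
      then have "2 * (c * \<bar>x * v\<bar>) \<le> c * (c * x\<^sup>2) + v\<^sup>2"
        using zero_le_power2[of "c * \<bar>x\<bar> - \<bar>v\<bar>"] by (simp only: power2_abs)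
      then have "c * (2 * \<bar>x * v\<bar>) \<le> c * (c * x\<^sup>2 + v\<^sup>2 / c)"
        using that by (simp add: distrib_left)
      then show ?thesis using that by (simp only: mult_le_cancel_left_pos)
    qed
    from this[OF k, of "?F y * ?w" "?a y / ?w"] w
    have "2 * \<bar>?F y * ?a y\<bar> \<le> ?k * ?A y + ?B y / ?k"
      unfolding A B by (simp del: prod_zero_iff)
    then show ?thesis by (simp only: flip: distrib_left) simp
  qed
  have gint: "integrable (LP u) (\<lambda>y. 1 / 2 * (?k * ?A y) + 1 / 2 * (?B y / ?k))"
    by (intro Bochner_Integration.integrable_add integrable_mult_right integrable_divide Aint Bint)
  have fint: "integrable (LP u) (\<lambda>y. ?F y * ?a y)"
  proof (rule Bochner_Integration.integrable_bound[OF gint])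
    show "AE y in LP u. norm (?F y * ?a y) \<le> norm (1 / 2 * (?k * ?A y) + 1 / 2 * (?B y / ?k))"
      using bound by (intro AE_I2) (simp only: real_norm_def, rule order_trans[OF _ abs_ge_self])
  qed measurable
  have "\<bar>LINT y|LP u. ?F y * ?a y\<bar> \<le> (LINT y|LP u. 1 / 2 * (?k * ?A y) + 1 / 2 * (?B y / ?k))"
    using bound by (intro order_trans[OF integral_abs_bound] integral_mono integrable_abs fint gint)
  also have "\<dots> = 1 / 2 * (?k * integral\<^sup>L (LP u) ?A) + 1 / 2 * (integral\<^sup>L (LP u) ?B / ?k)"
    by (subst Bochner_Integration.integral_add)
       (simp_all only: integral_mult_right_zero integral_divide_zero Aint Bint integrable_mult_right integrable_divide)
  also have "\<dots> \<le> 1 / 2 * (?k * \<gamma> u) + 1 / 2 * (t\<^sup>2 / \<gamma> u / ?k)"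
    using Aval Bval k by (intro add_mono mult_left_mono divide_right_mono) auto
  also have "\<dots> = t"
    using t pos[of u] by (simp add: field_simps power2_eq_square)
  finally show ?thesis .
qed

text \<open>The term of the representation for the empty set is reproduced exactly, since an empty
  kernel product averages to 1. Each of the 2^s - 1 other terms is at most t/2^s, which leaves room
  for a strict inequality.\<close>

proposition lattice_error_AE:
  fixes z :: "'s \<Rightarrow> nat"
  assumes f: "f \<in> sobolev_space \<phi> \<gamma> \<psi>" "sobolev_norm \<phi> \<gamma> \<psi> f \<le> 1" and pos: "\<And>u. \<gamma> u > 0"
    and N: "N \<ge> 1" and t: "t > 0"
  shows "AE \<Delta> in LP UNIV. (\<forall>j. \<Delta> j \<in> {0..<1}) \<longrightarrow>
     (\<forall>u. u \<noteq> {} \<longrightarrow> shift_error N z u \<Delta> < ennreal ((t / 2 ^ CARD('s))\<^sup>2 / \<gamma> u)) \<longrightarrow>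
     \<bar>lattice_rule \<phi> f N (vec_lambda z) (vec_lambda \<Delta>) - weighted_integral \<phi> f\<bar> < t"
proof -
  interpret anova \<phi> \<psi> "inner_integral \<phi> f"
    by (rule anova_inner_integral[OF f(1) pos])
  let ?F = "inner_integral \<phi> f"
  define x where "x n j = real n * real (z j) / real N" for n j
  \<comment> \<open>The exceptional sets of the finitely many lattice points may be united.\<close>
  have "AE \<Delta> in LP UNIV. \<forall>n\<in>{1..N}. \<forall>j\<in>UNIV. 0 < frac (\<Delta> j + x n j)"
    by (intro AE_finite_allI AE_LP_component AE_frac_pos) auto
  moreover have "AE \<Delta> in LP UNIV. \<forall>n\<in>{1..N}. (\<forall>j. \<Delta> j \<in> {0..<1}) \<longrightarrow>
      f (vec_lambda (\<lambda>j. quantile (frac (\<Delta> j + x n j)))) =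
      (\<Sum>u\<in>UNIV. LINT y|LP u. ?F u y * (\<Prod>i\<in>u. ker (quantile (frac (\<Delta> i + x n i))) (y i)))"
    by (intro AE_finite_allI AE_quantile_shift[OF sobolev_representation(1)[OF f(1) pos]]) auto
  ultimately show ?thesis
  proof (eventually_elim, intro impI)
    fix \<Delta>
    assume pos_frac: "\<forall>n\<in>{1..N}. \<forall>j\<in>UNIV. 0 < frac (\<Delta> j + x n j)"
      and rep: "\<forall>n\<in>{1..N}. (\<forall>j. \<Delta> j \<in> {0..<1}) \<longrightarrow>
        f (vec_lambda (\<lambda>j. quantile (frac (\<Delta> j + x n j)))) =
        (\<Sum>u\<in>UNIV. LINT y|LP u. ?F u y * (\<Prod>i\<in>u. ker (quantile (frac (\<Delta> i + x n i))) (y i)))"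
      and cube: "\<forall>j. \<Delta> j \<in> {0..<1}"
      and sm: "\<forall>u. u \<noteq> {} \<longrightarrow> shift_error N z u \<Delta> < ennreal ((t / 2 ^ CARD('s))\<^sup>2 / \<gamma> u)"
    have small: "shift_error N z u \<Delta> < ennreal ((t / 2 ^ CARD('s))\<^sup>2 / \<gamma> u)" if "u \<noteq> {}" for u
      using that sm by blast
    define q where "q n j = quantile (frac (\<Delta> j + x n j))" for n j
    have pt: "f (\<chi> j. dist_inv \<phi> (frac (real n * real (vec_lambda z $ j) / real N + vec_lambda \<Delta> $ j))) =
        (\<Sum>u\<in>UNIV. LINT y|LP u. ?F u y * (\<Prod>i\<in>u. ker (q n i) (y i)))" if "n \<in> {1..N}" for n
    proof -
      have "dist_inv \<phi> (frac (real n * real (z j) / real N + \<Delta> j)) = q n j" for j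
        using pos_frac that frac_lt_1[of "\<Delta> j + x n j"] unfolding q_def quantile_def x_def by (auto simp: add.commute)
      then show ?thesis
        using rep cube that by (simp add: q_def[symmetric])
    qed
    have int: "integrable (LP u) (\<lambda>y. ?F u y * (\<Prod>i\<in>u. ker (q n i) (y i)))" for n u
    proof (rule product_weight_integrable[where \<psi>=\<psi>])
      show "(\<integral>\<^sup>+y. ennreal ((ker (q n i) y)\<^sup>2 / (\<psi> i y)\<^sup>2) \<partial>lborel) < \<infinity>" for i
        by (rule ker_L2)
    qed (auto simp: psi_pos F_LP_meas F_L2[simplified])
    have avg: "1 / real N * (\<Sum>n=1..N. \<Prod>i\<in>u. ker (q n i) (y i)) = avg_saw N z u (\<lambda>j. dist_fun \<phi> (y j)) \<Delta>" for u y
    proof -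
      have "(\<Sum>n=1..N. \<Prod>i\<in>u. ker (q n i) (y i)) = (\<Sum>n=1..N. \<Prod>i\<in>u. saw (dist_fun \<phi> (y i)) (x n i + \<Delta> i))"
        using pos_frac by (intro sum.cong prod.cong refl) (simp add: q_def ker_quantile add.commute)
      then show ?thesis by (simp add: avg_saw_def x_def)
    qed
    have "lattice_rule \<phi> f N (vec_lambda z) (vec_lambda \<Delta>) =
       1 / real N * (\<Sum>n=1..N. \<Sum>u\<in>UNIV. LINT y|LP u. ?F u y * (\<Prod>i\<in>u. ker (q n i) (y i)))"
      unfolding lattice_rule_def by (intro arg_cong2[where f="(*)"] sum.cong refl pt)
    also have "\<dots> = (\<Sum>u\<in>UNIV. 1 / real N * (\<Sum>n=1..N. LINT y|LP u. ?F u y * (\<Prod>i\<in>u. ker (q n i) (y i))))"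
      by (subst sum.swap) (rule sum_distrib_left)
    also have "\<dots> = (\<Sum>u\<in>UNIV. LINT y|LP u. ?F u y * avg_saw N z u (\<lambda>j. dist_fun \<phi> (y j)) \<Delta>)"
    proof (intro sum.cong refl)
      fix u
      have "1 / real N * (\<Sum>n=1..N. LINT y|LP u. ?F u y * (\<Prod>i\<in>u. ker (q n i) (y i))) =
         (LINT y|LP u. 1 / real N * (\<Sum>n=1..N. ?F u y * (\<Prod>i\<in>u. ker (q n i) (y i))))"
        by (subst integral_mult_right_zero, subst Bochner_Integration.integral_sum) (rule int, rule refl)
      also have "\<dots> = (LINT y|LP u. ?F u y * avg_saw N z u (\<lambda>j. dist_fun \<phi> (y j)) \<Delta>)"
        unfolding avg[symmetric] sum_distrib_left[symmetric] by (simp add: mult_ac)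
      finally show "1 / real N * (\<Sum>n=1..N. LINT y|LP u. ?F u y * (\<Prod>i\<in>u. ker (q n i) (y i))) =
         (LINT y|LP u. ?F u y * avg_saw N z u (\<lambda>j. dist_fun \<phi> (y j)) \<Delta>)" .
    qed
    also have "\<dots> = (LINT y|LP {}. ?F {} y * avg_saw N z {} (\<lambda>j. dist_fun \<phi> (y j)) \<Delta>) +
       (\<Sum>u\<in>UNIV - {{}}. LINT y|LP u. ?F u y * avg_saw N z u (\<lambda>j. dist_fun \<phi> (y j)) \<Delta>)"
      by (rule sum.remove) auto
    also have "(LINT y|LP {}. ?F {} y * avg_saw N z {} (\<lambda>j. dist_fun \<phi> (y j)) \<Delta>) = weighted_integral \<phi> f"
      using N sobolev_representation(2)[OF f(1) pos]
      by (simp add: PiM_empty lebesgue_integral_count_space_finite avg_saw_def)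
    finally have "\<bar>lattice_rule \<phi> f N (vec_lambda z) (vec_lambda \<Delta>) - weighted_integral \<phi> f\<bar> =
      \<bar>\<Sum>u\<in>UNIV - {{}}. LINT y|LP u. ?F u y * avg_saw N z u (\<lambda>j. dist_fun \<phi> (y j)) \<Delta>\<bar>"
      by simp
    also have "\<dots> \<le> (\<Sum>u\<in>UNIV - {{} :: 's set}. t / 2 ^ CARD('s))"
      using t small by (intro order_trans[OF sum_abs] sum_mono integral_avg_saw_bound[OF f pos]) auto
    also have "\<dots> = (2 ^ CARD('s) - 1) * (t / 2 ^ CARD('s))"
    proof -
      have "card (UNIV - {{}} :: 's set set) = 2 ^ CARD('s) - 1"
        using card_Pow[of "UNIV :: 's set"] by (simp add: card_Diff_singleton)
      then show ?thesis by (simp add: of_nat_diff)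
    qed
    also have "\<dots> < t"
      using t by (simp add: field_simps)
    finally show "\<bar>lattice_rule \<phi> f N (vec_lambda z) (vec_lambda \<Delta>) - weighted_integral \<phi> f\<bar> < t" .
  qed
qed

end

section \<open>The median of independent samples\<close>

text \<open>If the median is at least a, all entries ranked after it deviate at least as much,
  otherwise all entries ranked before it. Including the median, either side has (k + 1)/2
  entries.\<close>

lemma median_error_count:
  fixes x :: "nat \<Rightarrow> real"
  assumes k: "odd k" and dev: "t \<le> \<bar>median (map x [1..<k+1]) - a\<bar>"
  shows "(k + 1) div 2 \<le> card {l \<in> {1..k}. t \<le> \<bar>x l - a\<bar>}"
proof -
  let ?m = "k div 2"
  define ys where "ys = sort (map x [1..<k+1])"
  have len: "length ys = k" by (simp add: ys_def)
  have m: "?m < k" using k by (auto elim: oddE)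
  have med: "median (map x [1..<k+1]) = ys ! ?m"
    by (simp add: median_def ys_def)
  have srt: "sorted ys" by (simp add: ys_def)
  have "card {i. i < length ys \<and> t \<le> \<bar>ys ! i - a\<bar>} = length (filter (\<lambda>y. t \<le> \<bar>y - a\<bar>) ys)"
    by (rule length_filter_conv_card[symmetric])
  also have "\<dots> = size (filter_mset (\<lambda>y. t \<le> \<bar>y - a\<bar>) (mset ys))"
    by (simp flip: mset_filter)
  also have "\<dots> = size (filter_mset (\<lambda>y. t \<le> \<bar>y - a\<bar>) (mset (map x [1..<k+1])))"
    by (simp only: ys_def mset_sort)
  also have "\<dots> = length (filter (\<lambda>l. t \<le> \<bar>x l - a\<bar>) [1..<k+1])"
    by (simp only: mset_filter[symmetric] size_mset filter_map length_map comp_def)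
  also have "\<dots> = card (set (filter (\<lambda>l. t \<le> \<bar>x l - a\<bar>) [1..<k+1]))"
    by (rule distinct_card[symmetric]) simp
  also have "set (filter (\<lambda>l. t \<le> \<bar>x l - a\<bar>) [1..<k+1]) = {l \<in> {1..k}. t \<le> \<bar>x l - a\<bar>}"
    by auto
  finally have cards: "card {i. i < k \<and> t \<le> \<bar>ys ! i - a\<bar>} = card {l \<in> {1..k}. t \<le> \<bar>x l - a\<bar>}"
    by (simp only: len)
  have "(k + 1) div 2 \<le> card {i. i < k \<and> t \<le> \<bar>ys ! i - a\<bar>}"
  proof (cases "a \<le> ys ! ?m")
    case True
    have "{?m..<k} \<subseteq> {i. i < k \<and> t \<le> \<bar>ys ! i - a\<bar>}"
    proof
      fix i assume i: "i \<in> {?m..<k}"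
      have "ys ! ?m \<le> ys ! i" using i srt len by (intro sorted_nth_mono) auto
      then show "i \<in> {i. i < k \<and> t \<le> \<bar>ys ! i - a\<bar>}"
        using i dev True unfolding med by simp
    qed
    then have "card {?m..<k} \<le> card {i. i < k \<and> t \<le> \<bar>ys ! i - a\<bar>}"
      by (intro card_mono) auto
    then show ?thesis using k by (auto elim!: oddE)
  next
    case False
    have "{..?m} \<subseteq> {i. i < k \<and> t \<le> \<bar>ys ! i - a\<bar>}"
    proof
      fix i assume i: "i \<in> {..?m}"
      have "ys ! i \<le> ys ! ?m" using i srt len m by (intro sorted_nth_mono) auto
      then show "i \<in> {i. i < k \<and> t \<le> \<bar>ys ! i - a\<bar>}"
        using i m dev False unfolding med by simp
    qed
    then have "card {..?m} \<le> card {i. i < k \<and> t \<le> \<bar>ys ! i - a\<bar>}"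
      by (intro card_mono) auto
    then show ?thesis using k by (auto elim!: oddE)
  qed
  then show ?thesis by (simp only: cards)
qed

text \<open>Union bound over the sets J of m samples that are all bad, each of probability at most
  p^m by independence. \<open>A\<close> is compared with a finite union of measurable rectangles, so
  nothing beyond the count of bad samples has to be known about it.\<close>

lemma prob_many_components_le:
  fixes M :: "'a measure" and I :: "nat set"
  assumes M: "prob_space M" and B: "B \<in> sets M" and p: "measure M B \<le> p" and I: "finite I"
    and A: "\<And>\<omega>. \<omega> \<in> A \<Longrightarrow> \<omega> \<in> space (PiM I (\<lambda>_. M)) \<and> m \<le> card {l \<in> I. \<omega> l \<in> B}"
  shows "measure (PiM I (\<lambda>_. M)) A \<le> real (card I choose m) * p ^ m"
proof -
  interpret M: prob_space M by (rule M)
  interpret finite_product_prob_space "\<lambda>_. M" I by standard (rule I)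
  let ?P = "PiM I (\<lambda>_. M)"
  let ?B = "\<lambda>J. PiE I (\<lambda>l. if l \<in> J then B else space M)"
  have meas: "?B J \<in> sets ?P" for J
    using B by (intro sets_PiM_I_finite I) auto
  have pB: "measure ?P (?B J) \<le> p ^ m" if J: "J \<in> {J. J \<subseteq> I \<and> card J = m}" for J
  proof -
    have "measure ?P (?B J) = (\<Prod>l\<in>I. measure M (if l \<in> J then B else space M))"
      using B by (intro prob_times) auto
    also have "\<dots> = (\<Prod>l\<in>I. if l \<in> J then measure M B else 1)"
      by (intro prod.cong refl) (simp add: M.prob_space)
    also have "\<dots> = measure M B ^ m"
      using J I by (subst prod.inter_restrict[symmetric]) (auto simp: Int_absorb1)
    also have "\<dots> \<le> p ^ m" by (intro power_mono p) simp
    finally show ?thesis .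
  qed
  have sub: "A \<subseteq> (\<Union>J\<in>{J. J \<subseteq> I \<and> card J = m}. ?B J)"
  proof
    fix \<omega> assume "\<omega> \<in> A"
    then have w: "\<omega> \<in> space ?P" "m \<le> card {l \<in> I. \<omega> l \<in> B}" using A by auto
    then obtain J where J: "J \<subseteq> {l \<in> I. \<omega> l \<in> B}" "card J = m"
      using obtain_subset_with_card_n by metis
    then have "\<omega> \<in> ?B J"
      using w(1) by (auto simp: space_PiM PiE_iff)
    with J show "\<omega> \<in> (\<Union>J\<in>{J. J \<subseteq> I \<and> card J = m}. ?B J)" by auto
  qed
  have fin: "finite {J. J \<subseteq> I \<and> card J = m}" using I by simp
  have "measure ?P A \<le> measure ?P (\<Union>J\<in>{J. J \<subseteq> I \<and> card J = m}. ?B J)"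
    using fin meas by (intro finite_measure_mono sub) auto
  also have "\<dots> \<le> (\<Sum>J\<in>{J. J \<subseteq> I \<and> card J = m}. measure ?P (?B J))"
    using fin meas by (intro measure_UNION_le)
  also have "\<dots> \<le> (\<Sum>J\<in>{J. J \<subseteq> I \<and> card J = m}. p ^ m)"
    by (intro sum_mono pB)
  also have "\<dots> = real (card I choose m) * p ^ m"
    using n_subsets[OF I, of m] by simp
  finally show ?thesis .
qed

text \<open>The two middle coefficients of an odd row are equal, and together they are at most the
  row sum 2^(2m+1).\<close>

lemma middle_binomial_le: "Suc (2 * m) choose Suc m \<le> 4 ^ m"
proof -
  have "2 * (Suc (2 * m) choose Suc m) = (\<Sum>i\<in>{m, Suc m}. Suc (2 * m) choose i)"
    using binomial_symmetric[of m "Suc (2 * m)"] by simp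
  also have "\<dots> \<le> (\<Sum>i\<le>Suc (2 * m). Suc (2 * m) choose i)"
    by (intro sum_mono2) auto
  also have "\<dots> = 2 * 4 ^ m"
    by (simp only: choose_row_sum power_Suc power_mult) simp
  finally show ?thesis by simp
qed

text \<open>The exceptional set lies in a countable union of null slices, one for each value of the
  discrete component.\<close>

lemma AE_pair_countable:
  fixes p :: "'a::countable pmf"
  assumes M: "sigma_finite_measure M" and AE: "\<And>z. AE x in M. Q z x"
  shows "AE (z, x) in measure_pmf p \<Otimes>\<^sub>M M. Q z x"
proof -
  interpret sigma_finite_measure M by (rule M)
  have "\<exists>E. E \<in> null_sets M \<and> {x \<in> space M. \<not> Q z x} \<subseteq> E" for z
    using AE[of z] by (auto simp: eventually_ae_filter)
  then obtain E where E: "\<And>z. E z \<in> null_sets M" "\<And>z. {x \<in> space M. \<not> Q z x} \<subseteq> E z"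
    by metis
  have "(\<Union>z. {z} \<times> E z) \<in> null_sets (measure_pmf p \<Otimes>\<^sub>M M)"
    by (intro null_sets_UN times_in_null_sets2 E) auto
  moreover have "{x \<in> space (measure_pmf p \<Otimes>\<^sub>M M). \<not> (case x of (z, x) \<Rightarrow> Q z x)} \<subseteq> (\<Union>z. {z} \<times> E z)"
    using E(2) by (auto simp: space_pair_measure)
  ultimately show ?thesis by (rule AE_I')
qed

abbreviation unit_cube :: "(real ^ 's::finite) set" where
  "unit_cube \<equiv> {x. \<forall>j. x $ j \<in> {0..1}}"

lemma unit_cube_eq: "unit_cube = cbox 0 1"
  by (auto simp: mem_box_cart)

lemma unit_cube_sets [measurable]: "unit_cube \<in> sets lborel"
  unfolding unit_cube_eq by simp

lemma emeasure_unit_cube: "emeasure lborel (unit_cube :: (real^'s::finite) set) = 1"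
proof -
  have "(1 :: real^'s) \<bullet> b = 1" if "b \<in> Basis" for b
    using that by (auto simp: Basis_vec_def inner_axis)
  moreover have "(0 :: real^'s) \<bullet> b \<le> 1 \<bullet> b" if "b \<in> Basis" for b
    using that by (auto simp: Basis_vec_def inner_axis)
  ultimately show ?thesis
    unfolding unit_cube_eq by (subst emeasure_lborel_cbox) auto
qed

lemma prob_space_uniform_cube: "prob_space (uniform_measure lborel (unit_cube :: (real^'s::finite) set))"
  by (rule prob_space_uniform_measure) (simp_all only: emeasure_unit_cube, simp_all)

text \<open>Samples are drawn from the closed cube, whereas the integrals over shifts use the
  half-open one.\<close>

lemma AE_component_less_one:
  "AE x in (lborel :: (real^'s::finite) measure). x \<in> unit_cube \<longrightarrow> (\<forall>j. x $ j \<in> {0..<1})"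
proof -
  have "AE y in LP (UNIV :: 's set). \<forall>j\<in>UNIV. y j \<noteq> 1"
    by (intro AE_finite_allI AE_LP_component AE_lborel_singleton) auto
  from AE_vec_nth[OF this] show ?thesis
    by eventually_elim (auto simp: less_le)
qed

lemma nn_integral_uniform_cube:
  fixes f :: "('s::finite \<Rightarrow> real) \<Rightarrow> ennreal"
  assumes f [measurable]: "f \<in> borel_measurable (LP UNIV)"
  shows "(\<integral>\<^sup>+x. f (vec_nth x) \<partial>uniform_measure lborel unit_cube) =
     (\<integral>\<^sup>+\<Delta>. (\<Prod>j\<in>UNIV. indicator {0..<1} (\<Delta> j)) * f \<Delta> \<partial>LP UNIV)"
proof -
  have "(\<integral>\<^sup>+x. f (vec_nth x) \<partial>uniform_measure lborel unit_cube) =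
     (\<integral>\<^sup>+x. f (vec_nth x) * indicator unit_cube x \<partial>lborel)"
    by (subst nn_integral_uniform_measure) (simp_all only: emeasure_unit_cube, simp_all add: divide_ennreal_def)
  also have "\<dots> = (\<integral>\<^sup>+x. (\<Prod>j\<in>UNIV. indicator {0..<1} (vec_nth x j)) * f (vec_nth x) \<partial>(lborel :: (real^'s) measure))"
  proof (intro nn_integral_cong_AE)
    show "AE x in (lborel :: (real^'s) measure). f (vec_nth x) * indicator unit_cube x =
        (\<Prod>j\<in>UNIV. indicator {0..<1} (vec_nth x j)) * f (vec_nth x)"
      using AE_component_less_one
    proof eventually_elim
      case (elim x)
      show ?case
      proof (cases "\<forall>j. x $ j \<in> {0..<1}")
        case True
        then have "x \<in> unit_cube" by (auto simp: less_imp_le)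
        with True show ?thesis by simp
      next
        case False
        then obtain j where j: "x $ j \<notin> {0..<1}" by blast
        have "x \<notin> unit_cube" using elim False by blast
        moreover have "(\<Prod>j\<in>UNIV. indicator {0..<1} (x $ j) :: ennreal) = 0"
          using j by (intro prod_zero bexI[of _ j]) simp_all
        ultimately show ?thesis by simp
      qed
    qed
  qed
  also have "\<dots> = (\<integral>\<^sup>+\<Delta>. (\<Prod>j\<in>UNIV. indicator {0..<1} (\<Delta> j)) * f \<Delta> \<partial>distr (lborel :: (real^'s) measure) (LP UNIV) vec_nth)"
    by (subst nn_integral_distr) auto
  finally show ?thesis by (simp only: LP_UNIV_vec[symmetric])
qed

section \<open>The failure probability of one sample\<close>

context weighted_setting
begin

text \<open>Trades the decay |h|^(-2r) for the weaker |h|^(-2rq) at the price of the power 1/q of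
  the series.\<close>

lemma mean_shift_error_le:
  assumes N: "N \<ge> 1" and q: "0 < q" "q \<le> 1"
    and C: "\<And>j. C j > 0" "\<And>j h. h \<noteq> 0 \<Longrightarrow> theta_hat \<phi> \<psi> j h \<le> C j * \<bar>of_int h\<bar> powr (- 2 * r)"
    and s: "0 \<le> s" "dual_sum (2 * r * q) N z u \<le> ennreal s"
  shows "(\<integral>\<^sup>+\<Delta>. (\<Prod>j\<in>UNIV. indicator {0..<1} (\<Delta> j)) * shift_error N z u \<Delta> \<partial>LP UNIV)
     \<le> ennreal ((\<Prod>j\<in>u. C j) * s powr (1 / q))"
proof -
  let ?H = "PiE u (\<lambda>_. UNIV - {0 :: int})"
  let ?d = "\<lambda>h. int N dvd (\<Sum>j\<in>u. h j * int (z j))"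
  let ?g = "\<lambda>h. of_bool (?d h) * (\<Prod>i\<in>u. \<bar>of_int (h i)\<bar> powr (- 2 * r)) :: real"
  have g0: "0 \<le> ?g h" for h
    by (intro mult_nonneg_nonneg prod_nonneg) auto
  have C0: "0 \<le> (\<Prod>j\<in>u. C j)" using C(1) by (intro prod_nonneg) (simp add: less_imp_le)
  have "(\<integral>\<^sup>+h. ennreal (?g h powr q) \<partial>count_space ?H) = dual_sum (2 * r * q) N z u"
    unfolding dual_sum_def
  proof (intro nn_integral_cong)
    fix h
    have "(\<Prod>i\<in>u. \<bar>of_int (h i)\<bar> powr (- 2 * r)) powr q = (\<Prod>i\<in>u. \<bar>of_int (h i)\<bar> powr - (2 * r * q) :: real)"
      by (subst prod_powr_distrib) (simp_all add: powr_powr)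
    then show "ennreal (?g h powr q) = of_bool (?d h) * ennreal (\<Prod>i\<in>u. \<bar>of_int (h i)\<bar> powr - (2 * r * q))"
      by simp
  qed
  with s have gs: "(\<integral>\<^sup>+h. ennreal (?g h) \<partial>count_space ?H) \<le> ennreal (s powr (1 / q))"
    by (intro nn_integral_powr_le q g0) auto
  have "(\<integral>\<^sup>+\<Delta>. (\<Prod>j\<in>UNIV. indicator {0..<1} (\<Delta> j)) * shift_error N z u \<Delta> \<partial>LP UNIV) =
      (\<integral>\<^sup>+h. of_bool (?d h) * (\<Prod>j\<in>u. ennreal (theta_hat \<phi> \<psi> j (h j))) \<partial>count_space ?H)"
    by (rule mean_shift_error[OF N])
  also have "\<dots> \<le> (\<integral>\<^sup>+h. ennreal (\<Prod>j\<in>u. C j) * ennreal (?g h) \<partial>count_space ?H)"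
  proof (intro nn_integral_mono)
    fix h assume "h \<in> space (count_space ?H)"
    then have h: "h j \<noteq> 0" if "j \<in> u" for j using that by (auto simp: PiE_iff)
    have "(\<Prod>j\<in>u. ennreal (theta_hat \<phi> \<psi> j (h j))) = ennreal (\<Prod>j\<in>u. theta_hat \<phi> \<psi> j (h j))"
      by (intro prod_ennreal theta_hat_nonneg)
    also have "\<dots> \<le> ennreal (\<Prod>j\<in>u. C j * \<bar>of_int (h j)\<bar> powr (- 2 * r))"
      using C(2) h theta_hat_nonneg by (intro ennreal_leI prod_mono) auto
    finally show "of_bool (?d h) * (\<Prod>j\<in>u. ennreal (theta_hat \<phi> \<psi> j (h j))) \<le> ennreal (\<Prod>j\<in>u. C j) * ennreal (?g h)"
      using C0 g0[of h] by (simp add: prod.distrib flip: ennreal_mult)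
  qed
  also have "\<dots> = ennreal (\<Prod>j\<in>u. C j) * (\<integral>\<^sup>+h. ennreal (?g h) \<partial>count_space ?H)"
    by (rule nn_integral_cmult) simp
  also have "\<dots> \<le> ennreal (\<Prod>j\<in>u. C j) * ennreal (s powr (1 / q))"
    by (intro mult_left_mono gs) simp
  finally show ?thesis using C0 by (simp add: ennreal_mult)
qed

lemma shift_error_set [measurable]:
  "{x. T \<le> shift_error N z u (vec_nth x)} \<in> sets lborel"
proof -
  have "(\<lambda>x. shift_error N z u (vec_nth x)) \<in> borel_measurable (lborel :: (real^'s) measure)"
    by measurable
  then have "{x \<in> space lborel. T \<le> shift_error N z u (vec_nth x)} \<in> sets lborel"
    by measurable
  then show ?thesis by simp
qed

text \<open>Markov's inequality gives p <= (C/T) s^(1/q) for the probability p and the dual series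
  s. As p <= 1, also p <= p^q, and the power q makes the bound linear in s. In this form it can be
  averaged over the generators by \<open>mean_dual_sum\<close>.\<close>

lemma shift_error_tail:
  fixes T :: real
  assumes N: "N \<ge> 1" and q: "0 < q" "q \<le> 1" and T: "T > 0"
    and C: "\<And>j. C j > 0" "\<And>j h. h \<noteq> 0 \<Longrightarrow> theta_hat \<phi> \<psi> j h \<le> C j * \<bar>of_int h\<bar> powr (- 2 * r)"
  shows "emeasure (uniform_measure lborel unit_cube) {x. ennreal T \<le> shift_error N z u (vec_nth x)}
     \<le> ennreal (((\<Prod>j\<in>u. C j) / T) powr q) * dual_sum (2 * r * q) N z u"
proof (cases "dual_sum (2 * r * q) N z u")
  \<comment> \<open>An infinite series makes the right-hand side infinite, as its factor is
    positive.\<close>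
  case top
  have "((\<Prod>j\<in>u. C j) / T) powr q > 0"
    using C(1) T by (simp add: prod_pos less_imp_neq[symmetric] C(1) prod_zero_iff)
  with top show ?thesis by (simp add: ennreal_mult_top)
next
  case (real s)
  interpret U: prob_space "uniform_measure lborel (unit_cube :: (real^'s) set)" by (rule prob_space_uniform_cube)
  let ?U = "uniform_measure lborel (unit_cube :: (real^'s) set)"
  let ?E = "{x. ennreal T \<le> shift_error N z u (vec_nth x)}"
  let ?C = "\<Prod>j\<in>u. C j"
  have C0: "0 \<le> ?C" using C(1) by (intro prod_nonneg) (simp add: less_imp_le)
  have E: "?E \<in> sets ?U" by simp
  have "ennreal T * emeasure ?U ?E = (\<integral>\<^sup>+x. ennreal T * indicator ?E x \<partial>?U)"
    using E by (rule nn_integral_cmult_indicator[symmetric])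
  also have "\<dots> \<le> (\<integral>\<^sup>+x. shift_error N z u (vec_nth x) \<partial>?U)"
    by (intro nn_integral_mono) (auto simp: indicator_def)
  also have "\<dots> \<le> ennreal (?C * s powr (1 / q))"
    using mean_shift_error_le[OF N q C, of s z u] real by (subst nn_integral_uniform_cube) auto
  finally have "ennreal T * ennreal (U.prob ?E) \<le> ennreal (?C * s powr (1 / q))"
    by (simp only: U.emeasure_eq_measure)
  then have "T * U.prob ?E \<le> ?C * s powr (1 / q)"
    using T C0 by (simp add: ennreal_le_iff flip: ennreal_mult)
  then have le: "U.prob ?E \<le> ?C / T * s powr (1 / q)"
    using T by (simp add: field_simps)
  have "p \<le> p powr q" if "0 \<le> p" "p \<le> 1" for p :: real
    using that q powr_mono'[of q 1 p] by (cases "p = 0") auto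
  from this[OF measure_nonneg U.prob_le_1] have "U.prob ?E \<le> U.prob ?E powr q" .
  also have "\<dots> \<le> (?C / T * s powr (1 / q)) powr q"
    using q le by (intro powr_mono2) auto
  also have "\<dots> = (?C / T) powr q * s"
    using C0 T q real powr_mult[of "?C / T" "s powr (1 / q)" q] by (simp add: powr_powr)
  finally show ?thesis
    unfolding U.emeasure_eq_measure using real by (simp add: ennreal_leI flip: ennreal_mult)
qed

end

lemma generator_vec_set_eq: "{z :: nat ^ 's::finite. \<forall>j. z $ j \<in> generators N} = vec_lambda ` generator_vecs N"
proof
  show "{z :: nat ^ 's. \<forall>j. z $ j \<in> generators N} \<subseteq> vec_lambda ` generator_vecs N"
  proof
    fix z :: "nat ^ 's" assume "z \<in> {z. \<forall>j. z $ j \<in> generators N}"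
    then show "z \<in> vec_lambda ` generator_vecs N"
      by (intro image_eqI[of _ _ "vec_nth z"]) auto
  qed
qed auto

lemma inj_vec_lambda: "inj_on vec_lambda A"
  by (rule inj_onI) (metis vec_lambda_inverse UNIV_I)

lemma vec_nth_vec_lambda: "vec_nth (vec_lambda z) = z"
  by (rule ext) simp

context weighted_setting
begin

text \<open>Does not mention the integrand. With the thresholds of \<open>lattice_error_AE\<close>,
  a sample outside of this set has an error below t for a given function of the unit ball, up to a
  null set that depends on the function.\<close>

definition failure_set :: "nat \<Rightarrow> ('s set \<Rightarrow> real) \<Rightarrow> ((nat ^ 's) \<times> (real ^ 's)) set" where
  "failure_set N T = {(z, x). \<exists>u. u \<noteq> {} \<and> ennreal (T u) \<le> shift_error N (vec_nth z) u (vec_nth x)}"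

lemma failure_set_sets: "failure_set N T \<in> sets (measure_pmf p \<Otimes>\<^sub>M uniform_measure lborel S)"
proof -
  have "failure_set N T = (\<Union>z. \<Union>u\<in>{u. u \<noteq> {}}. {z} \<times> {x. ennreal (T u) \<le> shift_error N (vec_nth z) u (vec_nth x)})"
    by (auto simp: failure_set_def)
  also have "\<dots> \<in> sets (measure_pmf p \<Otimes>\<^sub>M uniform_measure lborel S)"
    using shift_error_set by (intro sets.countable_UN'' sets.countable_UN' pair_measureI) auto
  finally show ?thesis .
qed

text \<open>The tail bound is averaged over the generators and summed over \<open>u\<close>. With n
  = \<open>totient N\<close> there are n^s generator vectors, and the counting contributes n^(s-1)
  times the divisor count d(N). What remains is d(N)/n <= d(N)^2/N, of order N^(\<delta> -
  1).\<close>

proposition failure_probability: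
  fixes C :: "'s \<Rightarrow> real" and \<gamma> :: "'s set \<Rightarrow> real"
  assumes q: "0 < q" "q \<le> 1" "2 * r * q > 1" and \<delta>: "\<delta> > 0" and pos: "\<And>u. \<gamma> u > 0"
    and C: "\<And>j. C j > 0" "\<And>j h. h \<noteq> 0 \<Longrightarrow> theta_hat \<phi> \<psi> j h \<le> C j * \<bar>of_int h\<bar> powr (- 2 * r)"
  shows "\<exists>D>0. \<forall>N\<ge>1. \<forall>t>0.
     emeasure (measure_pmf (pmf_of_set {z. \<forall>j. z $ j \<in> generators N}) \<Otimes>\<^sub>M uniform_measure lborel unit_cube)
       (failure_set N (\<lambda>u. (t / 2 ^ CARD('s))\<^sup>2 / \<gamma> u)) \<le> ennreal (D * t powr (- 2 * q) * real N powr (\<delta> - 1))"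
proof -
  \<comment> \<open>Half of \<delta>, since the divisor count enters twice: through the gcd and
    through the quotient of N and \<open>totient N\<close>.\<close>
  obtain K where K: "K > 0" "\<And>n. n \<ge> 1 \<Longrightarrow> real (divisor_count n) \<le> K * real n powr (\<delta> / 2)"
    using divisor_count_le_powr[of "\<delta> / 2"] \<delta> by auto
  define Z where "Z = enn2real (zeta_ints (2 * r * q))"
  have Z: "zeta_ints (2 * r * q) = ennreal Z" "0 \<le> Z"
    using zeta_ints_finite[OF q(3)] by (simp_all add: Z_def)
  \<comment> \<open>The coefficient of t^(-2q) after inserting the threshold t^2/(4^s \<gamma>),
    together with the zeta factors.\<close>
  define L where "L u = ((\<Prod>j\<in>u. C j) * 4 ^ CARD('s) * \<gamma> u) powr q * Z ^ card u" for u
  have L0: "0 \<le> L u" for u using Z(2) by (simp add: L_def)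
  \<comment> \<open>Adding 1 makes \<open>D\<close> positive, as the sum is only known to be
    nonnegative.\<close>
  define D where "D = K\<^sup>2 * (\<Sum>u\<in>UNIV. L u) + 1"
  have D: "D > 0" using L0 by (simp add: D_def sum_nonneg add_nonneg_pos)
  show ?thesis
  proof (intro exI[of _ D] conjI D allI impI)
    fix N :: nat and t :: real assume N: "N \<ge> 1" and t: "t > 0"
    interpret U: prob_space "uniform_measure lborel (unit_cube :: (real^'s) set)" by (rule prob_space_uniform_cube)
    let ?U = "uniform_measure lborel (unit_cube :: (real^'s) set)"
    let ?G = "{z :: nat ^ 's. \<forall>j. z $ j \<in> generators N}"
    let ?T = "\<lambda>u. (t / 2 ^ CARD('s))\<^sup>2 / \<gamma> u"
    let ?E = "\<lambda>z u. {x. ennreal (?T u) \<le> shift_error N z u (vec_nth x)}"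
    let ?n = "card (generators N)"
    have T: "?T u > 0" for u using t pos by simp
    have n0: "?n > 0" using N by (simp add: card_generators)
    have finG: "finite (generator_vecs N :: ('s \<Rightarrow> nat) set)"
      unfolding generator_vecs_PiE by (intro finite_PiE) auto
    have cardG: "card (generator_vecs N :: ('s \<Rightarrow> nat) set) = ?n ^ CARD('s)"
      unfolding generator_vecs_PiE by (subst card_PiE) auto
    have cG: "finite ?G" "card ?G = ?n ^ CARD('s)"
      unfolding generator_vec_set_eq using finG cardG by (simp_all add: card_image inj_vec_lambda)
    have "card ?G > 0" unfolding cG using n0 by simp
    then have "?G \<noteq> {}" by (metis card.empty less_irrefl)
    note G = cG(1) this cG(2)
    have TL: "((\<Prod>j\<in>u. C j) / ?T u) powr q * Z ^ card u = L u * t powr (- 2 * q)" for u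
    proof -
      have "(\<Prod>j\<in>u. C j) / ?T u = ((\<Prod>j\<in>u. C j) * 4 ^ CARD('s) * \<gamma> u) * t powr (- 2)"
      proof -
        have sq: "(2 ^ n)\<^sup>2 = (4 :: real) ^ n" for n
          by (simp add: power2_eq_square flip: power_mult_distrib)
        have "t powr (- 2) = 1 / t\<^sup>2"
          using t by (simp add: powr_minus_divide)
        then show ?thesis
          by (simp add: power_divide sq)
      qed
      then have "((\<Prod>j\<in>u. C j) / ?T u) powr q = ((\<Prod>j\<in>u. C j) * 4 ^ CARD('s) * \<gamma> u * t powr (- 2)) powr q"
        by (simp only:)
      also have "\<dots> = ((\<Prod>j\<in>u. C j) * 4 ^ CARD('s) * \<gamma> u) powr q * (t powr (- 2)) powr q"
        by (rule powr_mult)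
      finally have "((\<Prod>j\<in>u. C j) / ?T u) powr q = ((\<Prod>j\<in>u. C j) * 4 ^ CARD('s) * \<gamma> u) powr q * (t powr (- 2)) powr q" .
      then show ?thesis
        unfolding L_def by (simp add: powr_powr)
    qed
    have le_u: "(\<Sum>z\<in>generator_vecs N. emeasure ?U (?E z u)) \<le>
       of_nat (?n ^ (CARD('s) - 1)) * of_nat (divisor_count N) * ennreal (L u * t powr (- 2 * q))" if u: "u \<noteq> {}" for u :: "'s set"
    proof -
      have "(\<Sum>z\<in>generator_vecs N. emeasure ?U (?E z u)) \<le>
        (\<Sum>z\<in>generator_vecs N. ennreal (((\<Prod>j\<in>u. C j) / ?T u) powr q) * dual_sum (2 * r * q) N z u)"
        by (intro sum_mono shift_error_tail N q T C)
      also have "\<dots> = ennreal (((\<Prod>j\<in>u. C j) / ?T u) powr q) * (\<Sum>z\<in>generator_vecs N. dual_sum (2 * r * q) N z u)"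
        by (rule sum_distrib_left[symmetric])
      also have "\<dots> \<le> ennreal (((\<Prod>j\<in>u. C j) / ?T u) powr q) *
          (of_nat (?n ^ (CARD('s) - 1)) * (of_nat (divisor_count N) * zeta_ints (2 * r * q) ^ card u))"
        by (intro mult_left_mono mean_dual_sum N q u) simp
      also have "\<dots> = of_nat (?n ^ (CARD('s) - 1)) * of_nat (divisor_count N) * ennreal (L u * t powr (- 2 * q))"
        unfolding TL[symmetric] using Z by (simp add: ennreal_mult ennreal_power mult_ac)
      finally show ?thesis .
    qed
    have E_le: "emeasure ?U (Pair (vec_lambda z) -` failure_set N ?T) \<le> (\<Sum>u\<in>-{{}}. emeasure ?U (?E z u))" for z
    proof -
      have "Pair (vec_lambda z) -` failure_set N ?T = (\<Union>u\<in>-{{}}. ?E z u)"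
        unfolding failure_set_def
        by (rule set_eqI) (simp only: vimage_eq mem_Collect_eq case_prod_conv vec_nth_vec_lambda UN_iff Bex_def Compl_iff singleton_iff)
      moreover have "emeasure ?U (\<Union>u\<in>-{{}}. ?E z u) \<le> (\<Sum>u\<in>-{{}}. emeasure ?U (?E z u))"
        by (intro emeasure_subadditive_finite image_subsetI) (simp_all only: sets_uniform_measure shift_error_set finite)
      ultimately show ?thesis by (simp only:)
    qed
    have "emeasure (measure_pmf (pmf_of_set ?G) \<Otimes>\<^sub>M ?U) (failure_set N ?T) =
       (\<integral>\<^sup>+z. emeasure ?U (Pair z -` failure_set N ?T) \<partial>measure_pmf (pmf_of_set ?G))"
      by (rule U.emeasure_pair_measure_alt[OF failure_set_sets])
    also have "\<dots> = (\<Sum>z\<in>?G. emeasure ?U (Pair z -` failure_set N ?T)) / of_nat (card ?G)"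
      using G by (subst nn_integral_pmf_of_set) auto
    also have "\<dots> \<le> (\<Sum>u\<in>-{{}}. of_nat (?n ^ (CARD('s) - 1)) * of_nat (divisor_count N) * ennreal (L u * t powr (- 2 * q))) / of_nat (card ?G)"
    proof (intro divide_right_mono_ennreal)
      have "(\<Sum>z\<in>?G. emeasure ?U (Pair z -` failure_set N ?T)) =
          (\<Sum>z\<in>generator_vecs N. emeasure ?U (Pair (vec_lambda z) -` failure_set N ?T))"
        unfolding generator_vec_set_eq by (rule sum.reindex_cong[OF inj_vec_lambda refl refl])
      also have "\<dots> \<le> (\<Sum>z\<in>generator_vecs N. \<Sum>u\<in>-{{}}. emeasure ?U (?E z u))"
        by (intro sum_mono E_le)
      also have "\<dots> = (\<Sum>u\<in>-{{}}. \<Sum>z\<in>generator_vecs N. emeasure ?U (?E z u))"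
        by (rule sum.swap)
      also have "\<dots> \<le> (\<Sum>u\<in>-{{}}. of_nat (?n ^ (CARD('s) - 1)) * of_nat (divisor_count N) * ennreal (L u * t powr (- 2 * q)))"
        by (intro sum_mono le_u) simp
      finally show "(\<Sum>z\<in>?G. emeasure ?U (Pair z -` failure_set N ?T)) \<le> \<dots>" .
    qed
    also have "\<dots> = ennreal ((\<Sum>u\<in>-{{}}. real (?n ^ (CARD('s) - 1)) * real (divisor_count N) * (L u * t powr (- 2 * q))) / real (card ?G))"
    proof -
      have "(\<Sum>u\<in>-{{}}. of_nat (?n ^ (CARD('s) - 1)) * of_nat (divisor_count N) * ennreal (L u * t powr (- 2 * q))) =
         ennreal (\<Sum>u\<in>-{{}}. real (?n ^ (CARD('s) - 1)) * real (divisor_count N) * (L u * t powr (- 2 * q)))"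
        using L0 by (subst sum_ennreal[symmetric]) (auto intro!: sum.cong simp: ennreal_mult ennreal_of_nat_eq_real_of_nat)
      then show ?thesis
        using G n0 L0 by (simp add: ennreal_of_nat_eq_real_of_nat divide_ennreal sum_nonneg del: of_nat_power of_nat_mult)
    qed
    also have "\<dots> \<le> ennreal (D * t powr (- 2 * q) * real N powr (\<delta> - 1))"
    proof (rule ennreal_leI)
      let ?S = "\<Sum>u\<in>-{{}}. L u"
      have S: "0 \<le> ?S" "K\<^sup>2 * ?S \<le> D"
      proof -
        show "0 \<le> ?S" by (intro sum_nonneg L0)
        have "K\<^sup>2 * ?S \<le> K\<^sup>2 * (\<Sum>u\<in>UNIV. L u)"
          by (intro mult_left_mono sum_mono2 L0) simp_all
        then show "K\<^sup>2 * ?S \<le> D" by (simp add: D_def)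
      qed
      have d: "real (divisor_count N) / real ?n \<le> K\<^sup>2 * real N powr (\<delta> - 1)"
      proof -
        let ?d = "real (divisor_count N)"
        have "real N \<le> real ?n * ?d"
          using le_totient_times_divisor_count[OF N] N by (simp add: card_generators flip: of_nat_mult)
        then have "?d / real ?n \<le> ?d\<^sup>2 / real N"
          using N n0 mult_left_mono[of "real N" "real ?n * ?d" ?d] by (simp add: divide_simps power2_eq_square mult_ac)
        also have "\<dots> \<le> (K * real N powr (\<delta> / 2))\<^sup>2 / real N"
          using K N by (intro divide_right_mono power_mono) auto
        also have "\<dots> = K\<^sup>2 * real N powr (\<delta> - 1)"
          using N by (simp add: power_mult_distrib powr_diff power2_eq_square flip: powr_add)
        finally show ?thesis .
      qed
      have "(\<Sum>u\<in>-{{}}. real (?n ^ (CARD('s) - 1)) * real (divisor_count N) * (L u * t powr (- 2 * q))) / real (card ?G) =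
         ?S * t powr (- 2 * q) * (real (divisor_count N) * (real ?n ^ (CARD('s) - 1) / real ?n ^ CARD('s)))"
        using G(3) by (simp add: sum_distrib_left sum_distrib_right sum_divide_distrib mult_ac)
      also have "real ?n ^ (CARD('s) - 1) / real ?n ^ CARD('s) = 1 / real ?n"
        using n0 by (cases "CARD('s)") auto
      also have "?S * t powr (- 2 * q) * (real (divisor_count N) * (1 / real ?n)) \<le> ?S * t powr (- 2 * q) * (K\<^sup>2 * real N powr (\<delta> - 1))"
        using d S by (intro mult_left_mono) auto
      also have "\<dots> = (K\<^sup>2 * ?S) * (t powr (- 2 * q) * real N powr (\<delta> - 1))"
        by (simp add: mult_ac)
      also have "\<dots> \<le> D * (t powr (- 2 * q) * real N powr (\<delta> - 1))"
        using S by (intro mult_right_mono) auto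
      finally show "(\<Sum>u\<in>-{{}}. real (?n ^ (CARD('s) - 1)) * real (divisor_count N) * (L u * t powr (- 2 * q))) / real (card ?G)
         \<le> D * t powr (- 2 * q) * real N powr (\<delta> - 1)"
        by (simp add: mult_ac)
    qed
    finally show "emeasure (measure_pmf (pmf_of_set ?G) \<Otimes>\<^sub>M ?U) (failure_set N ?T)
       \<le> ennreal (D * t powr (- 2 * q) * real N powr (\<delta> - 1))" .
  qed
qed

end

section \<open>From one sample to the median\<close>

context weighted_setting
begin

text \<open>A sample is bad if it lies in the failure set or in the null set belonging to
  \<open>f\<close>, hence with probability at most \<rho>/4. For k = 2m + 1 the union bound gives
  4^m (\<rho>/4)^(m+1) = \<rho>^(m+1)/4, where 4^m bounds the binomial coefficient.\<close>

proposition median_tail: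
  assumes f: "f \<in> sobolev_space \<phi> \<gamma> \<psi>" "sobolev_norm \<phi> \<gamma> \<psi> f \<le> 1" and pos: "\<And>u. \<gamma> u > 0"
    and N: "N \<ge> 1" and k: "odd k" and t: "t > 0" and \<rho>: "0 < \<rho>"
    and fail: "emeasure (measure_pmf (pmf_of_set {z. \<forall>j. z $ j \<in> generators N}) \<Otimes>\<^sub>M uniform_measure lborel unit_cube)
       (failure_set N (\<lambda>u. (t / 2 ^ CARD('s))\<^sup>2 / \<gamma> u)) \<le> ennreal (\<rho> / 4)"
  shows "\<P>(\<omega> in sample_space N k. t \<le> \<bar>median_estimator \<phi> f N k \<omega> - weighted_integral \<phi> f\<bar>)
     \<le> \<rho> powr (real (k + 1) / 2) / 4"
proof -
  interpret U: prob_space "uniform_measure lborel (unit_cube :: (real^'s) set)" by (rule prob_space_uniform_cube)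
  let ?U = "uniform_measure lborel (unit_cube :: (real^'s) set)"
  let ?Z = "measure_pmf (pmf_of_set {z :: nat ^ 's. \<forall>j. z $ j \<in> generators N})"
  let ?M = "?Z \<Otimes>\<^sub>M ?U"
  let ?F = "failure_set N (\<lambda>u. (t / 2 ^ CARD('s))\<^sup>2 / \<gamma> u)"
  let ?err = "\<lambda>z x. \<bar>lattice_rule \<phi> f N z x - weighted_integral \<phi> f\<bar>"
  interpret Z: prob_space ?Z by (rule prob_space_measure_pmf)
  interpret M: pair_prob_space ?Z ?U by standard
  have "AE x in ?U. (z, x) \<notin> ?F \<longrightarrow> ?err z x < t" for z
  proof (rule AE_uniform_measureI[OF unit_cube_sets])
    have "AE y in LP UNIV. (\<forall>j. y j \<in> {0..<1}) \<longrightarrow>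
       (\<forall>u. u \<noteq> {} \<longrightarrow> shift_error N (vec_nth z) u y < ennreal ((t / 2 ^ CARD('s))\<^sup>2 / \<gamma> u)) \<longrightarrow>
       \<bar>lattice_rule \<phi> f N (vec_lambda (vec_nth z)) (vec_lambda y) - weighted_integral \<phi> f\<bar> < t"
      by (rule lattice_error_AE[OF f pos N t])
    from AE_vec_nth[OF this] AE_component_less_one
    show "AE x in lborel. x \<in> unit_cube \<longrightarrow> (z, x) \<notin> ?F \<longrightarrow> ?err z x < t"
    proof eventually_elim
      case (elim x)
      show ?case
      proof (intro impI)
        assume x: "x \<in> unit_cube" and nF: "(z, x) \<notin> ?F"
        have "\<forall>u. u \<noteq> {} \<longrightarrow> shift_error N (vec_nth z) u (vec_nth x) < ennreal ((t / 2 ^ CARD('s))\<^sup>2 / \<gamma> u)"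
          using nF unfolding failure_set_def by (simp only: mem_Collect_eq case_prod_conv not_ex de_Morgan_conj not_le) blast
        moreover have "\<forall>j. x $ j \<in> {0..<1}" using elim(2) x by (rule mp)
        ultimately show "?err z x < t"
          using elim(1) by (simp only: vec_nth_inverse simp_thms)
      qed
    qed
  qed
  then have "AE (z, x) in ?M. (z, x) \<notin> ?F \<longrightarrow> ?err z x < t"
    by (intro AE_pair_countable U.sigma_finite_measure_axioms)
  then obtain E where E: "{w \<in> space ?M. \<not> (case w of (z, x) \<Rightarrow> (z, x) \<notin> ?F \<longrightarrow> ?err z x < t)} \<subseteq> E"
      "emeasure ?M E = 0" "E \<in> sets ?M"
    by (rule AE_E)
  have null: "E \<in> null_sets ?M" using E(2,3) by (rule null_setsI)
  let ?B = "?F \<union> E"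
  have B: "?B \<in> sets ?M"
    by (rule sets.Un[OF failure_set_sets E(3)])
  have "emeasure ?M ?B = emeasure ?M ?F"
    by (rule emeasure_Un_null_set[OF failure_set_sets null])
  with fail have "ennreal (measure ?M ?B) \<le> ennreal (\<rho> / 4)"
    by (simp only: M.emeasure_eq_measure)
  then have pB: "measure ?M ?B \<le> \<rho> / 4"
    using \<rho> by (simp only: ennreal_le_iff)
  obtain m where m: "k = Suc (2 * m)" using k by (auto elim: oddE)
  let ?A = "{\<omega> \<in> space (sample_space N k). t \<le> \<bar>median_estimator \<phi> f N k \<omega> - weighted_integral \<phi> f\<bar>}"
  let ?x = "\<lambda>\<omega> l. lattice_rule \<phi> f N (fst (\<omega> l)) (snd (\<omega> l))"
  have "measure (PiM {1..k} (\<lambda>_. ?M)) ?A \<le> real (card {1..k} choose Suc m) * (\<rho> / 4) ^ Suc m"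
  proof (rule prob_many_components_le[OF M.prob_space_axioms B pB])
    fix \<omega> assume w: "\<omega> \<in> ?A"
    then have sp: "\<omega> \<in> space (PiM {1..k} (\<lambda>_. ?M))" by (simp only: sample_space_def mem_Collect_eq)
    have "t \<le> \<bar>median (map (?x \<omega>) [1..<k+1]) - weighted_integral \<phi> f\<bar>"
      using w by (simp only: median_estimator_def mem_Collect_eq)
    from median_error_count[OF k this]
    have "Suc m \<le> card {l \<in> {1..k}. t \<le> \<bar>?x \<omega> l - weighted_integral \<phi> f\<bar>}"
      using m by simp
    also have "card {l \<in> {1..k}. t \<le> \<bar>?x \<omega> l - weighted_integral \<phi> f\<bar>} \<le> card {l \<in> {1..k}. \<omega> l \<in> ?B}"
    proof (intro card_mono subsetI)
      fix l assume l: "l \<in> {l \<in> {1..k}. t \<le> \<bar>?x \<omega> l - weighted_integral \<phi> f\<bar>}"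
      then have "\<omega> l \<in> space ?M" using sp by (auto simp: space_PiM)
      moreover obtain z x where zx: "\<omega> l = (z, x)" by (cases "\<omega> l")
      ultimately have sp_zx: "(z, x) \<in> space ?M" by (simp only:)
      have err: "l \<in> {1..k}" "t \<le> ?err z x"
        using l by (simp_all add: zx)
      have "(z, x) \<in> E" if nF: "(z, x) \<notin> ?F"
      proof (rule subsetD[OF E(1)])
        show "(z, x) \<in> {w \<in> space ?M. \<not> (case w of (z, x) \<Rightarrow> (z, x) \<notin> ?F \<longrightarrow> ?err z x < t)}"
          using sp_zx err(2) nF by (simp only: mem_Collect_eq case_prod_conv not_less not_imp simp_thms)
      qed
      then show "l \<in> {l \<in> {1..k}. \<omega> l \<in> ?B}"
        unfolding mem_Collect_eq zx using err(1) by (intro conjI) blast+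
    qed simp
    finally show "\<omega> \<in> space (PiM {1..k} (\<lambda>_. ?M)) \<and> Suc m \<le> card {l \<in> {1..k}. \<omega> l \<in> ?B}"
      using sp by simp
  qed simp
  also have "real (card {1..k} choose Suc m) * (\<rho> / 4) ^ Suc m \<le> 4 ^ m * (\<rho> / 4) ^ Suc m"
  proof (rule mult_right_mono)
    have "real (Suc (2 * m) choose Suc m) \<le> real (4 ^ m)"
      by (simp only: of_nat_le_iff middle_binomial_le)
    then show "real (card {1..k} choose Suc m) \<le> 4 ^ m" unfolding m by simp
  qed (use \<rho> in simp)
  also have "4 ^ m * (\<rho> / 4) ^ Suc m = \<rho> ^ Suc m / 4"
    by (simp add: power_divide)
  also have "\<rho> ^ Suc m / 4 = \<rho> powr (real (k + 1) / 2) / 4"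
  proof -
    have "real (k + 1) / 2 = real (Suc m)" by (simp add: m)
    then show ?thesis using \<rho> by (simp only: powr_realpow)
  qed
  finally show ?thesis by (simp only: sample_space_def)
qed

end

theorem corollary3p6:
  fixes \<phi> :: "real \<Rightarrow> real"
    and \<gamma> :: "'s::finite set \<Rightarrow> real"
    and \<psi> :: "'s \<Rightarrow> real \<Rightarrow> real"
    and r \<epsilon> :: real
  assumes "prob_density \<phi>"
    and "dist_invertible \<phi>"
    and "\<And>u. \<gamma> u > 0" and "\<gamma> {} = 1"
    and "\<And>j y. \<psi> j y > 0" and "\<And>j. \<psi> j \<in> borel_measurable borel"
    and "weights_admissible \<phi> \<psi>"
    and "r > 1 / 2"
    and "\<And>j. \<exists>C>0. \<exists>q\<ge>r. \<forall>h::int. h \<noteq> 0 \<longrightarrow>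
               theta_hat \<phi> \<psi> j h \<le> C * \<bar>real_of_int h\<bar> powr (- 2 * q)"
    and "0 < \<epsilon>" and "\<epsilon> \<le> r - 1 / 2"
  shows "\<exists>c>0. \<forall>(N::nat) (k::nat) (\<rho>::real).
           N \<ge> 1 \<longrightarrow> odd k \<longrightarrow> k \<ge> 3 \<longrightarrow> 0 < \<rho> \<longrightarrow> \<rho> < 1 \<longrightarrow>
           (SUP f \<in> {f \<in> sobolev_space \<phi> \<gamma> \<psi>. sobolev_norm \<phi> \<gamma> \<psi> f \<le> 1}.
              \<P>(\<omega> in sample_space N k.
                 \<bar>median_estimator \<phi> f N k \<omega> - weighted_integral \<phi> f\<bar>
                   \<ge> c / \<rho> powr (1 / 2 + r - \<epsilon>) * real N powr (- r + \<epsilon>)))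
           \<le> \<rho> powr (real (k + 1) / 2) / 4"
proof -
  interpret weighted_setting \<phi> \<psi>
    by standard (fact assms)+
  \<comment> \<open>t is of order N^(-\<alpha>/2), so t^(-2q) contributes N^(\<alpha>q), which
    N^(\<delta> - 1) has to cancel; this fixes \<delta>. Positivity of \<delta> asks for q <
    1/\<alpha>, convergence of the zeta series for q > 1/(2r), and the power of \<rho> for q >= 1/(1
    + \<alpha>). With q = 1/(\<alpha> + \<eta>) these conditions read \<eta> > 0, \<eta> <
    2\<epsilon> and \<eta> <= 1.\<close>
  define \<alpha> where "\<alpha> = 2 * (r - \<epsilon>)"
  define \<eta> where "\<eta> = min 1 \<epsilon>"
  define q where "q = 1 / (\<alpha> + \<eta>)"
  define \<delta> where "\<delta> = 1 - \<alpha> * q"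
  \<comment> \<open>This is the assumption \<epsilon> <= r - 1/2; it yields q <= 1.\<close>
  have \<alpha>: "\<alpha> \<ge> 1" using assms(11) by (simp add: \<alpha>_def)
  have \<eta>: "0 < \<eta>" "\<eta> \<le> 1" "\<eta> \<le> \<epsilon>" using assms(10) by (auto simp: \<eta>_def)
  have q: "0 < q" "q \<le> 1" "1 \<le> q * (1 + \<alpha>)" "\<alpha> * q < 1"
    unfolding q_def using \<alpha> \<eta> by (simp_all add: divide_simps)
  have q': "2 * r * q > 1"
    unfolding q_def using \<alpha> \<eta> assms(10) by (simp add: divide_simps \<alpha>_def)
  \<comment> \<open>As |h| >= 1, decay with an exponent larger than r implies decay with r
    itself.\<close>
  have "\<exists>C>0. \<forall>h. h \<noteq> 0 \<longrightarrow> theta_hat \<phi> \<psi> j h \<le> C * \<bar>of_int h\<bar> powr (- 2 * r)" for j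
  proof -
    obtain C q where C: "C > 0" "q \<ge> r" "\<And>h. h \<noteq> 0 \<Longrightarrow> theta_hat \<phi> \<psi> j h \<le> C * \<bar>of_int h\<bar> powr (- 2 * q)"
      using assms(9) by metis
    have "theta_hat \<phi> \<psi> j h \<le> C * \<bar>of_int h\<bar> powr (- 2 * r)" if "h \<noteq> 0" for h
    proof (rule order_trans[OF C(3)[OF that]])
      show "C * \<bar>of_int h\<bar> powr (- 2 * q) \<le> C * \<bar>of_int h\<bar> powr (- 2 * r)"
        using C(1,2) that by (intro mult_left_mono[of "_ powr _"] powr_mono) simp_all
    qed
    with C(1) show ?thesis by blast
  qed
  then obtain C where C: "\<And>j. C j > 0" "\<And>j h. h \<noteq> 0 \<Longrightarrow> theta_hat \<phi> \<psi> j h \<le> C j * \<bar>of_int h\<bar> powr (- 2 * r)"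
    by metis
  have "\<delta> > 0" using q by (simp add: \<delta>_def)
  then have "\<exists>D>0. \<forall>N\<ge>1. \<forall>t>0.
     emeasure (measure_pmf (pmf_of_set {z. \<forall>j. z $ j \<in> generators N}) \<Otimes>\<^sub>M uniform_measure lborel unit_cube)
       (failure_set N (\<lambda>u. (t / 2 ^ CARD('s))\<^sup>2 / \<gamma> u)) \<le> ennreal (D * t powr (- 2 * q) * real N powr (\<delta> - 1))"
    by (intro failure_probability[where C=C and r=r] q(1,2) q' assms(3) C)
  then obtain D where D: "D > 0" "\<forall>N\<ge>1. \<forall>t>0.
     emeasure (measure_pmf (pmf_of_set {z. \<forall>j. z $ j \<in> generators N}) \<Otimes>\<^sub>M uniform_measure lborel unit_cube)
       (failure_set N (\<lambda>u. (t / 2 ^ CARD('s))\<^sup>2 / \<gamma> u)) \<le> ennreal (D * t powr (- 2 * q) * real N powr (\<delta> - 1))"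
    by (elim exE conjE)
  \<comment> \<open>Chosen so that D c^(-2q) = 1/4.\<close>
  define c where "c = (4 * D) powr (1 / (2 * q))"
  have c: "c > 0" using D(1) by (simp add: c_def)
  show ?thesis
  proof (intro exI[of _ c] conjI c allI impI)
    fix N k :: nat and \<rho> :: real
    assume N: "N \<ge> 1" and k: "odd k" and \<rho>: "0 < \<rho>" "\<rho> < 1"
    define t where "t = c / \<rho> powr (1 / 2 + r - \<epsilon>) * real N powr (- r + \<epsilon>)"
    have t: "t > 0" using c \<rho> N by (simp add: t_def)
    have tq: "t powr (- 2 * q) = c powr (- 2 * q) * \<rho> powr (q * (1 + \<alpha>)) * real N powr (\<alpha> * q)"
    proof -
      have e: "- (1 / 2 + r - \<epsilon>) * (- 2 * q) = q * (1 + \<alpha>)" "(- r + \<epsilon>) * (- 2 * q) = \<alpha> * q"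
        by (simp_all add: \<alpha>_def algebra_simps)
      have "t = c * \<rho> powr - (1 / 2 + r - \<epsilon>) * real N powr (- r + \<epsilon>)"
        unfolding t_def by (simp only: powr_minus divide_inverse)
      then show ?thesis
        by (simp only: powr_mult powr_powr e)
    qed
    have Nq: "real N powr (\<alpha> * q) * real N powr (\<delta> - 1) = 1"
      using N by (simp add: \<delta>_def flip: powr_add)
    have cq: "D * c powr (- 2 * q) = 1 / 4"
    proof -
      have "1 / (2 * q) * (- 2 * q) = - 1" using q(1) by simp
      then have "c powr (- 2 * q) = (4 * D) powr - 1"
        unfolding c_def powr_powr by (simp only:)
      then show ?thesis using D(1) by (simp add: powr_minus_divide)
    qed
    have "D * t powr (- 2 * q) * real N powr (\<delta> - 1) =
        (D * c powr (- 2 * q)) * \<rho> powr (q * (1 + \<alpha>)) * (real N powr (\<alpha> * q) * real N powr (\<delta> - 1))"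
      unfolding tq by (simp only: mult_ac)
    also have "\<dots> = 1 / 4 * \<rho> powr (q * (1 + \<alpha>))"
      by (simp only: Nq cq mult_1_right)
    \<comment> \<open>The exponent of \<rho> is at least 1, and \<rho> < 1.\<close>
    also have "\<dots> \<le> \<rho> / 4"
      using \<rho> powr_mono'[OF q(3), of \<rho>] by simp
    finally have "ennreal (D * t powr (- 2 * q) * real N powr (\<delta> - 1)) \<le> ennreal (\<rho> / 4)"
      by (rule ennreal_leI)
    from order_trans[OF D(2)[rule_format, OF N t] this]
    have fail: "emeasure (measure_pmf (pmf_of_set {z. \<forall>j. z $ j \<in> generators N}) \<Otimes>\<^sub>M uniform_measure lborel unit_cube)
       (failure_set N (\<lambda>u. (t / 2 ^ CARD('s))\<^sup>2 / \<gamma> u)) \<le> ennreal (\<rho> / 4)" .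
    show "(SUP f \<in> {f \<in> sobolev_space \<phi> \<gamma> \<psi>. sobolev_norm \<phi> \<gamma> \<psi> f \<le> 1}.
        \<P>(\<omega> in sample_space N k. c / \<rho> powr (1 / 2 + r - \<epsilon>) * real N powr (- r + \<epsilon>)
           \<le> \<bar>median_estimator \<phi> f N k \<omega> - weighted_integral \<phi> f\<bar>))
        \<le> \<rho> powr (real (k + 1) / 2) / 4"
      unfolding t_def[symmetric]
    proof (rule cSUP_least)
      show "{f \<in> sobolev_space \<phi> \<gamma> \<psi>. sobolev_norm \<phi> \<gamma> \<psi> f \<le> 1} \<noteq> {}"
      proof -
        have "(\<lambda>_. 0) \<in> {f \<in> sobolev_space \<phi> \<gamma> \<psi>. sobolev_norm \<phi> \<gamma> \<psi> f \<le> 1}"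
          using zero_in_sobolev_space[of \<gamma>] by simp
        then show ?thesis by blast
      qed
    next
      fix f assume "f \<in> {f \<in> sobolev_space \<phi> \<gamma> \<psi>. sobolev_norm \<phi> \<gamma> \<psi> f \<le> 1}"
      then have "f \<in> sobolev_space \<phi> \<gamma> \<psi>" "sobolev_norm \<phi> \<gamma> \<psi> f \<le> 1" by simp_all
      then show "\<P>(\<omega> in sample_space N k. t \<le> \<bar>median_estimator \<phi> f N k \<omega> - weighted_integral \<phi> f\<bar>)
          \<le> \<rho> powr (real (k + 1) / 2) / 4"
        by (rule median_tail[OF _ _ assms(3) N k t \<rho>(1) fail])
    qed
  qed
qed

end
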